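(* Let $S$ be a complex disc centered at $0$ with coordinate $s$, and let $f\colon X\to S$ be a proper flat morphism from a complex manifold $X$, with connected fibers of dimension $n$, smooth over $S\setminus\{0\}$, whose smooth fibers have trivial canonical bundle. Suppose that $n\ge2$ and that $f$ has only ordinary quadratic singularities in $X_0$. Then $\alpha=\beta=0$, where $\alpha,\beta$ are the coefficients in the asymptotics $$-\log\|\eta\|^2_{L^2}=\alpha\log|s|^2-\beta\log\bigl|\log|s|^2\bigr|+O(1)\qquad(s\to0)$$ of the $L^2$-norm of a local holomorphic frame $\eta$ of $f_\ast K_{X/S}$ near $0$.
   Context: $K_{X/S}=K_X\otimes f^\ast K_S^{-1}$; under the hypotheses $f_\ast K_{X/S}$ is a line bundle, with $L^2$-metric $\|\eta\|^2_{L^2,s}=(2\pi)^{-n}\left|\int_{X_s}\eta\wedge\overline\eta\right|$ for $s\ne0$. The coefficients are given by $\alpha=1-c$ and $\beta=b-1$, where, on a model obtained by blowing up along smooth centers in the special fiber so that $X_0=\sum_ja_jE_j$ has smooth components with normal crossings, and with $\sum_j(b_j-1)E_j$ the zero divisor of the evaluation map $f^\ast f_\ast K_{X/S}\to K_{X/S}$ on that model, $c=\min_jb_j/a_j$ and $b=\max\{\sharp J\mid\bigcap_{j\in J}E_j\ne\emptyset,\ b_j/a_j=c\ \forall j\in J\}$. An ordinary quadratic singularity of $f$ is a point of $X$ near which $f$ is the germ of a holomorphic function with an isolated critical point with invertible Hessian; equivalently, in suitable local coordinates, $f=\sum_{i=0}^{n}z_i^2$. *)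

theory Defs
  imports "HOL-Complex_Analysis.Complex_Analysis" "HOL-Library.Landau_Symbols"
begin

text \<open>
  Complex manifolds are given by a topology and an atlas. A chart is a pair \<open>(U, \<phi>)\<close> of its
  domain and its coordinate map. A manifold of dimension \<open>n + 1\<close> is modelled on
  \<open>complex ^ 'n option\<close> with \<open>n = CARD('n)\<close>, its fibres over a curve on \<open>complex ^ 'n\<close>.
\<close>

subsection \<open>Holomorphic functions of several variables\<close>

definition hol_fun :: "(complex ^ 'm::finite \<Rightarrow> complex) \<Rightarrow> (complex ^ 'm) set \<Rightarrow> bool" where
  "hol_fun F U \<longleftrightarrow>
     (\<forall>z\<in>U. \<exists>D. (F has_derivative D) (at z) \<and> (\<forall>a v. D (a *s v) = a * D v))"

definition hol_map :: "(complex ^ 'm::finite \<Rightarrow> complex ^ 'k) \<Rightarrow> (complex ^ 'm) set \<Rightarrow> bool" where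
  "hol_map F U \<longleftrightarrow> (\<forall>i. hol_fun (\<lambda>z. F z $ i) U)"

definition cpartial :: "'m::finite \<Rightarrow> (complex ^ 'm \<Rightarrow> complex) \<Rightarrow> complex ^ 'm \<Rightarrow> complex" where
  "cpartial i F z = deriv (\<lambda>t. F (z + axis i t)) 0"

definition cjacobian :: "(complex ^ 'm::finite \<Rightarrow> complex ^ 'k) \<Rightarrow> complex ^ 'm \<Rightarrow> complex ^ 'm ^ 'k" where
  "cjacobian F z = (\<chi> i j. cpartial j (\<lambda>w. F w $ i) z)"

definition chessian :: "(complex ^ 'm::finite \<Rightarrow> complex) \<Rightarrow> complex ^ 'm \<Rightarrow> complex ^ 'm ^ 'm" where
  "chessian F z = (\<chi> i j. cpartial i (cpartial j F) z)"

subsection \<open>Complex manifolds\<close>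

type_synonym ('a, 'm) chart = "'a set \<times> ('a \<Rightarrow> complex ^ 'm)"

definition chart_inv :: "('a, 'm::finite) chart \<Rightarrow> complex ^ 'm \<Rightarrow> 'a" where
  "chart_inv c = inv_into (fst c) (snd c)"

definition topological_chart :: "'a topology \<Rightarrow> ('a, 'm::finite) chart \<Rightarrow> bool" where
  "topological_chart X c \<longleftrightarrow>
     openin X (fst c) \<and> open (snd c ` fst c) \<and>
     homeomorphic_map (subtopology X (fst c)) (top_of_set (snd c ` fst c)) (snd c)"

definition complex_manifold :: "'a topology \<Rightarrow> ('a, 'm::finite) chart set \<Rightarrow> bool" where
  "complex_manifold X A \<longleftrightarrow>
     Hausdorff_space X \<and> second_countable X \<and>
     (\<forall>c\<in>A. topological_chart X c) \<and> (\<Union>c\<in>A. fst c) = topspace X \<and>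
     (\<forall>c\<in>A. \<forall>d\<in>A. hol_map (snd d \<circ> chart_inv c) (snd c ` (fst c \<inter> fst d)))"

definition hol_fun_on :: "('a, 'm::finite) chart set \<Rightarrow> ('a \<Rightarrow> complex) \<Rightarrow> 'a set \<Rightarrow> bool" where
  "hol_fun_on A g W \<longleftrightarrow> (\<forall>c\<in>A. hol_fun (g \<circ> chart_inv c) (snd c ` (fst c \<inter> W)))"

definition critical_point :: "('a, 'm::finite) chart set \<Rightarrow> ('a \<Rightarrow> complex) \<Rightarrow> 'a \<Rightarrow> bool" where
  "critical_point A f x \<longleftrightarrow>
     (\<forall>c\<in>A. x \<in> fst c \<longrightarrow> (\<forall>i. cpartial i (f \<circ> chart_inv c) (snd c x) = 0))"

definition ordinary_quadratic_singularity ::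
    "'a topology \<Rightarrow> ('a, 'm::finite) chart set \<Rightarrow> ('a \<Rightarrow> complex) \<Rightarrow> 'a \<Rightarrow> bool" where
  "ordinary_quadratic_singularity X A f x \<longleftrightarrow>
     critical_point A f x \<and>
     (\<exists>W. openin X W \<and> x \<in> W \<and> (\<forall>y\<in>W. critical_point A f y \<longrightarrow> y = x)) \<and>
     (\<exists>c\<in>A. x \<in> fst c \<and> invertible (chessian (f \<circ> chart_inv c) (snd c x)))"

text \<open>
  Flatness of the local ring of \<open>X\<close> at \<open>x\<close> over that of the complex line at \<open>f x\<close>: every linear
  relation \<open>(\<Sum>i<k. a i * m i) = 0\<close> with coefficients \<open>a i\<close> from the base is a consequence
  of relations over the base. Germs are represented by functions on neighbourhoods.
\<close>

definition flat_at :: "'a topology \<Rightarrow> ('a, 'm::finite) chart set \<Rightarrow> ('a \<Rightarrow> complex) \<Rightarrow> 'a \<Rightarrow> bool" where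
  "flat_at X A f x \<longleftrightarrow>
     (\<forall>(k::nat) (a :: nat \<Rightarrow> complex \<Rightarrow> complex) (m :: nat \<Rightarrow> 'a \<Rightarrow> complex) V W.
        open V \<and> f x \<in> V \<and> openin X W \<and> x \<in> W \<and> f ` W \<subseteq> V \<and>
        (\<forall>i<k. a i holomorphic_on V \<and> hol_fun_on A (m i) W) \<and>
        (\<forall>y\<in>W. (\<Sum>i<k. a i (f y) * m i y) = 0)
        \<longrightarrow>
        (\<exists>(l::nat) (b :: nat \<Rightarrow> nat \<Rightarrow> complex \<Rightarrow> complex) (u :: nat \<Rightarrow> 'a \<Rightarrow> complex) V' W'.
           open V' \<and> f x \<in> V' \<and> V' \<subseteq> V \<and> openin X W' \<and> x \<in> W' \<and> W' \<subseteq> W \<and> f ` W' \<subseteq> V' \<and>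
           (\<forall>i<k. \<forall>j<l. b i j holomorphic_on V') \<and> (\<forall>j<l. hol_fun_on A (u j) W') \<and>
           (\<forall>i<k. \<forall>y\<in>W'. m i y = (\<Sum>j<l. b i j (f y) * u j y)) \<and>
           (\<forall>j<l. \<forall>t\<in>V'. (\<Sum>i<k. a i t * b i j t) = 0)))"

subsection \<open>The canonical bundle\<close>

text \<open>
  A section over the open set \<open>W\<close> of the canonical bundle of a manifold with atlas \<open>A\<close> is given by
  its coefficients: in the chart \<open>c\<close> with coordinates \<open>z\<close> it is \<open>\<omega> c dz\<^sub>1 \<and> \<dots> \<and> dz\<^sub>m\<close>. The
  values of \<open>\<omega> c\<close> outside \<open>fst c \<inter> W\<close> are irrelevant.
\<close>

definition canonical_section ::
    "('a, 'm::finite) chart set \<Rightarrow> 'a set \<Rightarrow> (('a, 'm) chart \<Rightarrow> 'a \<Rightarrow> complex) \<Rightarrow> bool" where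
  "canonical_section A W \<omega> \<longleftrightarrow>
     (\<forall>c\<in>A. hol_fun (\<omega> c \<circ> chart_inv c) (snd c ` (fst c \<inter> W))) \<and>
     (\<forall>c\<in>A. \<forall>d\<in>A. \<forall>x\<in>fst c \<inter> fst d \<inter> W.
        \<omega> c x = det (cjacobian (snd d \<circ> chart_inv c) (snd c x)) * \<omega> d x)"

definition trivial_canonical_bundle :: "('a, 'm::finite) chart set \<Rightarrow> 'a set \<Rightarrow> bool" where
  "trivial_canonical_bundle A M \<longleftrightarrow>
     (\<exists>\<omega>. canonical_section A M \<omega> \<and> (\<forall>c\<in>A. \<forall>x\<in>fst c \<inter> M. \<omega> c x \<noteq> 0))"

text \<open>
  \<open>\<bar>\<theta>\<bar>\<^sup>2\<close> is a nonnegative density. Its integral is the supremum of its finite sums over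
  pairwise disjoint Borel pieces lying in charts; on a compact manifold the supremum is attained
  by every finite partition into such pieces.
\<close>

definition density_integral ::
    "('a, 'n::finite) chart set \<Rightarrow> (('a, 'n) chart \<Rightarrow> 'a \<Rightarrow> complex) \<Rightarrow> ennreal" where
  "density_integral B \<theta> =
     (SUP P \<in> {P. finite P \<and>
                 (\<forall>(d, E)\<in>P. d \<in> B \<and> E \<subseteq> fst d \<and> snd d ` E \<in> sets borel) \<and>
                 (\<forall>p\<in>P. \<forall>q\<in>P. p \<noteq> q \<longrightarrow> snd p \<inter> snd q = {})}.
        \<Sum>(d, E)\<in>P. \<integral>\<^sup>+ z \<in> snd d ` E. ennreal ((cmod (\<theta> d (chart_inv d z)))\<^sup>2) \<partial>lborel)"

text \<open>
  The integral of \<open>\<theta> \<and> cnj \<theta>\<close>. The constant comes from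
  \<open>dz\<^sub>1 \<and> \<dots> \<and> dz\<^sub>n \<and> dz\<^sub>1' \<and> \<dots> \<and> dz\<^sub>n' =
   (-1)^(n(n-1)/2) (dz\<^sub>1 \<and> dz\<^sub>1') \<and> \<dots> \<and> (dz\<^sub>n \<and> dz\<^sub>n')\<close>
  and \<open>dz \<and> dz' = -2\<i> dx \<and> dy\<close>, where \<open>z'\<close> is the conjugate of \<open>z\<close>.
\<close>

definition wedge_cnj_integral ::
    "('a, 'n::finite) chart set \<Rightarrow> (('a, 'n) chart \<Rightarrow> 'a \<Rightarrow> complex) \<Rightarrow> complex" where
  "wedge_cnj_integral B \<theta> =
     (-1) ^ (CARD('n) * (CARD('n) - 1) div 2) * (- 2 * \<i>) ^ CARD('n) *
     of_real (enn2real (density_integral B \<theta>))"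

subsection \<open>Families over a disc\<close>

definition fibre :: "'a topology \<Rightarrow> ('a \<Rightarrow> complex) \<Rightarrow> complex \<Rightarrow> 'a set" where
  "fibre X f s = {x \<in> topspace X. f x = s}"

text \<open>
  The charts of a fibre as a submanifold of \<open>X\<close>: homeomorphisms from open subsets of the
  fibre onto open subsets of \<open>complex ^ 'n\<close> whose inverses are holomorphic immersions into \<open>X\<close>.
\<close>

definition fibre_atlas ::
    "'a topology \<Rightarrow> ('a, 'n::finite option) chart set \<Rightarrow> ('a \<Rightarrow> complex) \<Rightarrow> complex
      \<Rightarrow> ('a, 'n) chart set" where
  "fibre_atlas X A f s =
     {d. topological_chart (subtopology X (fibre X f s)) d \<and>
         (\<forall>c\<in>A. hol_map (snd c \<circ> chart_inv d) (snd d ` (fst d \<inter> fst c)) \<and>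
                (\<forall>z\<in>snd d ` (fst d \<inter> fst c). inj ((*v) (cjacobian (snd c \<circ> chart_inv d) z))))}"

text \<open>
  A proper flat morphism from the manifold \<open>X\<close> to the disc of radius \<open>r\<close>, with connected
  (in particular nonempty) fibres, smooth over the punctured disc. As \<open>X\<close> has dimension
  \<open>CARD('n) + 1\<close>, the fibres have dimension \<open>CARD('n)\<close>.
\<close>

definition degeneration ::
    "'a topology \<Rightarrow> ('a, 'n::finite option) chart set \<Rightarrow> ('a \<Rightarrow> complex) \<Rightarrow> real \<Rightarrow> bool" where
  "degeneration X A f r \<longleftrightarrow>
     0 < r \<and> complex_manifold X A \<and>
     f ` topspace X \<subseteq> ball 0 r \<and> hol_fun_on A f (topspace X) \<and>
     proper_map X (top_of_set (ball 0 r)) f \<and>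
     (\<forall>x\<in>topspace X. flat_at X A f x) \<and>
     (\<forall>s\<in>ball 0 r. fibre X f s \<noteq> {} \<and> connectedin X (fibre X f s)) \<and>
     (\<forall>x\<in>topspace X. f x \<noteq> 0 \<longrightarrow> \<not> critical_point A f x)"

text \<open>
  Sections of \<open>K\<^bsub>X/S\<^esub> = K\<^sub>X \<otimes> f\<^sup>* K\<^sub>S\<^sup>-\<^sup>1\<close> are written in the local frames
  \<open>dz\<^sub>0 \<and> \<dots> \<and> dz\<^sub>n \<otimes> (ds)\<^sup>-\<^sup>1\<close>. As the coordinate \<open>s\<close> is defined on all of \<open>S\<close>, the
  coefficients transform as those of sections of \<open>K\<^sub>X\<close>.
\<close>

abbreviation relative_canonical_section ::
    "('a, 'm::finite) chart set \<Rightarrow> 'a set \<Rightarrow> (('a, 'm) chart \<Rightarrow> 'a \<Rightarrow> complex) \<Rightarrow> bool" where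
  "relative_canonical_section \<equiv> canonical_section"

text \<open>\<open>\<eta>\<close> is a holomorphic frame over the neighbourhood \<open>V\<close> of \<open>0\<close> of the sheaf \<open>f\<^sub>* K\<^bsub>X/S\<^esub>\<close>.\<close>

definition direct_image_frame ::
    "'a topology \<Rightarrow> ('a, 'n::finite option) chart set \<Rightarrow> ('a \<Rightarrow> complex) \<Rightarrow> real
      \<Rightarrow> complex set \<Rightarrow> (('a, 'n option) chart \<Rightarrow> 'a \<Rightarrow> complex) \<Rightarrow> bool" where
  "direct_image_frame X A f r V \<eta> \<longleftrightarrow>
     open V \<and> 0 \<in> V \<and> V \<subseteq> ball 0 r \<and>
     relative_canonical_section A {x \<in> topspace X. f x \<in> V} \<eta> \<and>
     (\<forall>V'. open V' \<and> V' \<subseteq> V \<longrightarrow>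
        (\<forall>\<sigma>. relative_canonical_section A {x \<in> topspace X. f x \<in> V'} \<sigma> \<longrightarrow>
           (\<exists>g. g holomorphic_on V' \<and>
                (\<forall>c\<in>A. \<forall>x\<in>fst c. f x \<in> V' \<longrightarrow> \<sigma> c x = g (f x) * \<eta> c x))) \<and>
        (\<forall>g. g holomorphic_on V' \<and> (\<forall>c\<in>A. \<forall>x\<in>fst c. f x \<in> V' \<longrightarrow> g (f x) * \<eta> c x = 0)
           \<longrightarrow> (\<forall>t\<in>V'. g t = 0)))"

text \<open>
  The isomorphism of the restriction of \<open>K\<^bsub>X/S\<^esub>\<close> to a smooth fibre with the canonical bundle of
  the fibre sends \<open>\<omega> \<otimes> (ds)\<^sup>-\<^sup>1\<close> to the form \<open>\<theta>\<close> with \<open>\<omega> = f\<^sup>* ds \<and> \<theta>\<close>, that is,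
  \<open>\<omega>(v, w\<^sub>1, \<dots>, w\<^sub>n) = df(v) \<theta>(w\<^sub>1, \<dots>, w\<^sub>n)\<close> for \<open>v\<close> tangent to \<open>X\<close> and \<open>w\<^sub>i\<close> tangent to the
  fibre. In a chart \<open>d\<close> of the fibre, the \<open>w\<^sub>i\<close> are taken to be the coordinate vector fields.
\<close>

definition fibre_form ::
    "('a, 'n::finite option) chart set \<Rightarrow> ('a \<Rightarrow> complex)
      \<Rightarrow> (('a, 'n option) chart \<Rightarrow> 'a \<Rightarrow> complex) \<Rightarrow> ('a, 'n) chart \<Rightarrow> 'a \<Rightarrow> complex" where
  "fibre_form A f \<omega> d x =
     (THE h. \<forall>c\<in>A. x \<in> fst c \<longrightarrow> (\<forall>v.
        \<omega> c x * det (\<chi> i j. case j of None \<Rightarrow> v $ i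
                           | Some k \<Rightarrow> cjacobian (snd c \<circ> chart_inv d) (snd d x) $ i $ k)
        = (\<Sum>i\<in>UNIV. cpartial i (f \<circ> chart_inv c) (snd c x) * v $ i) * h))"

definition L2_norm_sq ::
    "'a topology \<Rightarrow> ('a, 'n::finite option) chart set \<Rightarrow> ('a \<Rightarrow> complex)
      \<Rightarrow> (('a, 'n option) chart \<Rightarrow> 'a \<Rightarrow> complex) \<Rightarrow> complex \<Rightarrow> real" where
  "L2_norm_sq X A f \<eta> s =
     cmod (wedge_cnj_integral (fibre_atlas X A f s) (fibre_form A f \<eta>)) / (2 * pi) ^ CARD('n)"

definition L2_asymptotics ::
    "'a topology \<Rightarrow> ('a, 'n::finite option) chart set \<Rightarrow> ('a \<Rightarrow> complex)
      \<Rightarrow> (('a, 'n option) chart \<Rightarrow> 'a \<Rightarrow> complex) \<Rightarrow> real \<Rightarrow> real \<Rightarrow> bool" where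
  "L2_asymptotics X A f \<eta> \<alpha> \<beta> \<longleftrightarrow>
     (\<lambda>s. - ln (L2_norm_sq X A f \<eta> s)
          - (\<alpha> * ln ((cmod s)\<^sup>2) - \<beta> * ln \<bar>ln ((cmod s)\<^sup>2)\<bar>)) \<in> O[at 0](\<lambda>_. 1)"

end

theory Submission
  imports Defs
begin

text \<open>
  Both coefficients vanish as soon as \<open>\<parallel>\<eta>\<parallel>\<^sup>2\<close> stays between two positive constants near \<open>s = 0\<close>.

  Upper bound: where \<open>df(v) \<noteq> 0\<close> for a direction \<open>v\<close>, projection along \<open>v\<close> gives local
  coordinates on the fibres, in which the density of \<open>\<eta>\<close> is \<open>\<bar>\<eta>\<bar>\<^sup>2 / \<bar>df(v)\<bar>\<^sup>2\<close>. Near a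
  nondegenerate critical point \<open>p\<close> finitely many directions \<open>v\<close> with nonzero second derivative of \<open>f\<close>
  satisfy \<open>max \<bar>df(v)\<bar> \<ge> c \<bar>z - p\<bar>\<close>. Along such a \<open>v\<close> the function \<open>f\<close> takes each value at most
  twice, and the density is at most a multiple of \<open>\<bar>w\<bar>\<^sup>-\<^sup>2\<close>, where \<open>w\<close> is the projection of \<open>z - p\<close>. This is
  integrable on the space of dimension \<open>2n \<ge> 4\<close>.

  Lower bound: if \<open>\<eta>\<close> vanished at all regular points of the special fibre, then \<open>\<eta> / f\<close> would
  extend to a section, over the critical points by Hartogs' theorem. Then \<open>\<eta> / f = g(f) \<eta>\<close>
  for a holomorphic function \<open>g\<close> with \<open>s g(s) = 1\<close>, which is absurd at \<open>s = 0\<close>. So \<open>\<eta>\<close> is nonzero at some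
  regular point of the special fibre, and the nearby fibres contain a piece of fixed size on
  which the density is bounded below.
\<close>

text \<open>\<open>density_integral\<close> is a supremum over finite families of disjoint Borel
  pieces in arbitrary fibre charts, and the number of pieces is unbounded. An upper bound must treat
  all pieces of a family at once. Hence the estimates count multiplicities: the projections of
  disjoint pieces of one fibre still cover each point at most twice, so twice the integral of one
  majorant bounds the whole family, whatever the fibre.

  The directions need a nonzero second derivative because \<open>df(v)\<close> vanishes at the
  critical point: only the second derivative can keep the projection two-to-one on a full
  neighbourhood. Coordinate directions may fail, as for a product of two coordinates, whose zero set
  contains coordinate lines. The inverse square of the distance is integrable from real dimension 3
  on; in dimension 2 it diverges logarithmically, which is why n = 1 is excluded.

  For the lower bound a single piece is enough, since a supremum dominates each of its members.
  Two-sided bounds then settle the coefficients, because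
  \<open>\<alpha> * x + \<beta> * ln x\<close> stays bounded at infinity only if both
  vanish.\<close>

no_notation fps_nth (infixl \<open>$\<close> 75)

subsection \<open>Determinants of complex matrices as real matrices\<close>

lemma permutes_UNIV_iff_bij: "p permutes UNIV \<longleftrightarrow> bij p"
  by (metis bij_imp_permutes permutes_bij UNIV_I)

text \<open>Conjugation by \<open>h\<close> is a sign-preserving bijection between the permutations
  of the two index types, and it matches the summands of the Leibniz formula.\<close>

lemma det_reindex:
  fixes A :: "'c::comm_ring_1 ^ 'l ^ 'l" and h :: "'k::finite \<Rightarrow> 'l::finite"
  assumes h: "bij h"
  shows "det (\<chi> i j. A $ h i $ h j) = det A"
proof -
  let ?g = "map_permutation (UNIV::'k set) h"
  have bb: "bij_betw h UNIV UNIV" using h by simp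
  have mp: "?g p (h x) = h (p x)" for p x
    using h by (auto simp: map_permutation_def restrict_id_def bij_def)
  have inj: "inj_on ?g {p. p permutes UNIV}"
  proof (rule inj_onI)
    fix p q assume "?g p = ?g q"
    then have "h (p x) = h (q x)" for x using mp by metis
    then show "p = q" using h by (auto simp: bij_def inj_def fun_eq_iff)
  qed
  have img: "?g ` {p. p permutes UNIV} = {p. p permutes UNIV}"
  proof (rule card_subset_eq)
    show "?g ` {p. p permutes UNIV} \<subseteq> {p. p permutes UNIV}"
      using map_permutation_permutes[OF bb] by auto
    show "card (?g ` {p. p permutes UNIV}) = card {p::'l \<Rightarrow> 'l. p permutes UNIV}"
      using card_image[OF inj] bij_betw_same_card[OF bb] by (simp add: card_permutations)
  qed (simp add: finite_permutations)
  have "det A = (\<Sum>p\<in>?g ` {p. p permutes UNIV}. of_int (sign p) * (\<Prod>i\<in>UNIV. A $ i $ p i))"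
    unfolding det_def img ..
  also have "\<dots> = (\<Sum>p | p permutes UNIV. of_int (sign (?g p)) * (\<Prod>i\<in>UNIV. A $ i $ ?g p i))"
    by (rule sum.reindex[OF inj, unfolded comp_def])
  also have "\<dots> = (\<Sum>p | p permutes UNIV. of_int (sign p) * (\<Prod>i\<in>UNIV. A $ h i $ h (p i)))"
  proof (rule sum.cong[OF refl])
    fix p :: "'k \<Rightarrow> 'k" assume p: "p \<in> {p. p permutes UNIV}"
    have "sign (?g p) = sign p"
      by (rule sign_map_permutation) (use p h in \<open>auto simp: bij_def\<close>)
    moreover have "(\<Prod>i\<in>UNIV. A $ i $ ?g p i) = (\<Prod>i\<in>UNIV. A $ h i $ h (p i))"
      using prod.reindex_bij_betw[OF bb, of "\<lambda>i. A $ i $ ?g p i"] by (simp add: mp)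
    ultimately show "of_int (sign (?g p)) * (\<Prod>i\<in>UNIV. A $ i $ ?g p i) =
        of_int (sign p) * (\<Prod>i\<in>UNIV. A $ h i $ h (p i))" by simp
  qed
  finally show ?thesis by (simp add: det_def)
qed

lemma prod_UNIV_Plus:
  fixes f :: "'a::finite + 'b::finite \<Rightarrow> 'c::comm_monoid_mult"
  shows "(\<Prod>x\<in>UNIV. f x) = (\<Prod>a\<in>UNIV. f (Inl a)) * (\<Prod>b\<in>UNIV. f (Inr b))"
  unfolding UNIV_Plus_UNIV[symmetric] by (subst prod.Plus) simp_all

lemma sum_UNIV_Plus:
  fixes f :: "'a::finite + 'b::finite \<Rightarrow> 'c::comm_monoid_add"
  shows "(\<Sum>x\<in>UNIV. f x) = (\<Sum>a\<in>UNIV. f (Inl a)) + (\<Sum>b\<in>UNIV. f (Inr b))"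
  unfolding UNIV_Plus_UNIV[symmetric] by (subst sum.Plus) simp_all

definition block_diag :: "'c::comm_ring_1 ^ 'a ^ 'a \<Rightarrow> 'c ^ 'b ^ 'b \<Rightarrow> 'c ^ ('a::finite + 'b::finite) ^ ('a + 'b)" where
  "block_diag A B = (\<chi> i j. case i of
      Inl a \<Rightarrow> (case j of Inl a' \<Rightarrow> A $ a $ a' | Inr b' \<Rightarrow> 0)
    | Inr b \<Rightarrow> (case j of Inl a' \<Rightarrow> 0 | Inr b' \<Rightarrow> B $ b $ b'))"

text \<open>\<open>map_sum p q\<close> is the composite of the extensions of \<open>p\<close> and
  \<open>q\<close> by the identity, and these extensions keep their signs.\<close>

lemma sign_map_sum:
  fixes p :: "'a::finite \<Rightarrow> 'a" and q :: "'b::finite \<Rightarrow> 'b"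
  assumes p: "p permutes UNIV" and q: "q permutes UNIV"
  shows "sign (map_sum p q) = sign p * sign q"
proof -
  let ?l = "map_permutation UNIV (Inl :: 'a \<Rightarrow> 'a + 'b) p"
  let ?r = "map_permutation UNIV (Inr :: 'b \<Rightarrow> 'a + 'b) q"
  have "?l (Inl a) = Inl (p a)" "?r (Inr b) = Inr (q b)" "?l (Inr b) = Inr b" "?r (Inl a) = Inl a" for a b
    by (auto simp: map_permutation_def restrict_id_def)
  then have "map_sum p q x = (?l \<circ> ?r) x" for x
    by (cases x) auto
  then have eq: "map_sum p q = ?l \<circ> ?r" by auto
  have "?l permutes range Inl"
    by (rule map_permutation_permutes[OF _ p]) (simp add: bij_betw_def)
  then have pl: "permutation ?l" by (rule permutes_imp_permutation[rotated]) simp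
  have "?r permutes range Inr"
    by (rule map_permutation_permutes[OF _ q]) (simp add: bij_betw_def)
  then have pr: "permutation ?r" by (rule permutes_imp_permutation[rotated]) simp
  have "sign ?l = sign p" by (rule sign_map_permutation) (use p in auto)
  moreover have "sign ?r = sign q" by (rule sign_map_permutation) (use q in auto)
  ultimately show ?thesis unfolding eq by (simp add: sign_compose[OF pl pr])
qed

text \<open>A permutation whose Leibniz product has no zero factor must map each summand of the
  index type into itself, hence is a \<open>map_sum\<close>; the sum over such pairs
  factors.\<close>

lemma det_block_diag:
  fixes A :: "'c::comm_ring_1 ^ 'a ^ 'a" and B :: "'c ^ 'b ^ 'b"
  shows "det (block_diag A B :: 'c ^ ('a::finite + 'b::finite) ^ _) = det A * det B"
proof -
  let ?N = "block_diag A B"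
  let ?P = "{p::'a\<Rightarrow>'a. p permutes UNIV} \<times> {q::'b\<Rightarrow>'b. q permutes UNIV}"
  let ?g = "\<lambda>(p, q). map_sum p q :: 'a + 'b \<Rightarrow> 'a + 'b"
  let ?t = "\<lambda>p. of_int (sign p) * (\<Prod>i\<in>UNIV. ?N $ i $ p i)"
  have inj: "inj_on ?g ?P"
  proof (rule inj_onI, clarsimp)
    fix p p' :: "'a \<Rightarrow> 'a" and q q' :: "'b \<Rightarrow> 'b"
    assume e: "map_sum p q = map_sum p' q'"
    have "p a = p' a" for a using fun_cong[OF e, of "Inl a"] by simp
    moreover have "q b = q' b" for b using fun_cong[OF e, of "Inr b"] by simp
    ultimately show "p = p' \<and> q = q'" by auto
  qed
  have ms: "map_sum p q permutes UNIV" if "p permutes UNIV" "q permutes UNIV" for p :: "'a \<Rightarrow> 'a" and q :: "'b \<Rightarrow> 'b"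
    unfolding permutes_UNIV_iff_bij
    by (rule o_bij[where g = "map_sum (inv p) (inv q)"])
       (use that in \<open>auto simp: fun_eq_iff sum.map_comp sum.map_id permutes_inv_o\<close>)
  then have sub: "?g ` ?P \<subseteq> {p. p permutes UNIV}" by auto
  have zero: "?t p = 0" if p: "p permutes UNIV" "p \<notin> ?g ` ?P" for p
  proof -
    have "\<exists>i. ?N $ i $ p i = 0"
    proof (rule ccontr)
      assume "\<not> ?thesis"
      then have nz: "?N $ i $ p i \<noteq> 0" for i by blast
      have l: "\<exists>a'. p (Inl a) = Inl a'" for a
        using nz[of "Inl a"] by (cases "p (Inl a)") (auto simp: block_diag_def)
      have r: "\<exists>a'. p (Inr a) = Inr a'" for a
        using nz[of "Inr a"] by (cases "p (Inr a)") (auto simp: block_diag_def)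
      obtain u where u: "\<And>a. p (Inl a) = Inl (u a)" using l by metis
      obtain v where v: "\<And>a. p (Inr a) = Inr (v a)" using r by metis
      have pe: "p x = map_sum u v x" for x by (cases x) (auto simp: u v)
      have ip: "inj p" using p(1) by (simp add: permutes_inj)
      have "inj u" using ip u by (metis injD injI sum.inject(1))
      moreover have "inj v" using ip v by (metis injD injI sum.inject(2))
      ultimately have "bij u" "bij v" by (simp_all add: bij_def finite_UNIV_inj_surj)
      then have "p \<in> ?g ` ?P" using pe by (intro image_eqI[of _ _ "(u, v)"]) (auto simp: permutes_UNIV_iff_bij)
      then show False using p(2) by blast
    qed
    then have "(\<Prod>i\<in>UNIV. ?N $ i $ p i) = 0" by (intro prod_zero) auto
    then show ?thesis by simp
  qed
  have "det ?N = sum ?t (?g ` ?P)"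
    unfolding det_def by (rule sum.mono_neutral_right) (use sub zero in \<open>auto simp: finite_permutations\<close>)
  also have "\<dots> = (\<Sum>x\<in>?P. ?t (?g x))"
    by (rule sum.reindex[OF inj, unfolded comp_def])
  also have "\<dots> = (\<Sum>(p,q)\<in>?P. (of_int (sign p) * (\<Prod>i\<in>UNIV. A $ i $ p i)) * (of_int (sign q) * (\<Prod>i\<in>UNIV. B $ i $ q i)))"
    by (rule sum.cong[OF refl]) (auto simp: sign_map_sum prod_UNIV_Plus block_diag_def algebra_simps)
  also have "\<dots> = det A * det B"
    by (simp add: det_def sum_product sum.cartesian_product)
  finally show ?thesis .
qed

text \<open>Multiplication by \<open>M\<close> in the real coordinates \<open>(Re z, Im z)\<close>.\<close>

definition real_form :: "complex ^ 'n ^ 'n \<Rightarrow> real ^ ('n::finite + 'n) ^ ('n + 'n)" where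
  "real_form M = (\<chi> i j. case i of
      Inl a \<Rightarrow> (case j of Inl b \<Rightarrow> Re (M $ a $ b) | Inr b \<Rightarrow> - Im (M $ a $ b))
    | Inr a \<Rightarrow> (case j of Inl b \<Rightarrow> Im (M $ a $ b) | Inr b \<Rightarrow> Re (M $ a $ b)))"

text \<open>Applied to complex conjugation and to the embedding of the reals into the complex
  numbers.\<close>

lemma det_map_hom:
  assumes "\<And>x y. h (x + y) = h x + h y" "\<And>x y. h (x * y) = h x * h y" "h 1 = 1"
  shows "h (det (A :: 'a::comm_ring_1 ^ 'k::finite ^ 'k)) = det (\<chi> i j. (h (A $ i $ j) :: 'b::comm_ring_1))"
proof -
  have h0: "h 0 = 0" using assms(1)[of 0 0] by simp
  have hm: "h (- x) = - h x" for x using assms(1)[of x "- x"] h0 minus_unique[of "h x" "h (- x)"] by simp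
  have hs: "h (sum f S) = (\<Sum>x\<in>S. h (f x))" for f and S :: "('k \<Rightarrow> 'k) set"
    by (induction S rule: infinite_finite_induct) (auto simp: h0 assms)
  have hp: "h (prod f S) = (\<Prod>x\<in>S. h (f x))" for f and S :: "'k set"
    by (induction S rule: infinite_finite_induct) (auto simp: assms)
  show ?thesis by (auto simp: det_def hs assms(2) hp sign_def hm assms(3) intro!: sum.cong)
qed

text \<open>Over the complex numbers, passing from the coordinates (x, y) to (x + iy, x - iy) turns
  \<open>real_form M\<close> into the block diagonal matrix of \<open>M\<close> and its conjugate,
  whose determinant is \<open>det M * cnj (det M)\<close>.\<close>

lemma det_real_form:
  fixes M :: "complex ^ 'n ^ 'n::finite"
  shows "det (real_form M) = (cmod (det M))\<^sup>2"
proof -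
  let ?R = "(\<chi> i j. of_real (real_form M $ i $ j)) :: complex ^ ('n + 'n) ^ ('n + 'n)"
  let ?N = "block_diag M (\<chi> i j. cnj (M $ i $ j))"
  \<comment> \<open>\<open>Q\<close> is this coordinate change and \<open>Q'\<close> its inverse: x
    is half the sum and y is the difference divided by 2i.\<close>
  define Q :: "complex ^ ('n + 'n) ^ ('n + 'n)" where
    "Q = (\<chi> i j. case i of
      Inl a \<Rightarrow> (case j of Inl b \<Rightarrow> if a = b then 1 else 0 | Inr b \<Rightarrow> if a = b then \<i> else 0)
    | Inr a \<Rightarrow> (case j of Inl b \<Rightarrow> if a = b then 1 else 0 | Inr b \<Rightarrow> if a = b then - \<i> else 0))"
  define Q' :: "complex ^ ('n + 'n) ^ ('n + 'n)" where
    "Q' = (\<chi> i j. case i of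
      Inl a \<Rightarrow> (case j of Inl b \<Rightarrow> if a = b then 1/2 else 0 | Inr b \<Rightarrow> if a = b then 1/2 else 0)
    | Inr a \<Rightarrow> (case j of Inl b \<Rightarrow> if a = b then - \<i>/2 else 0 | Inr b \<Rightarrow> if a = b then \<i>/2 else 0))"
  have d: "(if a = b then x else 0) * y = (if a = b then x * y else (0::complex))"
    "y * (if a = b then x else 0) = (if a = b then y * x else (0::complex))" for a b :: 'n and x y by auto
  have "(Q ** Q') $ i $ j = mat 1 $ i $ j" for i j
    by (cases i; cases j) (auto simp: matrix_matrix_mult_def sum_UNIV_Plus Q_def Q'_def mat_def d)
  then have QQ: "Q ** Q' = mat 1" by (simp add: vec_eq_iff)
  have R: "?R $ Inl a $ Inl b = of_real (Re (M $ a $ b))" "?R $ Inl a $ Inr b = - of_real (Im (M $ a $ b))"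
     "?R $ Inr a $ Inl b = of_real (Im (M $ a $ b))" "?R $ Inr a $ Inr b = of_real (Re (M $ a $ b))" for a b
    by (simp_all add: real_form_def)
  have N: "?N $ Inl a $ Inl b = M $ a $ b" "?N $ Inl a $ Inr b = 0"
     "?N $ Inr a $ Inl b = 0" "?N $ Inr a $ Inr b = cnj (M $ a $ b)" for a b
    by (simp_all add: block_diag_def)
  have Q: "Q $ Inl a $ Inl b = (if a = b then 1 else 0)" "Q $ Inl a $ Inr b = (if a = b then \<i> else 0)"
     "Q $ Inr a $ Inl b = (if a = b then 1 else 0)" "Q $ Inr a $ Inr b = (if a = b then - \<i> else 0)" for a b
    by (simp_all add: Q_def)
  have QRe: "(Q ** ?R) $ i $ j = (\<Sum>a\<in>UNIV. Q $ i $ Inl a * ?R $ Inl a $ j) + (\<Sum>a\<in>UNIV. Q $ i $ Inr a * ?R $ Inr a $ j)" for i j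
    by (simp only: matrix_matrix_mult_def sum_UNIV_Plus vec_lambda_beta)
  have NQe: "(?N ** Q) $ i $ j = (\<Sum>a\<in>UNIV. ?N $ i $ Inl a * Q $ Inl a $ j) + (\<Sum>a\<in>UNIV. ?N $ i $ Inr a * Q $ Inr a $ j)" for i j
    by (simp only: matrix_matrix_mult_def sum_UNIV_Plus vec_lambda_beta)
  have "(Q ** ?R) $ i $ j = (?N ** Q) $ i $ j" for i j
    unfolding QRe NQe
    by (cases i; cases j; hypsubst; unfold R N Q d;
        simp add: sum.delta sum.delta' complex_eq_iff)
  then have QR: "Q ** ?R = ?N ** Q" by (simp add: vec_eq_iff)
  have "det Q * det Q' = 1" using arg_cong[OF QQ, of det] by (simp add: det_mul)
  then have nz: "det Q \<noteq> 0" by auto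
  have "det Q * det ?R = det ?N * det Q" using arg_cong[OF QR, of det] by (simp only: det_mul)
  then have "det ?R = det ?N" using nz by simp
  also have "\<dots> = det M * cnj (det M)"
    using det_map_hom[of cnj M] by (subst det_block_diag) simp
  finally have "complex_of_real (det (real_form M)) = complex_of_real ((cmod (det M))\<^sup>2)"
    using det_map_hom[of complex_of_real "real_form M"] by (simp only: complex_norm_square) simp
  then show ?thesis using of_real_eq_iff by blast
qed

subsection \<open>Change of variables on complex space\<close>

text \<open>Change of variables for absolutely integrable functions, restated for nonnegative
  Lebesgue integrals. Finiteness of the right-hand side is what makes the integrand absolutely
  integrable.\<close>

lemma nn_integral_change_of_variables_real:
  fixes f :: "real^'m::{finite,wellorder} \<Rightarrow> real" and g :: "real^'m::_ \<Rightarrow> real^'m::_"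
  assumes S: "S \<in> sets borel" and der_g: "\<And>x. x \<in> S \<Longrightarrow> (g has_derivative g' x) (at x)"
    and inj: "inj_on g S" and gS: "g ` S \<in> sets borel"
    and f: "f \<in> borel_measurable borel" "\<And>x. 0 \<le> f x" and fin: "(\<integral>\<^sup>+ y\<in>g ` S. f y \<partial>lborel) < \<infinity>"
  shows "(\<integral>\<^sup>+ x\<in>S. ennreal (\<bar>det (matrix (g' x))\<bar> * f (g x)) \<partial>lborel) = (\<integral>\<^sup>+ y\<in>g ` S. f y \<partial>lborel)"
proof -
  define I where "I = enn2real (\<integral>\<^sup>+ y\<in>g ` S. f y \<partial>lborel)"
  have I0: "0 \<le> I" by (simp add: I_def)
  have If: "(\<integral>\<^sup>+ y. ennreal (indicator (g ` S) y * f y) \<partial>lborel) = ennreal I"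
  proof -
    have "(\<integral>\<^sup>+ y. ennreal (indicator (g ` S) y * f y) \<partial>lborel) = (\<integral>\<^sup>+ y\<in>g ` S. f y \<partial>lborel)"
      by (intro nn_integral_cong) (auto simp: indicator_def)
    then show ?thesis using fin by (simp add: I_def)
  qed
  have "((\<lambda>y. indicator (g ` S) y * f y) has_integral I) UNIV"
    by (rule nn_integral_has_integral) (use If f gS I0 in auto)
  then have hI: "(f has_integral I) (g ` S)"
    by (subst has_integral_restrict_UNIV[symmetric])
       (simp add: indicator_def of_bool_def if_distrib[of "\<lambda>x. x * f y" for y] cong: if_cong)
  \<comment> \<open>The theorem to be applied concerns vector-valued functions, so the scalar
    function is regarded as a vector with one entry.\<close>
  define F where "F = (\<lambda>x. vec (f x) :: real^1)"
  have "F absolutely_integrable_on (g ` S) \<and> integral (g ` S) F = vec I"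
    unfolding absolutely_integrable_on_1_iff integral_on_1_eq F_def
    using hI f(2) by (auto simp: integral_unique intro!: nonnegative_absolutely_integrable_1)
  then have "(\<lambda>x. \<bar>det (matrix (g' x))\<bar> *\<^sub>R F(g x)) absolutely_integrable_on S \<and>
     integral S (\<lambda>x. \<bar>det (matrix (g' x))\<bar> *\<^sub>R F(g x)) = vec I"
    by (subst has_absolute_integral_change_of_variables)
       (use S der_g inj in \<open>auto intro: has_derivative_at_withinI\<close>)
  then have "((\<lambda>x. \<bar>det (matrix (g' x))\<bar> * f(g x)) has_integral I) S"
    unfolding absolutely_integrable_on_1_iff integral_on_1_eq F_def
    using set_lebesgue_integral_eq_integral(1) by (auto simp: has_integral_iff vec_eq_iff)
  then have "(\<integral>\<^sup>+ x\<in>S. ennreal (\<bar>det (matrix (g' x))\<bar> * f (g x)) \<partial>lborel) = ennreal I"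
    by (rule nn_integral_has_integral_lebesgue'[rotated]) (simp add: f)
  also have "\<dots> = (\<integral>\<^sup>+ y\<in>g ` S. f y \<partial>lborel)" using fin by (simp add: I_def)
  finally show ?thesis .
qed

text \<open>Such a map preserves inner products with basis vectors, so the preimage of a box is a
  box with the same side lengths, and boxes determine Lebesgue measure.\<close>

lemma lborel_distr_basis_bij:
  fixes \<iota> :: "'a::euclidean_space \<Rightarrow> 'b::euclidean_space"
  assumes lin: "linear \<iota>" and bij: "bij_betw \<iota> Basis Basis"
  shows "distr lborel borel \<iota> = lborel"
proof (rule lborel_eqI[symmetric])
  fix l u :: 'b assume lu: "\<And>b. b \<in> Basis \<Longrightarrow> l \<bullet> b \<le> u \<bullet> b"
  have inB: "\<iota> b \<in> Basis" if "b \<in> Basis" for b using bij that by (auto simp: bij_betw_def)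
  have inner: "\<iota> z \<bullet> \<iota> b = z \<bullet> b" if b: "b \<in> Basis" for z b
  proof -
    have "\<iota> z \<bullet> \<iota> b = (\<Sum>c\<in>Basis. (z \<bullet> c) *\<^sub>R \<iota> c) \<bullet> \<iota> b"
      using lin by (subst euclidean_representation[of z, symmetric])
        (simp only: linear_sum linear_cmul)
    also have "\<dots> = (\<Sum>c\<in>Basis. (z \<bullet> c) * (if c = b then 1 else 0))"
      unfolding inner_sum_left inner_scaleR_left
      by (intro sum.cong refl arg_cong2[where f = "(*)"])
         (use bij b inB in \<open>auto simp: inner_Basis bij_betw_def inj_on_def\<close>)
    also have "\<dots> = z \<bullet> b" using b by (simp add: if_distrib[of "\<lambda>t. _ * t"] cong: if_cong)
    finally show ?thesis .
  qed
  have m: "\<iota> \<in> borel_measurable borel"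
    using lin by (intro borel_measurable_continuous_onI linear_continuous_on) (simp add: linear_linear)
  let ?l = "\<Sum>b\<in>Basis. (l \<bullet> \<iota> b) *\<^sub>R b" and ?u = "\<Sum>b\<in>Basis. (u \<bullet> \<iota> b) *\<^sub>R b"
  have B: "Basis = \<iota> ` Basis" using bij by (simp add: bij_betw_def)
  have eq: "\<iota> -` box l u = box ?l ?u"
    by (auto simp: box_def B inner inner_sum_left inner_Basis if_distrib cong: if_cong)
  have lu': "?l \<bullet> b \<le> ?u \<bullet> b" if "b \<in> Basis" for b using lu[OF inB[OF that]] that by simp
  have "emeasure (distr lborel borel \<iota>) (box l u) = emeasure lborel (box ?l ?u)"
    by (subst emeasure_distr) (use m in \<open>auto simp: eq\<close>)
  also have "\<dots> = (\<Prod>b\<in>Basis. (?u - ?l) \<bullet> b)" using lu' by (subst emeasure_lborel_box) auto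
  also have "\<dots> = (\<Prod>b\<in>Basis. (u - l) \<bullet> \<iota> b)"
    by (intro arg_cong[of _ _ ennreal] prod.cong refl) (simp add: inner_diff_left)
  also have "\<dots> = (\<Prod>b\<in>Basis. (u - l) \<bullet> b)"
    using prod.reindex_bij_betw[OF bij, of "\<lambda>b. (u - l) \<bullet> b"] by simp
  finally show "emeasure (distr lborel borel \<iota>) (box l u) = (\<Prod>b\<in>Basis. (u - l) \<bullet> b)" .
qed simp

text \<open>\<open>'n bit0\<close> serves as a well-ordered type with twice as many elements as
  \<open>'n\<close>, because the real change of variables is formulated for well-ordered index
  types. Which bijection is taken does not matter.\<close>

definition real_index :: "'n::finite + 'n \<Rightarrow> 'n bit0" where
  "real_index = (SOME h. bij h)"

lemma bij_real_index: "bij (real_index :: 'n::finite + 'n \<Rightarrow> 'n bit0)"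
proof -
  have "card (UNIV :: ('n + 'n) set) = card (UNIV :: 'n bit0 set)" by simp
  then have "\<exists>h :: 'n + 'n \<Rightarrow> 'n bit0. bij h"
    by (metis bij_betw_iff_card finite)
  then show ?thesis unfolding real_index_def by (rule someI_ex)
qed

section \<open>Real coordinates on complex n-space\<close>

definition realify :: "complex ^ 'n::finite \<Rightarrow> real ^ 'n bit0" where
  "realify z = (\<chi> k. case inv real_index k of Inl a \<Rightarrow> Re (z $ a) | Inr a \<Rightarrow> Im (z $ a))"

definition unrealify :: "real ^ 'n bit0 \<Rightarrow> complex ^ 'n::finite" where
  "unrealify y = (\<chi> a. Complex (y $ real_index (Inl a)) (y $ real_index (Inr a)))"

lemma inv_real_index [simp]: "inv real_index (real_index x) = x"
  by (rule inv_f_f[OF bij_is_inj[OF bij_real_index]])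

lemma real_index_inv [simp]: "real_index (inv real_index x) = x"
  by (rule surj_f_inv_f[OF bij_is_surj[OF bij_real_index]])

lemma realify_nth [simp]:
  "realify z $ real_index (Inl a) = Re (z $ a)" "realify z $ real_index (Inr a) = Im (z $ a)"
  by (simp_all add: realify_def)

lemma all_real_index: "(\<forall>k. P k) \<longleftrightarrow> (\<forall>a. P (real_index (Inl a))) \<and> (\<forall>a. P (real_index (Inr a)))"
  by (metis real_index_inv obj_sumE)

lemma unrealify_realify [simp]: "unrealify (realify z) = z"
  by (simp add: unrealify_def vec_eq_iff)

lemma realify_unrealify [simp]: "realify (unrealify y) = y"
  unfolding vec_eq_iff all_real_index by (simp add: unrealify_def)

lemma linear_realify: "linear realify"
  by (rule linearI; unfold vec_eq_iff all_real_index; simp)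

lemma linear_unrealify: "linear unrealify"
  by (rule linearI) (simp_all add: unrealify_def vec_eq_iff complex_eq_iff)

lemma realify_axis:
  "realify (axis a 1) = axis (real_index (Inl a)) 1" "realify (axis a \<i>) = axis (real_index (Inr a)) 1"
  unfolding vec_eq_iff all_real_index by (auto simp: axis_def bij_is_inj[OF bij_real_index, THEN inj_eq])

lemma bij_realify_Basis: "bij_betw (realify :: complex ^ 'n::finite \<Rightarrow> _) Basis Basis"
proof -
  have "inj_on realify (Basis :: (complex ^ 'n) set)" by (metis inj_on_inverseI unrealify_realify)
  moreover have "realify ` (Basis :: (complex ^ 'n) set) = Basis"
  proof -
    have "(Basis :: (real ^ 'n bit0) set) = range (\<lambda>k. axis k 1)" by (auto simp: Basis_vec_def)
    also have "\<dots> = range (\<lambda>x. axis (real_index x) 1)"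
      by (simp only: image_image[symmetric, of "\<lambda>k. axis k 1" real_index] bij_is_surj[OF bij_real_index])
    also have "\<dots> = range (\<lambda>a. axis (real_index (Inl a)) 1) \<union> range (\<lambda>a. axis (real_index (Inr a)) 1)"
      unfolding UNIV_Plus_UNIV[symmetric] Plus_def by (auto simp: image_Un image_image)
    also have "\<dots> = realify ` (Basis :: (complex ^ 'n) set)"
      by (auto simp: Basis_vec_def Basis_complex_def realify_axis image_iff)
    finally show ?thesis ..
  qed
  ultimately show ?thesis by (simp add: bij_betw_def)
qed

lemma realify_measurable [measurable]: "realify \<in> borel_measurable borel"
  using linear_realify by (intro borel_measurable_continuous_onI linear_continuous_on) (simp add: linear_linear)

lemma unrealify_measurable [measurable]: "unrealify \<in> borel_measurable borel"
  using linear_unrealify by (intro borel_measurable_continuous_onI linear_continuous_on) (simp add: linear_linear)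

lemma nn_integral_realify:
  fixes f :: "complex ^ 'n::finite \<Rightarrow> ennreal"
  assumes "f \<in> borel_measurable borel"
  shows "(\<integral>\<^sup>+ y. f (unrealify y) \<partial>lborel) = (\<integral>\<^sup>+ z. f z \<partial>lborel)"
proof -
  have "(\<integral>\<^sup>+ y. f (unrealify y) \<partial>lborel) = (\<integral>\<^sup>+ y. f (unrealify y) \<partial>distr lborel borel (realify :: complex ^ 'n \<Rightarrow> _))"
    by (simp add: lborel_distr_basis_bij[OF linear_realify bij_realify_Basis])
  also have "\<dots> = (\<integral>\<^sup>+ z. f z \<partial>lborel)"
    using assms by (subst nn_integral_distr) simp_all
  finally show ?thesis .
qed

lemma matrix_vector_mult_axis_nth: "((M :: 'c::comm_ring_1 ^ 'n ^ 'm) *v axis a c) $ b = M $ b $ a * c"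
  by (simp add: matrix_vector_mult_def axis_def if_distrib[of "\<lambda>t. _ * t"] cong: if_cong)

lemma det_realify:
  fixes M :: "complex ^ 'n ^ 'n::finite"
  shows "det (matrix (\<lambda>y. realify (M *v unrealify y))) = (cmod (det M))\<^sup>2"
proof -
  let ?A = "matrix (\<lambda>y. realify (M *v unrealify y)) :: real ^ 'n bit0 ^ 'n bit0"
  have u: "unrealify (axis (real_index (Inl a)) 1) = axis a 1" "unrealify (axis (real_index (Inr a)) 1) = axis a \<i>" for a :: 'n
    by (metis realify_axis unrealify_realify)+
  have "?A $ real_index i $ real_index j = real_form M $ i $ j" for i j
    by (cases i; cases j) (auto simp: matrix_def real_form_def u matrix_vector_mult_axis_nth)
  then have "(\<chi> i j. ?A $ real_index i $ real_index j) = real_form M" by (simp add: vec_eq_iff)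
  then show ?thesis using det_reindex[OF bij_real_index, of ?A] by (simp add: det_real_form)
qed

text \<open>The real theorem transported through \<open>realify\<close>; by
  \<open>det_realify\<close> the real Jacobian is the squared modulus of the complex one. The
  transport of the left integral requires the measurability assumption \<open>m\<close>.\<close>

lemma nn_integral_change_of_variables_complex:
  fixes T :: "complex ^ 'n::finite \<Rightarrow> complex ^ 'n" and f :: "complex ^ 'n \<Rightarrow> real"
  assumes E: "E \<in> sets borel" and der: "\<And>z. z \<in> E \<Longrightarrow> (T has_derivative (\<lambda>v. J z *v v)) (at z)"
    and inj: "inj_on T E" and TE: "T ` E \<in> sets borel"
    and f: "f \<in> borel_measurable borel" "\<And>x. 0 \<le> f x" and fin: "(\<integral>\<^sup>+ w\<in>T ` E. f w \<partial>lborel) < \<infinity>"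
    and m: "(\<lambda>z. (cmod (det (J z)))\<^sup>2 * f (T z) * indicator E z) \<in> borel_measurable borel"
  shows "(\<integral>\<^sup>+ z\<in>E. ennreal ((cmod (det (J z)))\<^sup>2 * f (T z)) \<partial>lborel) = (\<integral>\<^sup>+ w\<in>T ` E. f w \<partial>lborel)"
proof -
  let ?S = "unrealify -` E" and ?g = "\<lambda>y. realify (T (unrealify y))"
  let ?g' = "\<lambda>y v. realify (J (unrealify y) *v unrealify v)"
  have gS: "?g ` ?S = unrealify -` (T ` E)"
  proof (intro equalityI subsetI)
    fix y assume "y \<in> unrealify -` (T ` E)"
    then obtain z where "z \<in> E" "unrealify y = T z" by auto
    then show "y \<in> ?g ` ?S"
      by (intro image_eqI[of _ _ "realify z"]) (simp_all, metis realify_unrealify)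
  qed auto
  have fm: "(\<lambda>w. ennreal (f w) * indicator (T ` E) w) \<in> borel_measurable borel" using f TE by measurable
  have im: "(\<integral>\<^sup>+ y\<in>?g ` ?S. f (unrealify y) \<partial>lborel) = (\<integral>\<^sup>+ w\<in>T ` E. f w \<partial>lborel)"
    unfolding gS nn_integral_realify[OF fm, symmetric] by (simp add: indicator_def)
  have "(\<integral>\<^sup>+ y\<in>?S. ennreal (\<bar>det (matrix (?g' y))\<bar> * f (unrealify (?g y))) \<partial>lborel) = (\<integral>\<^sup>+ y\<in>?g ` ?S. f (unrealify y) \<partial>lborel)"
  proof (rule nn_integral_change_of_variables_real[where f = "\<lambda>y. f (unrealify y)"])
    show "unrealify -` E \<in> sets borel"
      using measurable_sets[OF unrealify_measurable E] by simp
    show "?g ` ?S \<in> sets borel" unfolding gS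
      using measurable_sets[OF unrealify_measurable TE] by simp
    show "(?g has_derivative ?g' y) (at y)" if "y \<in> ?S" for y
    proof -
      have lu: "(unrealify has_derivative unrealify) (at y)"
        by (rule linear_imp_has_derivative[OF linear_unrealify])
      have lr: "(realify has_derivative realify) (at w)" for w :: "complex ^ 'n"
        by (rule linear_imp_has_derivative[OF linear_realify])
      show ?thesis
        using has_derivative_compose[OF has_derivative_compose[OF lu der[of "unrealify y"]] lr] that by simp
    qed
    show "inj_on ?g ?S"
      using inj by (auto simp: inj_on_def) (metis realify_unrealify unrealify_realify)
    show "(\<lambda>y. f (unrealify y)) \<in> borel_measurable borel" using f by measurable
  qed (use f fin im in auto)
  then have "(\<integral>\<^sup>+ y. ennreal ((cmod (det (J (unrealify y))))\<^sup>2 * f (T (unrealify y)) * indicator E (unrealify y)) \<partial>lborel) = (\<integral>\<^sup>+ w\<in>T ` E. f w \<partial>lborel)"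
    unfolding det_realify im
    by (elim trans[rotated], intro nn_integral_cong) (auto simp: indicator_def)
  moreover have "(\<integral>\<^sup>+ y. ennreal ((cmod (det (J (unrealify y))))\<^sup>2 * f (T (unrealify y)) * indicator E (unrealify y)) \<partial>lborel)
      = (\<integral>\<^sup>+ z. ennreal ((cmod (det (J z)))\<^sup>2 * f (T z) * indicator E z) \<partial>lborel)"
    by (rule nn_integral_realify[where f = "\<lambda>z. ennreal ((cmod (det (J z)))\<^sup>2 * f (T z) * indicator E z)"])
       (use m in measurable)
  moreover have "(\<integral>\<^sup>+ z. ennreal ((cmod (det (J z)))\<^sup>2 * f (T z) * indicator E z) \<partial>lborel)
      = (\<integral>\<^sup>+ z\<in>E. ennreal ((cmod (det (J z)))\<^sup>2 * f (T z)) \<partial>lborel)"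
    by (intro nn_integral_cong) (auto simp: indicator_def)
  ultimately show ?thesis by simp
qed

text \<open>By invariance of domain \<open>T\<close> is a homeomorphism onto an open set, so the
  image of \<open>E\<close> is the preimage of \<open>E\<close> under a continuous inverse.\<close>

lemma sets_borel_image_injective:
  fixes T :: "'a::euclidean_space \<Rightarrow> 'a"
  assumes U: "open U" "continuous_on U T" "inj_on T U" and E: "E \<subseteq> U" "E \<in> sets borel"
  shows "T ` E \<in> sets borel"
proof -
  obtain g where g: "homeomorphism U (T ` U) T g"
    using invariance_of_domain_homeomorphism[OF U(1,2) _ U(3)] by auto
  have o: "open (T ` U)" using invariance_of_domain[OF U(2,1,3)] .
  have "g \<in> borel_measurable (restrict_space borel (T ` U))"
    using g by (intro borel_measurable_continuous_on_restrict) (simp add: homeomorphism_def)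
  then have "g -` E \<inter> space (restrict_space borel (T ` U)) \<in> sets (restrict_space borel (T ` U))"
    using E(2) by (rule measurable_sets)
  moreover have "g -` E \<inter> space (restrict_space borel (T ` U)) = T ` E"
    using g E(1) by (auto simp: space_restrict_space homeomorphism_def image_iff)
  ultimately show ?thesis using o by (simp add: sets_restrict_space_iff)
qed

text \<open>Cover \<open>U\<close> by countably many open sets on which \<open>T\<close> is
  injective, cut \<open>E\<close> into disjoint pieces accordingly and change variables on each.
  \<open>N\<close> counts the images of pieces that contain a point; as a countable sum of
  indicators of Borel sets it is visibly measurable, and it cannot exceed the number of
  preimages.\<close>

lemma nn_integral_image_multiplicity:
  fixes T :: "complex ^ 'n::finite \<Rightarrow> complex ^ 'n" and f :: "complex ^ 'n \<Rightarrow> real"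
  assumes U: "open U" and E: "E \<in> sets borel" "E \<subseteq> U"
    and der: "\<And>z. z \<in> U \<Longrightarrow> (T has_derivative (\<lambda>v. J z *v v)) (at z)"
    and contJ: "continuous_on U (\<lambda>z. det (J z))"
    and inj: "\<And>z. z \<in> U \<Longrightarrow> \<exists>V. open V \<and> z \<in> V \<and> inj_on T (V \<inter> U)"
    and f: "f \<in> borel_measurable borel" "\<And>x. 0 \<le> f x" and fin: "(\<integral>\<^sup>+ w. f w \<partial>lborel) < \<infinity>"
    and k: "\<And>z. z \<in> E \<Longrightarrow> k z \<le> ennreal ((cmod (det (J z)))\<^sup>2 * f (T z))"
  obtains N :: "complex ^ 'n \<Rightarrow> ennreal" where "N \<in> borel_measurable borel"
    "(\<integral>\<^sup>+ z\<in>E. k z \<partial>lborel) \<le> (\<integral>\<^sup>+ w. N w * ennreal (f w) \<partial>lborel)"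
    "\<And>w. finite {z\<in>E. T z = w} \<Longrightarrow> N w \<le> of_nat (card {z\<in>E. T z = w})"
proof (cases "U = {}")
  case True
  show ?thesis by (rule that[of "\<lambda>_. 0"]) (use True E in auto)
next
  case False
  have contT: "continuous_on U T"
    using der by (intro continuous_at_imp_continuous_on ballI) (metis has_derivative_continuous)
  define \<V> where "\<V> = {V. open V \<and> inj_on T (V \<inter> U)}"
  obtain \<V>' where V': "\<V>' \<subseteq> \<V>" "countable \<V>'" "\<Union>\<V>' = \<Union>\<V>"
    by (rule Lindelof[of \<V>]) (auto simp: \<V>_def)
  have cov: "U \<subseteq> \<Union>\<V>'" using inj V' by (force simp: \<V>_def)
  have "\<V>' \<noteq> {}" using cov False by auto
  then obtain B :: "nat \<Rightarrow> (complex ^ 'n) set" where B: "range B = \<V>'"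
    using V'(2) by (metis range_from_nat_into)
  define D where "D l = E \<inter> disjointed B l" for l
  have oB: "open (B l)" and iB: "inj_on T (B l \<inter> U)" for l using B V'(1) by (auto simp: \<V>_def)
  have dis: "disjoint_family D"
    using disjoint_family_disjointed[of B] by (auto simp: D_def disjoint_family_on_def)
  have UD: "(\<Union>l. D l) = E"
    using cov B E by (auto simp: D_def UN_disjointed_eq simp flip: Int_UN_distrib)
  have Dm: "D l \<in> sets borel" for l
    unfolding D_def disjointed_def by (intro sets.Int sets.Diff sets.finite_UN E(1) borel_open[OF oB]) auto
  have DB: "D l \<subseteq> B l \<inter> U" for l using E disjointed_subset[of B l] by (auto simp: D_def)
  have TDm: "T ` D l \<in> sets borel" for l
    by (rule sets_borel_image_injective[of "B l \<inter> U"])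
       (use oB iB DB Dm U in \<open>auto intro: continuous_on_subset[OF contT]\<close>)
  define N :: "complex ^ 'n \<Rightarrow> ennreal" where "N w = (\<Sum>l. indicator (T ` D l) w)" for w
  let ?m = "\<lambda>z. ennreal ((cmod (det (J z)))\<^sup>2 * f (T z))"
  \<comment> \<open>Nothing is known about \<open>T\<close> and \<open>J\<close> off
    \<open>U\<close>, so both are replaced by 0 there before measurability is deduced from
    continuity on \<open>U\<close>.\<close>
  have mm: "(\<lambda>z. (cmod (det (J z)))\<^sup>2 * f (T z) * indicator G z) \<in> borel_measurable borel"
    if G: "G \<in> sets borel" "G \<subseteq> U" for G
  proof -
    have 1: "(\<lambda>z. if z \<in> U then cmod (det (J z)) else 0) \<in> borel_measurable borel"
      by (rule borel_measurable_continuous_on_if) (use U contJ in \<open>auto intro!: continuous_intros\<close>)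
    have 2: "(\<lambda>z. if z \<in> U then T z else 0) \<in> borel_measurable borel"
      by (rule borel_measurable_continuous_on_if) (use U contT in \<open>auto intro!: continuous_intros\<close>)
    have "(\<lambda>z. (if z \<in> U then cmod (det (J z)) else 0)\<^sup>2 * f (if z \<in> U then T z else 0) * indicator G z) \<in> borel_measurable borel"
      using 1 2 f(1) G(1) by measurable
    also have "(\<lambda>z. (if z \<in> U then cmod (det (J z)) else 0)\<^sup>2 * f (if z \<in> U then T z else 0) * indicator G z)
        = (\<lambda>z. (cmod (det (J z)))\<^sup>2 * f (T z) * indicator G z)"
      using G by (auto simp: indicator_def fun_eq_iff)
    finally show ?thesis .
  qed
  have piece: "(\<integral>\<^sup>+ z\<in>D l. ?m z \<partial>lborel) = (\<integral>\<^sup>+ w\<in>T ` D l. f w \<partial>lborel)" for l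
  proof (rule nn_integral_change_of_variables_complex)
    show "(\<integral>\<^sup>+ w\<in>T ` D l. f w \<partial>lborel) < \<infinity>"
      by (rule le_less_trans[OF nn_integral_mono fin]) (auto simp: indicator_def)
    show "(\<lambda>z. (cmod (det (J z)))\<^sup>2 * f (T z) * indicator (D l) z) \<in> borel_measurable borel"
      using mm Dm DB by blast
    show "inj_on T (D l)" using iB DB inj_on_subset by blast
    show "(T has_derivative (*v) (J z)) (at z)" if "z \<in> D l" for z using der DB that by blast
  qed (use Dm TDm f in auto)
  have mE: "(\<lambda>z. ?m z * indicator E z) \<in> borel_measurable borel"
  proof -
    have "(\<lambda>z. ennreal ((cmod (det (J z)))\<^sup>2 * f (T z) * indicator E z)) \<in> borel_measurable borel"
      using mm[OF E] by measurable
    also have "(\<lambda>z. ennreal ((cmod (det (J z)))\<^sup>2 * f (T z) * indicator E z)) = (\<lambda>z. ?m z * indicator E z)"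
      by (auto simp: indicator_def)
    finally show ?thesis .
  qed
  have "(\<integral>\<^sup>+ z\<in>E. k z \<partial>lborel) \<le> (\<integral>\<^sup>+ z\<in>E. ?m z \<partial>lborel)"
    by (rule nn_integral_mono) (use k in \<open>auto simp: indicator_def\<close>)
  also have "\<dots> = (\<integral>\<^sup>+ z. (\<Sum>l. ?m z * indicator E z * indicator (D l) z) \<partial>lborel)"
  proof (rule nn_integral_cong)
    fix z
    have "(\<Sum>l. indicator (D l) z) = (indicator (\<Union>l. D l) z :: ennreal)"
      by (rule suminf_indicator[OF dis])
    then show "?m z * indicator E z = (\<Sum>l. ?m z * indicator E z * indicator (D l) z)"
      by (simp add: ennreal_suminf_cmult UD) (simp add: indicator_def)
  qed
  also have "\<dots> = (\<Sum>l. \<integral>\<^sup>+ z. ?m z * indicator E z * indicator (D l) z \<partial>lborel)"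
    by (rule nn_integral_suminf) (use mE Dm in measurable)
  also have "\<dots> = (\<Sum>l. \<integral>\<^sup>+ z\<in>D l. ?m z \<partial>lborel)"
    by (intro suminf_cong nn_integral_cong) (use UD in \<open>auto simp: indicator_def\<close>)
  also have "\<dots> = (\<Sum>l. \<integral>\<^sup>+ w\<in>T ` D l. f w \<partial>lborel)" by (simp add: piece)
  also have "\<dots> = (\<integral>\<^sup>+ w. (\<Sum>l. ennreal (f w) * indicator (T ` D l) w) \<partial>lborel)"
    by (rule nn_integral_suminf[symmetric]) (use f TDm in measurable)
  also have "\<dots> = (\<integral>\<^sup>+ w. N w * f w \<partial>lborel)"
    by (simp add: ennreal_suminf_cmult N_def mult.commute)
  finally have le: "(\<integral>\<^sup>+ z\<in>E. k z \<partial>lborel) \<le> (\<integral>\<^sup>+ w. N w * f w \<partial>lborel)" .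
  have Nm: "N \<in> borel_measurable borel" unfolding N_def using TDm by measurable
  have Nle: "N w \<le> of_nat (card {z\<in>E. T z = w})" if fi: "finite {z\<in>E. T z = w}" for w
    unfolding N_def
  proof (rule suminf_le_const)
    fix L
    let ?I = "{l\<in>{..<L}. w \<in> T ` D l}"
    \<comment> \<open>A choice of one preimage of \<open>w\<close> in each piece that has one;
      disjointness of the pieces makes the choices distinct.\<close>
    define c where "c l = (SOME z. z \<in> D l \<and> T z = w)" for l
    have c: "c l \<in> D l \<and> T (c l) = w" if "l \<in> ?I" for l
      unfolding c_def by (rule someI_ex) (use that in auto)
    have "inj_on c ?I"
    proof (rule inj_onI)
      fix l l' assume l: "l \<in> ?I" "l' \<in> ?I" "c l = c l'"
      then have "c l \<in> D l \<inter> D l'" using c[OF l(1)] c[OF l(2)] by simp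
      then show "l = l'" using dis by (auto simp: disjoint_family_on_def)
    qed
    moreover have "c ` ?I \<subseteq> {z\<in>E. T z = w}"
    proof
      fix z assume "z \<in> c ` ?I"
      then obtain l where l: "l \<in> ?I" "z = c l" by blast
      then show "z \<in> {z\<in>E. T z = w}" using c[OF l(1)] UD by auto
    qed
    ultimately have "card ?I \<le> card {z\<in>E. T z = w}" using fi by (rule card_inj_on_le)
    moreover have "(\<Sum>l<L. indicator (T ` D l) w) = (of_nat (card ?I) :: ennreal)"
      by (simp add: indicator_def of_bool_def flip: sum.inter_filter)
    ultimately show "(\<Sum>l<L. indicator (T ` D l) w) \<le> (of_nat (card {z\<in>E. T z = w}) :: ennreal)"
      by simp
  qed simp
  show ?thesis by (rule that[OF Nm le Nle])
qed

text \<open>The preimages are counted over all members of \<open>P\<close> together. The bound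
  therefore involves \<open>M\<close> but not the number of members of \<open>P\<close>, as needed
  for a supremum over families of any size.\<close>

lemma sum_nn_integral_image_multiplicity:
  fixes T :: "'p \<Rightarrow> complex ^ 'n::finite \<Rightarrow> complex ^ 'n" and f :: "complex ^ 'n \<Rightarrow> real"
  assumes P: "finite P" and U: "\<And>p. p \<in> P \<Longrightarrow> open (U p)"
    and E: "\<And>p. p \<in> P \<Longrightarrow> E p \<in> sets borel" "\<And>p. p \<in> P \<Longrightarrow> E p \<subseteq> U p"
    and der: "\<And>p z. p \<in> P \<Longrightarrow> z \<in> U p \<Longrightarrow> (T p has_derivative (\<lambda>v. J p z *v v)) (at z)"
    and contJ: "\<And>p. p \<in> P \<Longrightarrow> continuous_on (U p) (\<lambda>z. det (J p z))"
    and inj: "\<And>p z. p \<in> P \<Longrightarrow> z \<in> U p \<Longrightarrow> \<exists>V. open V \<and> z \<in> V \<and> inj_on (T p) (V \<inter> U p)"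
    and f: "f \<in> borel_measurable borel" "\<And>x. 0 \<le> f x" and fin: "(\<integral>\<^sup>+ w. f w \<partial>lborel) < \<infinity>"
    and k: "\<And>p z. p \<in> P \<Longrightarrow> z \<in> E p \<Longrightarrow> k p z \<le> ennreal ((cmod (det (J p z)))\<^sup>2 * f (T p z))"
    and mult: "\<And>w. finite (SIGMA p:P. {z\<in>E p. T p z = w})" "\<And>w. card (SIGMA p:P. {z\<in>E p. T p z = w}) \<le> M"
  shows "(\<Sum>p\<in>P. \<integral>\<^sup>+ z\<in>E p. k p z \<partial>lborel) \<le> of_nat M * (\<integral>\<^sup>+ w. f w \<partial>lborel)"
proof -
  have "\<forall>p\<in>P. \<exists>N :: complex ^ 'n \<Rightarrow> ennreal. N \<in> borel_measurable borel \<and>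
    (\<integral>\<^sup>+ z\<in>E p. k p z \<partial>lborel) \<le> (\<integral>\<^sup>+ w. N w * ennreal (f w) \<partial>lborel) \<and>
    (\<forall>w. finite {z\<in>E p. T p z = w} \<longrightarrow> N w \<le> of_nat (card {z\<in>E p. T p z = w}))"
  proof
    fix p assume p: "p \<in> P"
    obtain N :: "complex ^ 'n \<Rightarrow> ennreal" where "N \<in> borel_measurable borel"
      "(\<integral>\<^sup>+ z\<in>E p. k p z \<partial>lborel) \<le> (\<integral>\<^sup>+ w. N w * ennreal (f w) \<partial>lborel)"
      "\<And>w. finite {z\<in>E p. T p z = w} \<Longrightarrow> N w \<le> of_nat (card {z\<in>E p. T p z = w})"
      by (rule nn_integral_image_multiplicity[OF U[OF p] E[OF p] der[OF p] contJ[OF p] inj[OF p] f fin k[OF p]];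
          (assumption | rule that; assumption))
    then show "\<exists>N :: complex ^ 'n \<Rightarrow> ennreal. N \<in> borel_measurable borel \<and>
      (\<integral>\<^sup>+ z\<in>E p. k p z \<partial>lborel) \<le> (\<integral>\<^sup>+ w. N w * ennreal (f w) \<partial>lborel) \<and>
      (\<forall>w. finite {z\<in>E p. T p z = w} \<longrightarrow> N w \<le> of_nat (card {z\<in>E p. T p z = w}))"
      by blast
  qed
  from bchoice[OF this] obtain N :: "'p \<Rightarrow> complex ^ 'n \<Rightarrow> ennreal" where
    N: "\<And>p. p \<in> P \<Longrightarrow> N p \<in> borel_measurable borel"
    "\<And>p. p \<in> P \<Longrightarrow> (\<integral>\<^sup>+ z\<in>E p. k p z \<partial>lborel) \<le> (\<integral>\<^sup>+ w. N p w * ennreal (f w) \<partial>lborel)"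
    "\<And>p w. p \<in> P \<Longrightarrow> finite {z\<in>E p. T p z = w} \<Longrightarrow> N p w \<le> of_nat (card {z\<in>E p. T p z = w})"
    by blast
  have fi: "finite {z\<in>E p. T p z = w}" if "p \<in> P" for p w
  proof (rule finite_subset)
    show "{z\<in>E p. T p z = w} \<subseteq> snd ` (SIGMA p:P. {z\<in>E p. T p z = w})"
      using that by (auto simp: image_iff)
    show "finite (snd ` (SIGMA p:P. {z\<in>E p. T p z = w}))" using mult(1) by (rule finite_imageI)
  qed
  have "(\<Sum>p\<in>P. \<integral>\<^sup>+ z\<in>E p. k p z \<partial>lborel) \<le> (\<Sum>p\<in>P. \<integral>\<^sup>+ w. N p w * ennreal (f w) \<partial>lborel)"
    by (intro sum_mono N)
  also have "\<dots> = (\<integral>\<^sup>+ w. (\<Sum>p\<in>P. N p w * ennreal (f w)) \<partial>lborel)"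
    by (rule nn_integral_sum[symmetric]) (use N(1) f in measurable)
  also have "\<dots> \<le> (\<integral>\<^sup>+ w. of_nat M * ennreal (f w) \<partial>lborel)"
  proof (rule nn_integral_mono)
    fix w
    have "(\<Sum>p\<in>P. N p w) \<le> (\<Sum>p\<in>P. of_nat (card {z\<in>E p. T p z = w}))"
      by (intro sum_mono N fi)
    also have "\<dots> = of_nat (card (SIGMA p:P. {z\<in>E p. T p z = w}))"
      using P fi by (subst card_SigmaI) auto
    also have "\<dots> \<le> of_nat M" using mult(2) by simp
    finally show "(\<Sum>p\<in>P. N p w * ennreal (f w)) \<le> of_nat M * ennreal (f w)"
      unfolding sum_distrib_right[symmetric] by (intro mult_right_mono) auto
  qed
  also have "\<dots> = of_nat M * (\<integral>\<^sup>+ w. f w \<partial>lborel)"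
    by (rule nn_integral_cmult) (use f in measurable)
  finally show ?thesis .
qed

text \<open>Decompose the ball into dyadic shells. On the shell of radius about
  \<open>R / 2 ^ k\<close> the integrand is of order \<open>4 ^ k\<close> and the volume of order
  \<open>2 ^ (- d * k)\<close>, with d the dimension; for d at least 3 the products are dominated by
  a geometric series of ratio 1/2.\<close>

lemma nn_integral_inverse_square_ball:
  fixes a :: "'a::euclidean_space"
  assumes dim: "DIM('a) \<ge> 3" and R: "R > 0"
  shows "(\<integral>\<^sup>+ w\<in>ball a R. ennreal (1 / (norm (w - a))\<^sup>2) \<partial>lborel) < \<infinity>"
proof -
  have le: "g k \<le> (\<Sum>k. g k)" for g :: "nat \<Rightarrow> ennreal" and k
    using sum_le_suminf[OF summableI, of "{k}" g] by simp
  let ?r = "\<lambda>k::nat. R / 2 ^ k"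
  let ?t = "\<lambda>k w. ennreal ((1 / ?r (Suc k))\<^sup>2) * indicator (ball a (?r k)) w"
  have "(\<integral>\<^sup>+ w\<in>ball a R. ennreal (1 / (norm (w - a))\<^sup>2) \<partial>lborel) \<le> (\<integral>\<^sup>+ w. (\<Sum>k. ?t k w) \<partial>lborel)"
  proof (rule nn_integral_mono)
    fix w :: 'a
    show "ennreal (1 / (norm (w - a))\<^sup>2) * indicator (ball a R) w \<le> (\<Sum>k. ?t k w)"
    \<comment> \<open>At the centre division by zero makes the integrand 0, so only the punctured
      ball needs an argument.\<close>
    proof (cases "w \<in> ball a R \<and> w \<noteq> a")
      case True
      then have w: "0 < norm (w - a)" "norm (w - a) < R" by (auto simp: dist_norm norm_minus_commute)
      have "\<exists>k. ?r (Suc k) \<le> norm (w - a)"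
      proof -
        have "0 < norm (w - a) / R" using w R by simp
        then obtain n where n: "(1/2) ^ n < norm (w - a) / R" using real_arch_pow_inv[of _ "1/2"] by auto
        have "?r (Suc n) \<le> R * (1/2) ^ n" using R by (simp add: power_divide field_simps)
        also have "\<dots> \<le> norm (w - a)" using n R by (simp add: field_simps)
        finally show ?thesis by blast
      qed
      \<comment> \<open>The least such \<open>k\<close> places \<open>w\<close> in the shell between
        the radii \<open>?r (Suc k)\<close> and \<open>?r k\<close>.\<close>
      then obtain k where k: "?r (Suc k) \<le> norm (w - a)" and least: "\<And>j. j < k \<Longrightarrow> \<not> ?r (Suc j) \<le> norm (w - a)"
        using exists_least_iff[of "\<lambda>k. ?r (Suc k) \<le> norm (w - a)"] by blast
      have "norm (w - a) < ?r k"
        using w least[of "k - 1"] by (cases k) auto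
      then have inb: "w \<in> ball a (?r k)" by (simp add: dist_norm norm_minus_commute)
      have "1 / (norm (w - a))\<^sup>2 \<le> (1 / ?r (Suc k))\<^sup>2"
      proof -
        have "R\<^sup>2 \<le> (norm (w - a) * (2 * 2 ^ k))\<^sup>2"
          using k R by (intro power_mono) (simp_all add: field_simps)
        then show ?thesis using w R by (simp add: power_divide field_simps power_mult_distrib)
      qed
      then have "ennreal (1 / (norm (w - a))\<^sup>2) * indicator (ball a R) w \<le> ?t k w"
        using inb True by (simp add: ennreal_leI)
      also have "\<dots> \<le> (\<Sum>k. ?t k w)"
        by (rule le)
      finally show ?thesis .
    qed auto
  qed
  also have "\<dots> = (\<Sum>k. \<integral>\<^sup>+ w. ?t k w \<partial>lborel)" 
    by (rule nn_integral_suminf) (intro borel_measurable_times_ennreal borel_measurable_const borel_measurable_indicator, simp)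
  also have "\<dots> = (\<Sum>k. ennreal ((1 / ?r (Suc k))\<^sup>2 * (unit_ball_vol DIM('a) * ?r k ^ DIM('a))))"
    using R by (intro suminf_cong) (simp add: nn_integral_cmult_indicator emeasure_ball ennreal_mult)
  also have "\<dots> \<le> (\<Sum>k. ennreal (4 * unit_ball_vol DIM('a) * R ^ DIM('a) / R\<^sup>2 * (1/2) ^ k))"
  proof (intro suminf_le summableI ennreal_leI)
    fix k
    have "(1 / ?r (Suc k))\<^sup>2 * (unit_ball_vol DIM('a) * ?r k ^ DIM('a)) =
      4 * unit_ball_vol DIM('a) * R ^ DIM('a) / R\<^sup>2 * ((2 ^ k)\<^sup>2 * (1 / 2 ^ k) ^ DIM('a))"
      using R by (simp add: power_divide field_simps power2_eq_square)
    also have "\<dots> \<le> 4 * unit_ball_vol DIM('a) * R ^ DIM('a) / R\<^sup>2 * (1/2) ^ k"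
    proof (rule mult_left_mono)
      \<comment> \<open>Here the dimension enters: two factors of the cube cancel the growth of the
        integrand and one remains for convergence.\<close>
      have "(1 / 2 ^ k :: real) ^ DIM('a) \<le> (1 / 2 ^ k) ^ 3"
        by (rule power_decreasing) (use dim in auto)
      then have "(2 ^ k)\<^sup>2 * (1 / 2 ^ k :: real) ^ DIM('a) \<le> (2 ^ k)\<^sup>2 * (1 / 2 ^ k) ^ 3"
        by (rule mult_left_mono) simp
      also have "\<dots> = (1/2) ^ k" by (simp add: power2_eq_square power3_eq_cube power_divide)
      finally show "(2 ^ k)\<^sup>2 * (1 / 2 ^ k :: real) ^ DIM('a) \<le> (1/2) ^ k" .
    qed (use R in \<open>auto intro!: divide_nonneg_nonneg mult_nonneg_nonneg\<close>)
    finally show "(1 / ?r (Suc k))\<^sup>2 * (unit_ball_vol DIM('a) * ?r k ^ DIM('a))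
        \<le> 4 * unit_ball_vol DIM('a) * R ^ DIM('a) / R\<^sup>2 * (1/2) ^ k" .
  qed
  also have "\<dots> < \<infinity>"
  proof -
    have "summable (\<lambda>k. 4 * unit_ball_vol DIM('a) * R ^ DIM('a) / R\<^sup>2 * (1/2) ^ k)"
      by (intro summable_mult summable_geometric) simp
    then show ?thesis
      by (subst suminf_ennreal2) (use R in \<open>auto intro!: divide_nonneg_nonneg mult_nonneg_nonneg\<close>)
  qed
  finally show ?thesis .
qed

subsection \<open>Calculus of holomorphic functions of several variables\<close>

lemma bounded_linear_vector_smult: "bounded_linear (\<lambda>t::complex. t *s (v :: complex ^ 'm::finite))"
proof (rule linear_conv_bounded_linear[THEN iffD1], rule linearI)
  fix b c :: complex and r :: real
  show "(b + c) *s v = b *s v + c *s v" by (simp add: vec_eq_iff algebra_simps)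
  show "(r *\<^sub>R b) *s v = r *\<^sub>R (b *s v)" by (simp add: vec_eq_iff)
qed

lemma axis_eq_smult: "axis i t = t *s (axis i 1 :: complex ^ 'm::finite)"
  by (simp add: axis_def vec_eq_iff)

lemma bounded_linear_axis: "bounded_linear (axis i :: complex \<Rightarrow> complex ^ 'm::finite)"
  using bounded_linear_vector_smult[of "axis i 1"] by (simp flip: axis_eq_smult)

lemma bounded_linear_csum: "bounded_linear (\<lambda>v :: complex ^ 'm::finite. \<Sum>i\<in>UNIV. c i * v $ i)"
  by (intro bounded_linear_sum bounded_linear_const_mult bounded_linear_vec_nth)

text \<open>A complex linear derivative is determined by its values on the coordinate vectors, and
  those are the derivatives along the coordinate lines.\<close>

lemma hol_fun_has_derivative:
  assumes "hol_fun F U" "z \<in> U"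
  shows "(F has_derivative (\<lambda>v. \<Sum>i\<in>UNIV. cpartial i F z * v $ i)) (at z)"
proof -
  obtain D where D: "(F has_derivative D) (at z)" and c: "\<And>a v. D (a *s v) = a * D v"
    using assms unfolding hol_fun_def by blast
  have lin: "linear D" using D has_derivative_bounded_linear bounded_linear.linear by blast
  have p: "cpartial i F z = D (axis i 1)" for i
  proof -
    have a0: "axis i (0::complex) = 0" by (simp add: axis_def zero_vec_def)
    have a: "((\<lambda>t. z + axis i t) has_derivative axis i) (at 0)"
      using has_derivative_add[OF has_derivative_const[of z] bounded_linear_imp_has_derivative[OF bounded_linear_axis]] by simp
    have "((\<lambda>t. F (z + axis i t)) has_derivative (\<lambda>t. D (axis i t))) (at 0)"
      by (rule has_derivative_compose[OF a]) (simp only: a0 add_0_right D)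
    moreover have "D (axis i t) = D (axis i 1) * t" for t
      using c[of t "axis i 1"] by (simp only: axis_eq_smult[symmetric] mult.commute)
    then have "(\<lambda>t. D (axis i t)) = (*) (D (axis i 1))" by (rule ext)
    ultimately have "((\<lambda>t. F (z + axis i t)) has_field_derivative D (axis i 1)) (at 0)"
      by (simp only: has_field_derivative_def)
    then show ?thesis unfolding cpartial_def by (rule DERIV_imp_deriv)
  qed
  have "D v = (\<Sum>i\<in>UNIV. cpartial i F z * v $ i)" for v
  proof -
    have "D v = D (\<Sum>i\<in>UNIV. v $ i *s axis i 1)" by (simp add: basis_expansion)
    also have "\<dots> = (\<Sum>i\<in>UNIV. D (v $ i *s axis i 1))" by (rule linear_sum[OF lin])
    finally show ?thesis by (simp add: c p mult.commute)
  qed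
  then have "D = (\<lambda>v. \<Sum>i\<in>UNIV. cpartial i F z * v $ i)" by (rule ext)
  then show ?thesis using D by simp
qed

lemma hol_funI:
  assumes "\<And>z. z \<in> U \<Longrightarrow> (F has_derivative (\<lambda>v. \<Sum>i\<in>UNIV. c z i * v $ i)) (at z)"
  shows "hol_fun F U"
  unfolding hol_fun_def
proof
  fix z assume "z \<in> U"
  then show "\<exists>D. (F has_derivative D) (at z) \<and> (\<forall>a v. D (a *s v) = a * D v)"
    by (intro exI[of _ "\<lambda>v. \<Sum>i\<in>UNIV. c z i * v $ i"] conjI assms)
       (simp_all add: sum_distrib_left mult_ac)
qed

lemma cpartial_unique:
  assumes "(F has_derivative (\<lambda>v. \<Sum>i\<in>UNIV. c i * v $ i)) (at z)"
  shows "cpartial i F z = c i"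
proof -
  have "hol_fun F {z}" by (rule hol_funI[where c = "\<lambda>_. c"]) (use assms in auto)
  from has_derivative_unique[OF hol_fun_has_derivative[OF this] assms]
  have e: "(\<Sum>i\<in>UNIV. cpartial i F z * v $ i) = (\<Sum>i\<in>UNIV. c i * v $ i)" for v
    by (simp add: fun_eq_iff)
  show ?thesis using e[of "axis i 1"] by (simp add: axis_def if_distrib[of "\<lambda>t. _ * t"] cong: if_cong)
qed

lemma hol_fun_subset: "hol_fun F U \<Longrightarrow> V \<subseteq> U \<Longrightarrow> hol_fun F V"
  by (auto simp: hol_fun_def)

lemma hol_fun_transform:
  assumes "hol_fun F U" "open U" "\<And>z. z \<in> U \<Longrightarrow> F z = G z"
  shows "hol_fun G U"
  using assms unfolding hol_fun_def by (meson has_derivative_transform_within_open)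

lemma hol_fun_continuous_on: "hol_fun F U \<Longrightarrow> continuous_on U F"
  by (meson continuous_at_imp_continuous_on has_derivative_continuous hol_fun_def)

lemma hol_fun_const: "hol_fun (\<lambda>_. c) U"
  by (rule hol_funI[where c = "\<lambda>_ _. 0"]) simp

lemma hol_fun_nth: "hol_fun (\<lambda>z. z $ j) U"
  unfolding hol_fun_def
  by (intro ballI exI[of _ "\<lambda>z. z $ j"]) (auto intro: bounded_linear_imp_has_derivative bounded_linear_vec_nth)

lemma hol_fun_add:
  assumes "hol_fun F U" "hol_fun G U" shows "hol_fun (\<lambda>z. F z + G z) U"
  by (rule hol_funI[where c = "\<lambda>z i. cpartial i F z + cpartial i G z"])
     (use assms[THEN hol_fun_has_derivative] in \<open>auto intro!: derivative_eq_intros simp: algebra_simps sum.distrib\<close>)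

lemma hol_fun_mult:
  assumes "hol_fun F U" "hol_fun G U" shows "hol_fun (\<lambda>z. F z * G z) U"
  by (rule hol_funI[where c = "\<lambda>z i. F z * cpartial i G z + cpartial i F z * G z"])
     (use assms[THEN hol_fun_has_derivative] in
       \<open>auto intro!: derivative_eq_intros simp: algebra_simps sum.distrib sum_distrib_left\<close>)

lemma hol_fun_sum:
  assumes "\<And>i. i \<in> I \<Longrightarrow> hol_fun (F i) U" shows "hol_fun (\<lambda>z. \<Sum>i\<in>I. F i z) U"
  using assms by (induction I rule: infinite_finite_induct) (auto intro: hol_fun_const hol_fun_add)

lemma hol_fun_prod:
  assumes "\<And>i. i \<in> I \<Longrightarrow> hol_fun (F i) U" shows "hol_fun (\<lambda>z. \<Prod>i\<in>I. F i z) U"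
  using assms by (induction I rule: infinite_finite_induct) (auto intro: hol_fun_const hol_fun_mult)

lemma hol_fun_compose_holomorphic:
  assumes F: "hol_fun F U" and g: "\<And>z. z \<in> U \<Longrightarrow> (g has_field_derivative g' z) (at (F z))"
  shows "hol_fun (\<lambda>z. g (F z)) U"
proof (rule hol_funI[where c = "\<lambda>z i. g' z * cpartial i F z"])
  fix z assume z: "z \<in> U"
  show "((\<lambda>z. g (F z)) has_derivative (\<lambda>v. \<Sum>i\<in>UNIV. g' z * cpartial i F z * v $ i)) (at z)"
    using has_derivative_compose[OF hol_fun_has_derivative[OF F z] g[OF z, unfolded has_field_derivative_def]]
    by (simp add: sum_distrib_left mult_ac)
qed

lemma hol_fun_divide:
  assumes "hol_fun F U" "hol_fun G U" "\<And>z. z \<in> U \<Longrightarrow> G z \<noteq> 0"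
  shows "hol_fun (\<lambda>z. F z / G z) U"
proof -
  have "hol_fun (\<lambda>z. inverse (G z)) U"
    by (rule hol_fun_compose_holomorphic[OF assms(2), where g' = "\<lambda>z. - (inverse (G z) ^ Suc (Suc 0))"])
       (rule DERIV_inverse, rule assms(3))
  then show ?thesis using hol_fun_mult[OF assms(1)] by (simp add: divide_inverse)
qed

lemma has_derivative_vecI:
  fixes g :: "'a::real_normed_vector \<Rightarrow> complex ^ 'k::finite"
  assumes "\<And>i. ((\<lambda>x. g x $ i) has_derivative (\<lambda>v. g' v $ i)) F"
  shows "(g has_derivative g') F"
proof -
  have "((\<lambda>x. \<Sum>i\<in>UNIV. axis i (g x $ i)) has_derivative (\<lambda>v. \<Sum>i\<in>UNIV. axis i (g' v $ i))) F"
    by (intro has_derivative_sum bounded_linear.has_derivative[OF bounded_linear_axis] assms)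
  moreover have "(\<Sum>i\<in>UNIV. axis i (w $ i)) = w" for w :: "complex ^ 'k"
    by (subst axis_eq_smult) (rule basis_expansion)
  ultimately show ?thesis by simp
qed

lemma hol_map_has_derivative:
  assumes "hol_map g U" "z \<in> U"
  shows "(g has_derivative (\<lambda>v. cjacobian g z *v v)) (at z)"
proof (rule has_derivative_vecI)
  fix i
  have "hol_fun (\<lambda>w. g w $ i) U" using assms(1) by (simp add: hol_map_def)
  from hol_fun_has_derivative[OF this assms(2)]
  show "((\<lambda>x. g x $ i) has_derivative (\<lambda>v. (cjacobian g z *v v) $ i)) (at z)"
    by (simp add: cjacobian_def matrix_vector_mult_def)
qed

lemma hol_map_continuous_on: "hol_map g U \<Longrightarrow> continuous_on U g"
  by (meson continuous_at_imp_continuous_on has_derivative_continuous hol_map_has_derivative)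

lemma hol_map_subset: "hol_map F U \<Longrightarrow> V \<subseteq> U \<Longrightarrow> hol_map F V"
  by (auto simp: hol_map_def intro: hol_fun_subset)

lemma has_derivative_compose_hol:
  assumes "hol_map g U" "z \<in> U" and F: "(F has_derivative (\<lambda>v. \<Sum>i\<in>UNIV. c i * v $ i)) (at (g z))"
  shows "((\<lambda>z. F (g z)) has_derivative (\<lambda>v. \<Sum>j\<in>UNIV. (\<Sum>i\<in>UNIV. c i * cjacobian g z $ i $ j) * v $ j)) (at z)"
proof -
  have "((\<lambda>z. F (g z)) has_derivative (\<lambda>v. \<Sum>i\<in>UNIV. c i * (cjacobian g z *v v) $ i)) (at z)"
    using has_derivative_compose[OF hol_map_has_derivative[OF assms(1,2)] F] .
  moreover have "(\<Sum>i\<in>UNIV. c i * (cjacobian g z *v v) $ i) = (\<Sum>j\<in>UNIV. (\<Sum>i\<in>UNIV. c i * cjacobian g z $ i $ j) * v $ j)" for v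
    by (simp add: matrix_vector_mult_def sum_distrib_left sum_distrib_right mult.assoc) (rule sum.swap)
  ultimately show ?thesis by simp
qed

lemma hol_fun_compose:
  assumes g: "hol_map g U" and F: "hol_fun F V" and "g ` U \<subseteq> V"
  shows "hol_fun (\<lambda>z. F (g z)) U"
  by (rule hol_funI, rule has_derivative_compose_hol[OF g]) (use assms in \<open>auto intro!: hol_fun_has_derivative\<close>)

lemma cpartial_compose:
  assumes g: "hol_map g U" "z \<in> U" and F: "hol_fun F V" "g z \<in> V"
  shows "cpartial j (\<lambda>z. F (g z)) z = (\<Sum>i\<in>UNIV. cpartial i F (g z) * cjacobian g z $ i $ j)"
  by (rule cpartial_unique[OF has_derivative_compose_hol[OF g hol_fun_has_derivative[OF F]]])

lemma hol_map_compose: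
  assumes "hol_map g U" "hol_map F V" "g ` U \<subseteq> V"
  shows "hol_map (\<lambda>z. F (g z)) U"
  using assms hol_fun_compose unfolding hol_map_def by blast

lemma cjacobian_compose:
  assumes g: "hol_map g U" "z \<in> U" and F: "hol_map F V" "g z \<in> V"
  shows "cjacobian (\<lambda>z. F (g z)) z = cjacobian F (g z) ** cjacobian g z"
proof -
  have "cjacobian (\<lambda>z. F (g z)) z $ i $ j = (cjacobian F (g z) ** cjacobian g z) $ i $ j" for i j
    using cpartial_compose[OF g _ F(2), of "\<lambda>w. F w $ i" j] F(1)
    by (simp add: hol_map_def cjacobian_def matrix_matrix_mult_def)
  then show ?thesis by (simp add: vec_eq_iff)
qed

lemma has_derivative_line:
  fixes F :: "complex ^ 'm::finite \<Rightarrow> complex"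
  assumes "(F has_derivative (\<lambda>v. \<Sum>i\<in>UNIV. c i * v $ i)) (at (z + t0 *s v))"
  shows "((\<lambda>t. F (z + t *s v)) has_field_derivative (\<Sum>i\<in>UNIV. c i * v $ i)) (at t0)"
proof -
  have "((\<lambda>t. z + t *s v) has_derivative (\<lambda>t. t *s v)) (at t0)"
    using has_derivative_add[OF has_derivative_const[of z] bounded_linear_imp_has_derivative[OF bounded_linear_vector_smult]] by simp
  from has_derivative_compose[OF this assms]
  have "((\<lambda>t. F (z + t *s v)) has_derivative (\<lambda>t. \<Sum>i\<in>UNIV. c i * (t *s v) $ i)) (at t0)" .
  moreover have "(\<lambda>t. \<Sum>i\<in>UNIV. c i * (t *s v) $ i) = (*) (\<Sum>i\<in>UNIV. c i * v $ i)"
    by (rule ext) (simp add: sum_distrib_left sum_distrib_right mult_ac)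
  ultimately show ?thesis by (simp only: has_field_derivative_def)
qed

lemma hol_fun_line:
  assumes "hol_fun F U" "z + t0 *s v \<in> U"
  shows "((\<lambda>t. F (z + t *s v)) has_field_derivative (\<Sum>i\<in>UNIV. cpartial i F (z + t0 *s v) * v $ i)) (at t0)"
  by (rule has_derivative_line[OF hol_fun_has_derivative[OF assms]])

section \<open>Contour integrals with parameters and Cauchy's formula in one coordinate\<close>

lemma continuous_on_contour_param:
  assumes "continuous_on (U \<times> sphere a \<rho>) (\<lambda>(z, \<zeta>). K z \<zeta>)" "\<rho> \<ge> 0"
  shows "continuous_on U (\<lambda>z. contour_integral (circlepath a \<rho>) (K z))"
proof -
  have "continuous_on (U \<times> {0..1}) (\<lambda>(z, t). K z (circlepath a \<rho> t))"
  proof -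
    have "continuous_on (U \<times> {0..1}) (\<lambda>x. (fst x, circlepath a \<rho> (snd x)))"
      unfolding circlepath by (intro continuous_intros)
    moreover have "(\<lambda>x. (fst x, circlepath a \<rho> (snd x))) ` (U \<times> {0..1}) \<subseteq> U \<times> sphere a \<rho>"
      using assms(2) by (auto simp: circlepath dist_norm norm_mult)
    ultimately show ?thesis
      using continuous_on_compose2[OF assms(1), of "U \<times> {0..1}" "\<lambda>x. (fst x, circlepath a \<rho> (snd x))"]
      by (simp add: case_prod_beta)
  qed
  then have "continuous_on (U \<times> cbox 0 1) (\<lambda>(z, t). K z (circlepath a \<rho> t) * vector_derivative (circlepath a \<rho>) (at t))"
    unfolding vector_derivative_circlepath case_prod_beta cbox_interval by (intro continuous_intros)
  from integral_continuous_on_param[OF this] show ?thesis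
    by (simp add: contour_integral_integral)
qed

text \<open>Leibniz' rule on the parameter interval of the circle; the complex linear form of the
  derivative is kept explicit so that it yields holomorphy directly.\<close>

lemma has_derivative_contour_param:
  fixes K :: "complex ^ 'm::finite \<Rightarrow> complex \<Rightarrow> complex"
  assumes U: "open U" "z0 \<in> U" and \<rho>: "\<rho> \<ge> 0"
    and der: "\<And>z \<zeta>. z \<in> U \<Longrightarrow> \<zeta> \<in> sphere a \<rho> \<Longrightarrow> ((\<lambda>z. K z \<zeta>) has_derivative (\<lambda>v. \<Sum>i\<in>UNIV. Kp i z \<zeta> * v $ i)) (at z)"
    and contK: "\<And>z. z \<in> U \<Longrightarrow> continuous_on (sphere a \<rho>) (K z)"
    and contKp: "\<And>i. continuous_on (U \<times> sphere a \<rho>) (\<lambda>(z, \<zeta>). Kp i z \<zeta>)"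
  shows "((\<lambda>z. contour_integral (circlepath a \<rho>) (K z)) has_derivative
          (\<lambda>v. \<Sum>i\<in>UNIV. contour_integral (circlepath a \<rho>) (Kp i z0) * v $ i)) (at z0)"
proof -
  let ?\<gamma> = "circlepath a \<rho>" and ?\<gamma>' = "\<lambda>t. vector_derivative (circlepath a \<rho>) (at t)"
  obtain e where e: "e > 0" "ball z0 e \<subseteq> U" using U open_contains_ball by blast
  let ?B = "ball z0 e"
  have sph: "?\<gamma> t \<in> sphere a \<rho>" for t :: real using \<rho> by (auto simp: circlepath dist_norm norm_mult)
  have cg: "continuous_on S ?\<gamma>" for S unfolding circlepath by (intro continuous_intros)
  have cg': "continuous_on S ?\<gamma>'" for S unfolding vector_derivative_circlepath by (intro continuous_intros)
  \<comment> \<open>\<open>leibniz_rule\<close> wants the derivative as a continuous function with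
    values in bounded linear maps.\<close>
  define fx where "fx z t = Blinfun (\<lambda>v. \<Sum>i\<in>UNIV. (Kp i z (?\<gamma> t) * ?\<gamma>' t) * v $ i)" for z t
  have fx: "blinfun_apply (fx z t) = (\<lambda>v. \<Sum>i\<in>UNIV. (Kp i z (?\<gamma> t) * ?\<gamma>' t) * v $ i)" for z t
    unfolding fx_def by (rule bounded_linear_Blinfun_apply[OF bounded_linear_csum])
  have cp: "continuous_on (?B \<times> {0..1}) (\<lambda>x. Kp i (fst x) (?\<gamma> (snd x)))" for i
  proof -
    have "continuous_on (?B \<times> {0..1}) (\<lambda>x. (fst x, ?\<gamma> (snd x)))"
      unfolding circlepath by (intro continuous_intros)
    moreover have "(\<lambda>x. (fst x, ?\<gamma> (snd x))) ` (?B \<times> {0..1}) \<subseteq> U \<times> sphere a \<rho>"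
      using e sph by auto
    ultimately show ?thesis
      using continuous_on_compose2[OF contKp, of "?B \<times> {0..1}" "\<lambda>x. (fst x, ?\<gamma> (snd x))"]
      by (simp add: case_prod_beta)
  qed
  have cfx: "continuous_on (?B \<times> cbox 0 1) (\<lambda>(z, t). fx z t)"
    unfolding case_prod_beta cbox_interval
  proof (rule continuous_on_blinfun_componentwise)
    fix v :: "complex ^ 'm"
    have "continuous_on (?B \<times> {0..1}) (\<lambda>x. ?\<gamma>' (snd x))"
      unfolding vector_derivative_circlepath by (intro continuous_intros)
    then show "continuous_on (?B \<times> {0..1}) (\<lambda>x. blinfun_apply (fx (fst x) (snd x)) v)"
      unfolding fx by (intro continuous_intros cp)
  qed
  have "((\<lambda>z. integral (cbox 0 1) (\<lambda>t. K z (?\<gamma> t) * ?\<gamma>' t)) has_derivative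
      blinfun_apply (integral (cbox 0 1) (fx z0))) (at z0 within ?B)"
  proof (rule leibniz_rule[OF _ _ cfx])
    fix z t assume zt: "z \<in> ?B" "t \<in> cbox 0 (1::real)"
    have "((\<lambda>z. K z (?\<gamma> t)) has_derivative (\<lambda>v. \<Sum>i\<in>UNIV. Kp i z (?\<gamma> t) * v $ i)) (at z within ?B)"
      by (rule has_derivative_at_withinI[OF der]) (use zt e sph in auto)
    then have "((\<lambda>z. K z (?\<gamma> t) * ?\<gamma>' t) has_derivative (\<lambda>v. (\<Sum>i\<in>UNIV. Kp i z (?\<gamma> t) * v $ i) * ?\<gamma>' t)) (at z within ?B)"
      by (rule has_derivative_mult_left)
    then show "((\<lambda>z. K z (?\<gamma> t) * ?\<gamma>' t) has_derivative blinfun_apply (fx z t)) (at z within ?B)"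
      unfolding fx by (simp add: sum_distrib_left sum_distrib_right mult_ac)
  next
    fix z assume z: "z \<in> ?B"
    have "continuous_on (cbox 0 1) (\<lambda>t. K z (?\<gamma> t) * ?\<gamma>' t)"
      by (intro continuous_intros continuous_on_compose2[OF contK cg] cg') (use z e sph in auto)
    then show "(\<lambda>t. K z (?\<gamma> t) * ?\<gamma>' t) integrable_on cbox 0 1" by (rule integrable_continuous)
  qed (use e in auto)
  moreover have "blinfun_apply (integral (cbox 0 1) (fx z0)) = (\<lambda>v. \<Sum>i\<in>UNIV. contour_integral ?\<gamma> (Kp i z0) * v $ i)"
  proof
    fix v
    have "continuous_on (cbox 0 1) (fx z0)"
      by (rule continuous_on_compose2[OF cfx, of _ "\<lambda>t. (z0, t)", simplified]) (use e in \<open>auto intro!: continuous_intros\<close>)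
    then have i: "fx z0 integrable_on cbox 0 1" by (rule integrable_continuous)
    have cK: "continuous_on (cbox 0 1) (\<lambda>t. Kp i z0 (?\<gamma> t) * ?\<gamma>' t)" for i
      by (intro continuous_intros cg' continuous_on_compose2[OF cp, of _ "\<lambda>t. (z0, t)", simplified]) (use e in auto)
    have "blinfun_apply (integral (cbox 0 1) (fx z0)) v = integral (cbox 0 1) (\<lambda>t. blinfun_apply (fx z0 t) v)"
      using integral_linear[OF i blinfun.bounded_linear_left[of v]] by (simp add: o_def)
    also have "\<dots> = (\<Sum>i\<in>UNIV. integral (cbox 0 1) (\<lambda>t. (Kp i z0 (?\<gamma> t) * ?\<gamma>' t) * v $ i))"
      unfolding fx by (intro integral_sum integrable_on_mult_left integrable_continuous cK) auto
    also have "\<dots> = (\<Sum>i\<in>UNIV. contour_integral ?\<gamma> (Kp i z0) * v $ i)"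
      by (simp add: contour_integral_integral)
    finally show "blinfun_apply (integral (cbox 0 1) (fx z0)) v = (\<Sum>i\<in>UNIV. contour_integral ?\<gamma> (Kp i z0) * v $ i)" .
  qed
  ultimately show ?thesis
    using e by (simp add: contour_integral_integral at_within_open[OF _ open_ball])
qed

lemma cjacobian_eq_mat_1:
  fixes h :: "complex ^ 'm::finite \<Rightarrow> complex ^ 'm"
  assumes "open W" "z \<in> W" "\<And>w. w \<in> W \<Longrightarrow> h w = w"
  shows "cjacobian h z = mat 1"
proof -
  have "cpartial j (\<lambda>w. h w $ i) z = mat 1 $ i $ j" for i j
  proof (rule cpartial_unique)
    have "((\<lambda>z. z $ i) has_derivative (\<lambda>v. \<Sum>j\<in>UNIV. mat 1 $ i $ j * v $ j)) (at z)"
      using bounded_linear_imp_has_derivative[OF bounded_linear_vec_nth, of i]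
      by (simp add: mat_def if_distrib[of "\<lambda>t. t * _"] cong: if_cong)
    then show "((\<lambda>w. h w $ i) has_derivative (\<lambda>v. \<Sum>j\<in>UNIV. mat 1 $ i $ j * v $ j)) (at z)"
      by (rule has_derivative_transform_within_open[OF _ assms(1,2)]) (simp add: assms(3))
  qed
  then show ?thesis by (simp add: cjacobian_def vec_eq_iff)
qed

lemma exists_ball_close:
  fixes g :: "'a::metric_space \<Rightarrow> 'b::metric_space" and h :: "'a \<Rightarrow> 'c::metric_space"
  assumes g: "continuous_on U g" and h: "continuous_on U h" and U: "open U" "p \<in> U" and ab: "a > 0" "b > 0"
  shows "\<exists>e>0. \<forall>y. dist y p < e \<longrightarrow> dist (g y) (g p) < a \<and> dist (h y) (h p) < b \<and> y \<in> U"
proof -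
  have "isCont g p" "isCont h p" using g h U continuous_on_eq_continuous_at by blast+
  then have "\<forall>\<^sub>F y in nhds p. dist (g y) (g p) < a" "\<forall>\<^sub>F y in nhds p. dist (h y) (h p) < b"
    using tendsto_at_iff_tendsto_nhds[of g p] tendsto_at_iff_tendsto_nhds[of h p] ab
    unfolding isCont_def by (blast dest: tendstoD)+
  moreover have "\<forall>\<^sub>F y in nhds p. y \<in> U" using U by (rule eventually_nhds_in_open)
  ultimately have "\<forall>\<^sub>F y in nhds p. dist (g y) (g p) < a \<and> dist (h y) (h p) < b \<and> y \<in> U"
    by (intro eventually_conj)
  then show ?thesis unfolding eventually_nhds_metric .
qed

lemma open_nonzero:
  fixes g :: "'a::topological_space \<Rightarrow> complex"
  assumes "continuous_on U g" "open U"
  shows "open {z \<in> U. g z \<noteq> 0}"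
  using continuous_open_preimage[OF assms, of "- {0}"] by (simp add: vimage_def Int_def open_Compl)

lemma continuous_on_axis [continuous_intros]:
  fixes f :: "'a::topological_space \<Rightarrow> complex"
  assumes "continuous_on S f" shows "continuous_on S (\<lambda>x. axis i (f x) :: complex ^ 'm::finite)"
  using bounded_linear.continuous_on[OF bounded_linear_axis assms] .

lemma norm_axis_complex: "norm (axis i (t::complex) :: complex ^ 'm::finite) = cmod t"
  by (simp add: norm_vec_def L2_set_def axis_def if_distrib[of "\<lambda>t. (norm t)\<^sup>2"] cong: if_cong)

text \<open>Cauchy's formula for the first derivative on a coordinate line. It expresses the partial
  derivative through values of \<open>F\<close> alone, so that regularity of \<open>F\<close> passes
  to its derivatives.\<close>

lemma cpartial_contour_integral:
  fixes F :: "complex ^ 'm::finite \<Rightarrow> complex"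
  assumes F: "hol_fun F U" "open U" and \<rho>: "\<rho> > 0" and U: "\<And>\<zeta>. \<zeta> \<in> cball 0 \<rho> \<Longrightarrow> z + axis j \<zeta> \<in> U"
  shows "cpartial j F z = 1 / (2 * of_real pi * \<i>) * contour_integral (circlepath 0 \<rho>) (\<lambda>\<zeta>. F (z + axis j \<zeta>) / \<zeta>\<^sup>2)"
proof -
  have der: "((\<lambda>t. F (z + axis j t)) has_field_derivative (\<Sum>i\<in>UNIV. cpartial i F (z + axis j t0) * axis j 1 $ i)) (at t0)"
    if "t0 \<in> cball 0 \<rho>" for t0
    using hol_fun_line[OF F(1), of z t0 "axis j 1"] U[OF that] by (simp flip: axis_eq_smult)
  have "((\<lambda>t. F (z + axis j t)) has_field_derivative
      1 / (2 * of_real pi * \<i>) * contour_integral (circlepath 0 \<rho>) (\<lambda>\<zeta>. F (z + axis j \<zeta>) / (\<zeta> - 0)\<^sup>2)) (at 0)"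
  proof (rule Cauchy_derivative_integral_circlepath(2))
    show "continuous_on (cball 0 \<rho>) (\<lambda>t. F (z + axis j t))"
      using der by (intro continuous_at_imp_continuous_on ballI) (use DERIV_isCont in blast)
    show "(\<lambda>t. F (z + axis j t)) holomorphic_on ball 0 \<rho>"
      using der by (intro holomorphic_onI) (meson ball_subset_cball field_differentiable_at_within field_differentiable_def subsetD)
  qed (use \<rho> in auto)
  then show ?thesis unfolding cpartial_def by (simp add: DERIV_imp_deriv)
qed

lemma hol_fun_cball:
  fixes z0 :: "complex ^ 'm::finite"
  assumes "open U" "z0 \<in> U"
  obtains \<rho> where "\<rho> > 0" "\<And>z j \<zeta>. z \<in> ball z0 \<rho> \<Longrightarrow> \<zeta> \<in> cball 0 \<rho> \<Longrightarrow> z + axis j \<zeta> \<in> U"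
proof -
  obtain e where e: "e > 0" "ball z0 e \<subseteq> U" using assms open_contains_ball by blast
  show ?thesis
  proof (rule that[of "e/2"])
    fix z :: "complex ^ 'm" and j and \<zeta> :: complex
    assume "z \<in> ball z0 (e/2)" "\<zeta> \<in> cball 0 (e/2)"
    then have "dist z0 z + norm (axis j \<zeta> :: complex ^ 'm) < e" by (simp add: norm_axis_complex)
    moreover have "dist z0 (z + axis j \<zeta>) \<le> dist z0 z + norm (axis j \<zeta> :: complex ^ 'm)"
      using dist_triangle[of z0 "z + axis j \<zeta>" z] by (simp add: dist_norm)
    ultimately show "z + axis j \<zeta> \<in> U" using e(2) by (simp add: subset_iff)
  qed (use e in auto)
qed

text \<open>\<open>hol_fun\<close> demands a complex derivative at each point but no continuity of
  it; continuity comes from the integral formula.\<close>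

lemma continuous_on_cpartial:
  fixes F :: "complex ^ 'm::finite \<Rightarrow> complex"
  assumes F: "hol_fun F U" "open U"
  shows "continuous_on U (cpartial j F)"
proof (rule continuous_at_imp_continuous_on, rule ballI)
  fix z0 assume z0: "z0 \<in> U"
  obtain \<rho> where \<rho>: "\<rho> > 0" "\<And>z j \<zeta>. z \<in> ball z0 \<rho> \<Longrightarrow> \<zeta> \<in> cball 0 \<rho> \<Longrightarrow> z + axis j \<zeta> \<in> U"
    using hol_fun_cball[OF F(2) z0] by metis
  have "continuous_on (ball z0 \<rho> \<times> sphere 0 \<rho>) (\<lambda>(z, \<zeta>). F (z + axis j \<zeta>) / \<zeta>\<^sup>2)"
    unfolding case_prod_beta
    by (intro continuous_intros continuous_on_compose2[OF hol_fun_continuous_on[OF F(1)]]) (use \<rho> in auto)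
  from continuous_on_contour_param[OF this] \<rho>(1)
  have "continuous_on (ball z0 \<rho>) (\<lambda>z. 1 / (2 * of_real pi * \<i>) * contour_integral (circlepath 0 \<rho>) (\<lambda>\<zeta>. F (z + axis j \<zeta>) / \<zeta>\<^sup>2))"
    by (intro continuous_intros) auto
  moreover have "cpartial j F z = 1 / (2 * of_real pi * \<i>) * contour_integral (circlepath 0 \<rho>) (\<lambda>\<zeta>. F (z + axis j \<zeta>) / \<zeta>\<^sup>2)"
    if "z \<in> ball z0 \<rho>" for z
    by (rule cpartial_contour_integral[OF F \<rho>(1)]) (use \<rho>(2) that in blast)
  ultimately have "continuous_on (ball z0 \<rho>) (cpartial j F)"
    by (rule continuous_on_eq[OF _ sym])
  then show "isCont (cpartial j F) z0"
    using \<rho>(1) by (simp add: continuous_on_eq_continuous_at)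
qed

text \<open>The coefficients are left as contour integrals over a known radius: read backwards, the
  same integrals are Cauchy's formula for \<open>cpartial j (cpartial i F)\<close>, which gives the
  symmetry of second derivatives in \<open>cpartial_commute\<close>.\<close>

lemma cpartial_has_derivative:
  fixes F :: "complex ^ 'm::finite \<Rightarrow> complex"
  assumes F: "hol_fun F U" "open U" and z0: "z0 \<in> U"
  shows "\<exists>\<rho>>0. (\<forall>\<zeta>\<in>cball 0 \<rho>. z0 + axis j \<zeta> \<in> U) \<and> (cpartial j F has_derivative (\<lambda>v. \<Sum>i\<in>UNIV.
    (1 / (2 * of_real pi * \<i>) * contour_integral (circlepath 0 \<rho>) (\<lambda>\<zeta>. cpartial i F (z0 + axis j \<zeta>) / \<zeta>\<^sup>2)) * v $ i)) (at z0)"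
proof -
  obtain \<rho> where \<rho>: "\<rho> > 0" "\<And>z j \<zeta>. z \<in> ball z0 \<rho> \<Longrightarrow> \<zeta> \<in> cball 0 \<rho> \<Longrightarrow> z + axis j \<zeta> \<in> U"
    using hol_fun_cball[OF F(2) z0] by metis
  have inU: "z + axis j \<zeta> \<in> U" if "z \<in> ball z0 \<rho>" "\<zeta> \<in> sphere 0 \<rho>" for z :: "complex ^ 'm" and \<zeta> :: complex using \<rho>(2)[OF that(1)] that(2) by simp
  let ?I = "\<lambda>z :: complex ^ 'm. contour_integral (circlepath 0 \<rho>) (\<lambda>\<zeta>. F (z + axis j \<zeta>) / \<zeta>\<^sup>2)"
  have "(?I has_derivative (\<lambda>v. \<Sum>i\<in>UNIV. contour_integral (circlepath 0 \<rho>) (\<lambda>\<zeta>. cpartial i F (z0 + axis j \<zeta>) / \<zeta>\<^sup>2) * v $ i)) (at z0)"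
  proof (rule has_derivative_contour_param[where U = "ball z0 \<rho>" and Kp = "\<lambda>i z \<zeta>. cpartial i F (z + axis j \<zeta>) / \<zeta>\<^sup>2"])
    fix z :: "complex ^ 'm" and \<zeta> :: complex assume z: "z \<in> ball z0 \<rho>" "\<zeta> \<in> sphere 0 \<rho>"
    have "((\<lambda>z. z + axis j \<zeta>) has_derivative (\<lambda>v. v)) (at z)" by (auto intro!: derivative_eq_intros)
    from has_derivative_compose[OF this hol_fun_has_derivative[OF F(1) inU[OF z]]]
    have "((\<lambda>z. F (z + axis j \<zeta>)) has_derivative (\<lambda>v. \<Sum>i\<in>UNIV. cpartial i F (z + axis j \<zeta>) * v $ i)) (at z)" .
    from has_derivative_mult_left[OF this, of "inverse (\<zeta>\<^sup>2)"]
    show "((\<lambda>z. F (z + axis j \<zeta>) / \<zeta>\<^sup>2) has_derivative (\<lambda>v. \<Sum>i\<in>UNIV. cpartial i F (z + axis j \<zeta>) / \<zeta>\<^sup>2 * v $ i)) (at z)"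
      by (simp add: divide_inverse sum_distrib_left sum_distrib_right mult_ac)
  next
    fix z assume z: "z \<in> ball z0 \<rho>"
    show "continuous_on (sphere 0 \<rho>) (\<lambda>\<zeta>. F (z + axis j \<zeta>) / \<zeta>\<^sup>2)"
      by (intro continuous_intros continuous_on_compose2[OF hol_fun_continuous_on[OF F(1)]]) (use \<rho>(1) inU z in auto)
  next
    fix i
    show "continuous_on (ball z0 \<rho> \<times> sphere 0 \<rho>) (\<lambda>(z, \<zeta>). cpartial i F (z + axis j \<zeta>) / \<zeta>\<^sup>2)"
      unfolding case_prod_beta
      by (intro continuous_intros continuous_on_compose2[OF continuous_on_cpartial[OF F]]) (use \<rho>(1) inU in auto)
  qed (use \<rho> in auto)
  from has_derivative_mult_right[OF this, of "1 / (2 * of_real pi * \<i>)"]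
  have d: "((\<lambda>z. 1 / (2 * of_real pi * \<i>) * ?I z) has_derivative (\<lambda>v. \<Sum>i\<in>UNIV.
    (1 / (2 * of_real pi * \<i>) * contour_integral (circlepath 0 \<rho>) (\<lambda>\<zeta>. cpartial i F (z0 + axis j \<zeta>) / \<zeta>\<^sup>2)) * v $ i)) (at z0)"
    by (simp only: sum_distrib_left mult.assoc)
  have "(cpartial j F has_derivative (\<lambda>v. \<Sum>i\<in>UNIV.
    (1 / (2 * of_real pi * \<i>) * contour_integral (circlepath 0 \<rho>) (\<lambda>\<zeta>. cpartial i F (z0 + axis j \<zeta>) / \<zeta>\<^sup>2)) * v $ i)) (at z0)"
  proof (rule has_derivative_transform_within_open[OF d, of "ball z0 \<rho>"])
    fix z assume "z \<in> ball z0 \<rho>"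
    then show "1 / (2 * of_real pi * \<i>) * ?I z = cpartial j F z"
      by (intro cpartial_contour_integral[OF F \<rho>(1), symmetric] \<rho>(2))
  qed (use \<rho> in auto)
  then show ?thesis using \<rho> by (intro exI[of _ \<rho>]) auto
qed

lemma hol_fun_cpartial:
  fixes F :: "complex ^ 'm::finite \<Rightarrow> complex"
  assumes F: "hol_fun F U" "open U"
  shows "hol_fun (cpartial j F) U"
  unfolding hol_fun_def
proof
  fix z assume z: "z \<in> U"
  obtain \<rho> where d: "(cpartial j F has_derivative (\<lambda>v. \<Sum>i\<in>UNIV.
    (1 / (2 * of_real pi * \<i>) * contour_integral (circlepath 0 \<rho>) (\<lambda>\<zeta>. cpartial i F (z + axis j \<zeta>) / \<zeta>\<^sup>2)) * v $ i)) (at z)"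
    using cpartial_has_derivative[OF F z, of j] by blast
  have "hol_fun (cpartial j F) {z}" by (rule hol_funI) (simp only: singleton_iff, rule d)
  then show "\<exists>D. (cpartial j F has_derivative D) (at z) \<and> (\<forall>a v. D (a *s v) = a * D v)" by (simp add: hol_fun_def)
qed

lemma cpartial_commute:
  fixes F :: "complex ^ 'm::finite \<Rightarrow> complex"
  assumes F: "hol_fun F U" "open U" and z: "z \<in> U"
  shows "cpartial i (cpartial j F) z = cpartial j (cpartial i F) z"
proof -
  obtain \<rho> where \<rho>: "\<rho> > 0" "\<And>\<zeta>. \<zeta> \<in> cball 0 \<rho> \<Longrightarrow> z + axis j \<zeta> \<in> U"
    and d: "(cpartial j F has_derivative (\<lambda>v. \<Sum>i\<in>UNIV.
    (1 / (2 * of_real pi * \<i>) * contour_integral (circlepath 0 \<rho>) (\<lambda>\<zeta>. cpartial i F (z + axis j \<zeta>) / \<zeta>\<^sup>2)) * v $ i)) (at z)"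
    using cpartial_has_derivative[OF F z, of j] by blast
  show ?thesis
    unfolding cpartial_unique[OF d, of i]
    by (rule cpartial_contour_integral[OF hol_fun_cpartial[OF F] F(2) \<rho>, symmetric])
qed

text \<open>For \<open>c = z $ j\<close> the argument is \<open>z\<close> with its coordinate
  \<open>j\<close> replaced by \<open>t\<close>, the form in which slices enter the Cauchy integrals
  below.\<close>

lemma hol_fun_slice_holomorphic:
  assumes F: "hol_fun F U" "\<And>t. t \<in> S \<Longrightarrow> z + axis j (t - c) \<in> U"
  shows "(\<lambda>t. F (z + axis j (t - c))) holomorphic_on S"
    "t \<in> S \<Longrightarrow> ((\<lambda>t. F (z + axis j (t - c))) has_field_derivative cpartial j F (z + axis j (t - c))) (at t)"
proof -
  have eq: "z + axis j (t - c) = (z - axis j c) + t *s axis j 1" for t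
    by (simp add: vec_eq_iff axis_def)
  have d: "((\<lambda>t. F (z + axis j (t - c))) has_field_derivative cpartial j F (z + axis j (t - c))) (at t)" if "t \<in> S" for t
  proof -
    have "((\<lambda>t. F (z - axis j c + t *s axis j 1)) has_field_derivative
       (\<Sum>i\<in>UNIV. cpartial i F (z - axis j c + t *s axis j 1) * axis j 1 $ i)) (at t)"
      by (rule hol_fun_line[OF F(1)]) (use F(2)[OF that] eq in simp)
    moreover have "(\<Sum>i\<in>UNIV. cpartial i F w * axis j 1 $ i) = cpartial j F w" for w
      by (simp add: axis_def if_distrib[of "\<lambda>t. _ * t"] cong: if_cong)
    ultimately show ?thesis by (simp only: eq)
  qed
  then show "(\<lambda>t. F (z + axis j (t - c))) holomorphic_on S"
    by (intro holomorphic_onI) (meson field_differentiable_at_within field_differentiable_def)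
  show "t \<in> S \<Longrightarrow> ((\<lambda>t. F (z + axis j (t - c))) has_field_derivative cpartial j F (z + axis j (t - c))) (at t)"
    by (rule d)
qed

text \<open>\<open>K\<close> has to be holomorphic only near the circles, not inside them. So the
  Cauchy integral can extend \<open>K\<close> across a set that the circles avoid.\<close>

lemma hol_fun_cauchy_slice:
  fixes K :: "complex ^ 'm::finite \<Rightarrow> complex"
  assumes K: "hol_fun K W" "open W" and U: "open U" and \<rho>: "\<rho> > 0"
    and inW: "\<And>(z :: complex ^ 'm) \<zeta>. z \<in> U \<Longrightarrow> \<zeta> \<in> sphere a \<rho> \<Longrightarrow> z + axis j (\<zeta> - z $ j) \<in> W"
    and disc: "\<And>z :: complex ^ 'm. z \<in> U \<Longrightarrow> z $ j \<in> ball a \<rho>"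
  shows "hol_fun (\<lambda>z. contour_integral (circlepath a \<rho>) (\<lambda>\<zeta>. K (z + axis j (\<zeta> - z $ j)) / (\<zeta> - z $ j))) U"
proof (rule hol_funI)
  \<comment> \<open>The point \<open>z + axis j (\<zeta> - z $ j)\<close> does not depend on
    \<open>z $ j\<close>, so in direction \<open>j\<close> only the Cauchy kernel is differentiated,
    in the other directions only \<open>K\<close>.\<close>
  define Kp where "Kp i z \<zeta> = (if i = j then K (z + axis j (\<zeta> - z $ j)) / (\<zeta> - z $ j)\<^sup>2
      else cpartial i K (z + axis j (\<zeta> - z $ j)) / (\<zeta> - z $ j))" for i z \<zeta>
  have ne: "\<zeta> - z $ j \<noteq> 0" if "z \<in> U" "\<zeta> \<in> sphere a \<rho>" for z \<zeta>
    using disc[OF that(1)] that(2) by (auto simp: dist_norm)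
  fix z0 assume z0: "z0 \<in> U"
  show "((\<lambda>z. contour_integral (circlepath a \<rho>) (\<lambda>\<zeta>. K (z + axis j (\<zeta> - z $ j)) / (\<zeta> - z $ j))) has_derivative
     (\<lambda>v. \<Sum>i\<in>UNIV. contour_integral (circlepath a \<rho>) (Kp i z0) * v $ i)) (at z0)"
  proof (rule has_derivative_contour_param[OF U z0])
    fix z \<zeta> assume z: "z \<in> U" "\<zeta> \<in> sphere a \<rho>"
    let ?w = "z + axis j (\<zeta> - z $ j)" and ?k = "\<zeta> - z $ j"
    have g: "((\<lambda>z. z + axis j (\<zeta> - z $ j)) has_derivative (\<lambda>v. v - axis j (v $ j))) (at z)"
    proof -
      have "((\<lambda>z. \<zeta> - z $ j) has_derivative (\<lambda>v. - (v $ j))) (at z)"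
        by (auto intro!: derivative_eq_intros bounded_linear.has_derivative[OF bounded_linear_vec_nth])
      from bounded_linear.has_derivative[OF bounded_linear_axis this]
      have "((\<lambda>z. axis j (\<zeta> - z $ j) :: complex ^ 'm) has_derivative (\<lambda>v. axis j (- (v $ j)))) (at z)" .
      from has_derivative_add[OF has_derivative_ident this]
      moreover have "v + axis j (- (v $ j)) = v - axis j (v $ j)" for v :: "complex ^ 'm"
        by (simp add: vec_eq_iff axis_def)
      ultimately show ?thesis by simp
    qed
    have d1: "((\<lambda>z. K (z + axis j (\<zeta> - z $ j))) has_derivative
        (\<lambda>v. \<Sum>i\<in>UNIV. cpartial i K ?w * (v - axis j (v $ j)) $ i)) (at z)"
      by (rule has_derivative_compose[OF g hol_fun_has_derivative[OF K(1) inW[OF z]]])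
    have d2: "((\<lambda>z. \<zeta> - z $ j) has_derivative (\<lambda>v. - (v $ j))) (at z)"
      by (auto intro!: derivative_eq_intros bounded_linear.has_derivative[OF bounded_linear_vec_nth])
    have "((\<lambda>z. K (z + axis j (\<zeta> - z $ j)) / (\<zeta> - z $ j)) has_derivative
      (\<lambda>v. ((\<Sum>i\<in>UNIV. cpartial i K ?w * (v - axis j (v $ j)) $ i) * ?k - K ?w * (- (v $ j))) / (?k * ?k))) (at z)"
      by (rule has_derivative_divide'[OF d1 d2 ne[OF z]])
    moreover have "((\<Sum>i\<in>UNIV. cpartial i K ?w * (v - axis j (v $ j)) $ i) * ?k - K ?w * (- (v $ j))) / (?k * ?k)
        = (\<Sum>i\<in>UNIV. Kp i z \<zeta> * v $ i)" for v
    proof -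
      have "(\<Sum>i\<in>UNIV. Kp i z \<zeta> * v $ i) = Kp j z \<zeta> * v $ j + (\<Sum>i\<in>UNIV-{j}. Kp i z \<zeta> * v $ i)"
        by (subst sum.remove[of UNIV j]) auto
      also have "(\<Sum>i\<in>UNIV-{j}. Kp i z \<zeta> * v $ i) = (\<Sum>i\<in>UNIV-{j}. cpartial i K ?w * (v - axis j (v $ j)) $ i) / ?k"
        unfolding sum_divide_distrib by (rule sum.cong) (auto simp: Kp_def axis_def)
      also have "(\<Sum>i\<in>UNIV-{j}. cpartial i K ?w * (v - axis j (v $ j)) $ i) = (\<Sum>i\<in>UNIV. cpartial i K ?w * (v - axis j (v $ j)) $ i)"
        by (subst sum.remove[of UNIV j]) (auto simp: axis_def)
      finally show ?thesis using ne[OF z] by (simp add: Kp_def power2_eq_square divide_simps)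
    qed
    ultimately show "((\<lambda>z. K (z + axis j (\<zeta> - z $ j)) / (\<zeta> - z $ j)) has_derivative (\<lambda>v. \<Sum>i\<in>UNIV. Kp i z \<zeta> * v $ i)) (at z)"
      by simp
  next
    fix z assume z: "z \<in> U"
    show "continuous_on (sphere a \<rho>) (\<lambda>\<zeta>. K (z + axis j (\<zeta> - z $ j)) / (\<zeta> - z $ j))"
      by (intro continuous_intros continuous_on_compose2[OF hol_fun_continuous_on[OF K(1)]]) (use ne inW z in auto)
  next
    fix i
    have c: "continuous_on (U \<times> sphere a \<rho>) (\<lambda>x. G (fst x + axis j (snd x - fst x $ j)))"
      if "continuous_on W G" for G :: "complex ^ 'm \<Rightarrow> complex"
      by (intro continuous_intros continuous_on_compose2[OF that]) (use inW in auto)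
    have "continuous_on (U \<times> sphere a \<rho>) (\<lambda>x. Kp i (fst x) (snd x))"
    proof (cases "i = j")
      case True
      then show ?thesis unfolding Kp_def
        using c[OF hol_fun_continuous_on[OF K(1)]] ne by (auto intro!: continuous_intros)
    next
      case False
      then show ?thesis unfolding Kp_def
        using c[OF continuous_on_cpartial[OF K]] ne by (auto intro!: continuous_intros)
    qed
    then show "continuous_on (U \<times> sphere a \<rho>) (\<lambda>(z, \<zeta>). Kp i z \<zeta>)" by (simp add: case_prod_beta)
  qed (use \<rho> in auto)
qed

subsection \<open>Removable singularities and division\<close>

lemma axis_zero_complex [simp]: "axis i (0::complex) = 0"
  by (simp add: axis_def zero_vec_def)

lemma tendsto_axis_perturb:
  fixes z :: "complex ^ 'm::finite"
  shows "(\<lambda>n. z + axis i (complex_of_real (inverse (real (Suc n))))) \<longlonglongrightarrow> z"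
proof -
  have "(\<lambda>n. axis i (complex_of_real (inverse (real (Suc n)))) :: complex ^ 'm) \<longlonglongrightarrow> axis i (complex_of_real 0)"
    by (intro bounded_linear.tendsto[OF bounded_linear_axis] tendsto_of_real LIMSEQ_inverse_real_of_nat)
  from tendsto_add[OF tendsto_const this, of z] show ?thesis
    by (simp add: axis_def zero_vec_def[symmetric] del: of_real_inverse of_real_of_nat_eq)
qed

text \<open>The complement of a hyperplane is dense: points on it are approached by small shifts in
  direction \<open>i\<close>.\<close>

lemma continuous_eq_off_hyperplane:
  fixes f g :: "complex ^ 'm::finite \<Rightarrow> complex"
  assumes f: "continuous_on S f" and g: "continuous_on S g" and S: "open S"
    and eq: "\<And>z. z \<in> S \<Longrightarrow> z $ i \<noteq> c \<Longrightarrow> f z = g z" and z: "z \<in> S"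
  shows "f z = g z"
proof (cases "z $ i = c")
  case True
  let ?s = "\<lambda>n. z + axis i (complex_of_real (inverse (real (Suc n))))"
  have lim: "?s \<longlonglongrightarrow> z" by (rule tendsto_axis_perturb)
  have ev: "\<forall>\<^sub>F n in sequentially. ?s n \<in> S" using lim S z by (rule topological_tendstoD)
  have "isCont f z" "isCont g z" using f g S z by (simp_all add: continuous_on_eq_continuous_at)
  then have fl: "(\<lambda>n. f (?s n)) \<longlonglongrightarrow> f z" and gl: "(\<lambda>n. g (?s n)) \<longlonglongrightarrow> g z"
    using lim isCont_tendsto_compose by blast+
  have "\<forall>\<^sub>F n in sequentially. f (?s n) = g (?s n)"
    using ev
  proof eventually_elim
    case (elim n)
    have "?s n $ i = c + complex_of_real (inverse (real (Suc n)))" using True by (simp add: axis_def)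
    moreover have "complex_of_real (inverse (real (Suc n))) \<noteq> 0"
      using of_nat_neq_0[of n, where ?'a = real] by (simp only: of_real_eq_0_iff inverse_nonzero_iff_nonzero not_False_eq_True)
    ultimately have "?s n $ i \<noteq> c" by (simp only: add_cancel_left_right not_False_eq_True)
    then show ?case by (rule eq[OF elim])
  qed
  then have "(\<lambda>n. g (?s n)) \<longlonglongrightarrow> f z" by (rule Lim_transform_eventually[OF fl])
  then show ?thesis using gl by (rule LIMSEQ_unique)
qed (use eq z in auto)

text \<open>The extension is the Cauchy integral of \<open>K\<close> over a fixed circle in
  coordinate \<open>j\<close>, which avoids \<open>p\<close>. If \<open>z\<close> differs from
  \<open>p\<close> in another coordinate, the whole disc avoids \<open>p\<close> and Cauchy's
  formula returns \<open>K z\<close>. The remaining points follow by continuity; a second coordinate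
  exists because the dimension is at least 2.\<close>

lemma hartogs_isolated_point:
  fixes K :: "complex ^ 'm::finite \<Rightarrow> complex"
  assumes K: "hol_fun K (U - {p})" and U: "open U" "p \<in> U" and dim: "CARD('m) \<ge> 2"
  obtains N \<tau> where "open N" "p \<in> N" "N \<subseteq> U" "hol_fun \<tau> N" "\<And>z. z \<in> N - {p} \<Longrightarrow> \<tau> z = K z"
proof -
  obtain i j :: 'm where ij: "i \<noteq> j"
    using dim by (metis card_2_iff' ex_card subset_UNIV)
  obtain R where R: "R > 0" "ball p R \<subseteq> U" using U open_contains_ball by blast
  \<comment> \<open>Replacing coordinate \<open>j\<close> moves a point of the
    \<open>\<rho>\<close>-ball by at most \<open>2 * \<rho>\<close>, so everything stays within
    \<open>4 * \<rho>\<close> of \<open>p\<close>.\<close>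
  define \<rho> where "\<rho> = R / 4"
  have \<rho>: "\<rho> > 0" "ball p (4 * \<rho>) \<subseteq> U" using R by (auto simp: \<rho>_def)
  let ?g = "\<lambda>z \<zeta>. z + axis j (\<zeta> - z $ j) :: complex ^ 'm"
  have gU: "?g z \<zeta> \<in> U" if "z \<in> ball p \<rho>" "\<zeta> \<in> cball (p $ j) \<rho>" for z \<zeta>
  proof -
    have "cmod (\<zeta> - z $ j) \<le> cmod (\<zeta> - p $ j) + cmod (p $ j - z $ j)"
      using norm_triangle_ineq[of "\<zeta> - p $ j" "p $ j - z $ j"] by simp
    moreover have "cmod (p $ j - z $ j) \<le> dist p z"
      using Finite_Cartesian_Product.norm_nth_le[of "p - z" j] by (simp add: dist_norm)
    moreover have "dist p (?g z \<zeta>) \<le> dist p z + cmod (\<zeta> - z $ j)"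
      using dist_triangle[of p "?g z \<zeta>" z] by (simp add: dist_norm norm_axis_complex)
    ultimately have "dist p (?g z \<zeta>) < 4 * \<rho>" using that \<rho> by (simp add: dist_norm norm_minus_commute)
    then show ?thesis using \<rho>(2) by (simp add: subset_iff)
  qed
  have pj: "z $ j \<in> ball (p $ j) \<rho>" if "z \<in> ball p \<rho>" for z
    using Finite_Cartesian_Product.norm_nth_le[of "p - z" j] that by (simp add: dist_norm)
  define \<tau> where "\<tau> z = 1 / (2 * of_real pi * \<i>) * contour_integral (circlepath (p $ j) \<rho>) (\<lambda>\<zeta>. K (?g z \<zeta>) / (\<zeta> - z $ j))" for z
  have "hol_fun \<tau> (ball p \<rho>)" unfolding \<tau>_def
  proof (intro hol_fun_mult hol_fun_const hol_fun_cauchy_slice[OF K])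
    show "?g z \<zeta> \<in> U - {p}" if "z \<in> ball p \<rho>" "\<zeta> \<in> sphere (p $ j) \<rho>" for z \<zeta>
    proof -
      have "?g z \<zeta> $ j \<noteq> p $ j" using that \<rho>(1) by (auto simp: axis_def)
      then show ?thesis using gU[OF that(1)] that(2) by auto
    qed
  qed (use U \<rho> pj in auto)
  moreover have "\<tau> z = K z" if z: "z \<in> ball p \<rho> - {p}" for z
  proof -
    have off: "\<tau> z = K z" if z: "z \<in> ball p \<rho>" "z $ k \<noteq> p $ k" and k: "k \<noteq> j" for z k
    proof -
      have ne: "?g z \<zeta> \<in> U - {p}" if "\<zeta> \<in> cball (p $ j) \<rho>" for \<zeta>
      proof -
        have "?g z \<zeta> $ k = z $ k" using k by (simp add: axis_def)
        then show ?thesis using gU[OF z(1) that] z(2) by auto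
      qed
      have hol: "(\<lambda>\<zeta>. K (?g z \<zeta>)) holomorphic_on cball (p $ j) \<rho>"
        by (rule hol_fun_slice_holomorphic(1)[OF K ne])
      have "((\<lambda>\<zeta>. K (?g z \<zeta>) / (\<zeta> - z $ j)) has_contour_integral 2 * of_real pi * \<i> * K (?g z (z $ j))) (circlepath (p $ j) \<rho>)"
      proof (rule Cauchy_integral_circlepath)
        show "continuous_on (cball (p $ j) \<rho>) (\<lambda>\<zeta>. K (?g z \<zeta>))" using hol by (rule holomorphic_on_imp_continuous_on)
        show "(\<lambda>\<zeta>. K (?g z \<zeta>)) holomorphic_on ball (p $ j) \<rho>" using hol by (rule holomorphic_on_subset) auto
        show "cmod (z $ j - p $ j) < \<rho>" using pj[OF z(1)] by (simp add: dist_norm norm_minus_commute)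
      qed
      moreover have "?g z (z $ j) = z" by (simp add: vec_eq_iff axis_def)
      ultimately show ?thesis unfolding \<tau>_def by (simp add: contour_integral_unique)
    qed
    show ?thesis
    proof (rule continuous_eq_off_hyperplane[where S = "ball p \<rho> - {p}" and i = i and c = "p $ i"])
      show "continuous_on (ball p \<rho> - {p}) \<tau>"
        using hol_fun_continuous_on[OF \<open>hol_fun \<tau> (ball p \<rho>)\<close>] by (rule continuous_on_subset) auto
      show "continuous_on (ball p \<rho> - {p}) K"
        using hol_fun_continuous_on[OF K] by (rule continuous_on_subset) (use \<rho> in auto)
    qed (use off ij z in auto)
  qed
  moreover have "ball p \<rho> \<subseteq> U" using \<rho> by (auto simp: subset_iff)
  ultimately show ?thesis using that[of "ball p \<rho>" \<tau>] \<rho>(1) by auto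
qed

text \<open>On each slice in direction \<open>j\<close> near \<open>p\<close> the function
  \<open>F\<close> has at most one zero, a simple one, and \<open>E\<close> vanishes there; so the
  quotient is holomorphic on the slice. To make it holomorphic in all variables, it is defined as
  the Cauchy integral of \<open>E / F\<close> over a circle on which \<open>F\<close> has no
  zero.\<close>

lemma hol_fun_divide_at_regular:
  fixes F E :: "complex ^ 'm::finite \<Rightarrow> complex"
  assumes F: "hol_fun F U" and E: "hol_fun E U" and U: "open U" "p \<in> U"
    and reg: "F p = 0" "cpartial j F p \<noteq> 0" and zero: "\<And>z. z \<in> U \<Longrightarrow> F z = 0 \<Longrightarrow> E z = 0"
  obtains N \<tau> where "open N" "p \<in> N" "N \<subseteq> U" "hol_fun \<tau> N" "\<And>z. z \<in> N \<Longrightarrow> E z = F z * \<tau> z"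
proof -
  define a where "a = cpartial j F p"
  have a0: "a \<noteq> 0" using reg by (simp add: a_def)
  obtain R where R: "R > 0" "\<And>z. dist z p < R \<Longrightarrow> dist (cpartial j F z) a < cmod a / 2 \<and> z \<in> U"
    using exists_ball_close[OF continuous_on_cpartial[OF F U(1)] continuous_on_cpartial[OF F U(1)] U,
      of "cmod a / 2" "cmod a / 2" j j] a0 unfolding a_def by auto
  \<comment> \<open>Slices are taken over discs of radius \<open>2 * \<rho>\<close>, which contain
    the closed discs bounded by the circles of radius \<open>\<rho>\<close>; the points reached stay
    within \<open>4 * \<rho>\<close> of \<open>p\<close>.\<close>
  define \<rho> where "\<rho> = R / 8"
  have \<rho>: "\<rho> > 0" "8 * \<rho> = R" using R by (auto simp: \<rho>_def)
  let ?g = "\<lambda>z \<zeta>. z + axis j (\<zeta> - z $ j) :: complex ^ 'm"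
  have gg: "dist (?g z \<zeta>) p < R" if "z \<in> ball p \<rho>" "\<zeta> \<in> ball (p $ j) (2 * \<rho>)" for z \<zeta>
  proof -
    have "cmod (\<zeta> - z $ j) \<le> cmod (\<zeta> - p $ j) + cmod (p $ j - z $ j)"
      using norm_triangle_ineq[of "\<zeta> - p $ j" "p $ j - z $ j"] by simp
    moreover have "cmod (p $ j - z $ j) \<le> dist p z"
      using Finite_Cartesian_Product.norm_nth_le[of "p - z" j] by (simp add: dist_norm)
    moreover have "dist p (?g z \<zeta>) \<le> dist p z + cmod (\<zeta> - z $ j)"
      using dist_triangle[of p "?g z \<zeta>" z] by (simp add: dist_norm norm_axis_complex)
    ultimately have "dist p (?g z \<zeta>) < 8 * \<rho>" using that \<rho>(1) by (simp add: dist_norm norm_minus_commute)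
    then show ?thesis using \<rho>(2) by (simp add: dist_commute)
  qed
  have pj: "z $ j \<in> ball (p $ j) \<rho>" if "z \<in> ball p \<rho>" for z
    using Finite_Cartesian_Product.norm_nth_le[of "p - z" j] that by (simp add: dist_norm)
  \<comment> \<open>After subtracting \<open>a * t\<close> the slice has derivative at most half of
    the modulus of \<open>a\<close>. The resulting lower bound gives injectivity on the slice, and
    later a lower bound for the difference quotient at a zero.\<close>
  have slice_inj: "cmod a / 2 * cmod (t - t') \<le> cmod (F (?g z t) - F (?g z t'))"
    if z: "z \<in> ball p \<rho>" and t: "t \<in> ball (p $ j) (2 * \<rho>)" "t' \<in> ball (p $ j) (2 * \<rho>)" for z t t'
  proof -
    let ?h = "\<lambda>t. F (?g z t) - a * t"
    have "cmod (?h t - ?h t') \<le> cmod a / 2 * cmod (t - t')"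
    proof (rule field_differentiable_bound[OF convex_ball _ _ t])
      fix x assume x: "x \<in> ball (p $ j) (2 * \<rho>)"
      have "((\<lambda>t. F (?g z t)) has_field_derivative cpartial j F (?g z x)) (at x)"
        by (rule hol_fun_slice_holomorphic(2)[OF F _ x]) (use gg[OF z] R(2) in blast)
      from DERIV_diff[OF this DERIV_cmult[OF DERIV_ident, of a]]
      show "(?h has_field_derivative cpartial j F (?g z x) - a) (at x within ball (p $ j) (2 * \<rho>))"
        by (simp add: has_field_derivative_at_within)
      show "cmod (cpartial j F (?g z x) - a) \<le> cmod a / 2"
        using R(2)[OF gg[OF z x]] by (simp add: dist_norm)
    qed
    moreover have "?h t - ?h t' = (F (?g z t) - F (?g z t')) - a * (t - t')" by (simp add: algebra_simps)
    moreover have "cmod (a * (t - t')) \<le> cmod (F (?g z t) - F (?g z t')) + cmod ((F (?g z t) - F (?g z t')) - a * (t - t'))"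
      by (metis norm_triangle_sub add.commute norm_minus_commute)
    ultimately show ?thesis by (simp add: norm_mult)
  qed
  define W where "W = {z \<in> U. F z \<noteq> 0}"
  have oW: "open W"
    unfolding W_def by (rule open_nonzero[OF hol_fun_continuous_on[OF F] U(1)])
  have circ: "?g p \<zeta> \<in> W" if "\<zeta> \<in> sphere (p $ j) \<rho>" for \<zeta>
  proof -
    have gp: "?g p (p $ j) = p" by (simp add: vec_eq_iff axis_def)
    have "cmod a / 2 * cmod (\<zeta> - p $ j) \<le> cmod (F (?g p \<zeta>) - F (?g p (p $ j)))"
      by (rule slice_inj) (use that \<rho> in auto)
    moreover have "0 < cmod a / 2 * cmod (\<zeta> - p $ j)" using a0 \<rho>(1) that by (auto simp: dist_norm)
    ultimately have "F (?g p \<zeta>) \<noteq> 0" using reg(1) gp by auto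
    moreover have "?g p \<zeta> \<in> U" using gg[of p \<zeta>] R(2) that \<rho>(1) by auto
    ultimately show ?thesis by (simp add: W_def)
  qed
  \<comment> \<open>The circle through the slice of \<open>p\<close> is compact in the open set
    \<open>W\<close>. For nearby \<open>z\<close> its points move only in the coordinates other than
    \<open>j\<close>, hence little, and remain in \<open>W\<close>.\<close>
  have "\<exists>e>0. e \<le> \<rho> \<and> (\<forall>z\<in>ball p e. \<forall>\<zeta>\<in>sphere (p $ j) \<rho>. ?g z \<zeta> \<in> W)"
  proof -
    have "continuous_on (sphere (p $ j) \<rho>) (\<lambda>\<zeta>. ?g p \<zeta>)" by (intro continuous_intros)
    then have cK: "compact ((\<lambda>\<zeta>. ?g p \<zeta>) ` sphere (p $ j) \<rho>)" by (intro compact_continuous_image) auto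
    have sub: "(\<lambda>\<zeta>. ?g p \<zeta>) ` sphere (p $ j) \<rho> \<subseteq> W" using circ by auto
    obtain e where e: "e > 0" "(\<Union>x\<in>(\<lambda>\<zeta>. ?g p \<zeta>) ` sphere (p $ j) \<rho>. ball x e) \<subseteq> W"
      using compact_subset_open_imp_ball_epsilon_subset[OF cK oW sub] by blast
    show ?thesis
    proof (intro exI[of _ "min (e/2) \<rho>"] conjI ballI)
      fix z \<zeta> assume z: "z \<in> ball p (min (e/2) \<rho>)" and \<zeta>: "\<zeta> \<in> sphere (p $ j) \<rho>"
      have "?g p \<zeta> - ?g z \<zeta> = (p - z) - axis j ((p - z) $ j)" by (simp add: vec_eq_iff axis_def)
      then have "norm (?g p \<zeta> - ?g z \<zeta>) \<le> norm (p - z) + cmod ((p - z) $ j)"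
        using norm_triangle_ineq4[of "p - z" "axis j ((p - z) $ j)"] by (simp only: norm_axis_complex)
      also have "\<dots> \<le> 2 * norm (p - z)" using Finite_Cartesian_Product.norm_nth_le[of "p - z" j] by simp
      also have "\<dots> < e" using z by (simp add: dist_norm)
      finally show "?g z \<zeta> \<in> W" using e(2) \<zeta> by (force simp: dist_norm)
    qed (use e \<rho> in auto)
  qed
  then obtain e where e: "e > 0" "e \<le> \<rho>" "\<And>z \<zeta>. z \<in> ball p e \<Longrightarrow> \<zeta> \<in> sphere (p $ j) \<rho> \<Longrightarrow> ?g z \<zeta> \<in> W" by blast
  have zp: "z \<in> ball p \<rho>" if "z \<in> ball p e" for z using that e(2) by auto
  define K where "K z = E z / F z" for z
  have K: "hol_fun K W" unfolding K_def
    by (intro hol_fun_divide hol_fun_subset[OF E] hol_fun_subset[OF F]) (auto simp: W_def)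
  define \<tau> where "\<tau> z = 1 / (2 * of_real pi * \<i>) * contour_integral (circlepath (p $ j) \<rho>) (\<lambda>\<zeta>. K (?g z \<zeta>) / (\<zeta> - z $ j))" for z
  have hol\<tau>: "hol_fun \<tau> (ball p e)" unfolding \<tau>_def
    by (intro hol_fun_mult hol_fun_const hol_fun_cauchy_slice[OF K oW]) (use \<rho> pj zp e in auto)
  have div: "E z = F z * \<tau> z" if z: "z \<in> ball p e" for z
  proof -
    let ?B = "ball (p $ j) (2 * \<rho>)"
    define f where "f = (\<lambda>t. F (?g z t))"
    define h where "h = (\<lambda>t. E (?g z t))"
    have inU: "?g z t \<in> U" if "t \<in> ?B" for t using gg[OF zp[OF z] that] R(2) by blast
    have f: "f holomorphic_on ?B" unfolding f_def by (rule hol_fun_slice_holomorphic(1)[OF F inU])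
    have h: "h holomorphic_on ?B" unfolding h_def by (rule hol_fun_slice_holomorphic(1)[OF E inU])
    have fh: "h t = 0" if "t \<in> ?B" "f t = 0" for t using zero inU[OF that(1)] that(2) by (simp add: f_def h_def)
    have f_inj: "cmod a / 2 * cmod (t - t') \<le> cmod (f t - f t')" if "t \<in> ?B" "t' \<in> ?B" for t t'
      unfolding f_def by (rule slice_inj[OF zp[OF z] that])
    have "\<exists>q. q holomorphic_on ?B \<and> (\<forall>t\<in>?B. h t = f t * q t)"
    proof (cases "\<exists>t0\<in>?B. f t0 = 0")
      case False
      then show ?thesis using f h by (intro exI[of _ "\<lambda>t. h t / f t"]) (auto intro!: holomorphic_intros)
    next
      case True
      then obtain t0 where t0: "t0 \<in> ?B" "f t0 = 0" by blast
      have h0: "h t0 = 0" using fh t0 by blast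
      \<comment> \<open>Difference quotients with the removable singularity filled in; both
        numerators vanish at \<open>t0\<close>, so \<open>qh / qf\<close> is the quotient of
        \<open>h\<close> by \<open>f\<close>.\<close>
      define qf where "qf = (\<lambda>t. if t = t0 then deriv f t0 else (f t - f t0) / (t - t0))"
      define qh where "qh = (\<lambda>t. if t = t0 then deriv h t0 else (h t - h t0) / (t - t0))"
      have hq: "qf holomorphic_on ?B" "qh holomorphic_on ?B"
        unfolding qf_def qh_def using f h by (auto intro!: pole_lemma_open)
      have nz: "qf t \<noteq> 0" if t: "t \<in> ?B" for t
      proof -
        have "cmod a / 2 \<le> cmod (qf t)" if t: "t \<in> ?B" "t \<noteq> t0" for t
          using f_inj[OF t(1) t0(1)] t(2) by (simp add: qf_def norm_divide field_simps)
        moreover have "cmod a / 2 \<le> cmod (qf t0)"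
        proof (rule tendsto_lowerbound[of "\<lambda>t. cmod (qf t)" _ "at t0"])
          have "isCont qf t0" using hq(1) t0(1) holomorphic_on_imp_continuous_on continuous_on_eq_continuous_at[OF open_ball] by blast
          then show "((\<lambda>t. cmod (qf t)) \<longlongrightarrow> cmod (qf t0)) (at t0)" unfolding isCont_def by (rule tendsto_norm)
          have "\<forall>\<^sub>F t in at t0. t \<in> ?B" using t0(1) by (intro eventually_at_in_open') auto
          then show "\<forall>\<^sub>F t in at t0. cmod a / 2 \<le> cmod (qf t)"
            using eventually_neq_at_within[of t0] by eventually_elim (use calculation in blast)
        qed simp
        ultimately show ?thesis using t a0 by (cases "t = t0") force+
      qed
      show ?thesis
      proof (intro exI[of _ "\<lambda>t. qh t / qf t"] conjI ballI)
        show "(\<lambda>t. qh t / qf t) holomorphic_on ?B" using hq nz by (intro holomorphic_intros) auto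
        fix t assume t: "t \<in> ?B"
        show "h t = f t * (qh t / qf t)"
        proof (cases "t = t0")
          case False
          then have "f t = qf t * (t - t0)" "h t = qh t * (t - t0)" using t0 h0 by (auto simp: qf_def qh_def)
          then show ?thesis using nz[OF t] by simp
        qed (use t0 h0 in auto)
      qed
    qed
    then obtain q where q: "q holomorphic_on ?B" "\<And>t. t \<in> ?B \<Longrightarrow> h t = f t * q t" by blast
    \<comment> \<open>\<open>q\<close> is holomorphic on the whole disc and equals
      \<open>E / F\<close> on the circle, so the integral defining \<open>\<tau> z\<close> evaluates
      to \<open>q (z $ j)\<close>.\<close>
    have "((\<lambda>\<zeta>. q \<zeta> / (\<zeta> - z $ j)) has_contour_integral 2 * of_real pi * \<i> * q (z $ j)) (circlepath (p $ j) \<rho>)"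
    proof (rule Cauchy_integral_circlepath)
      show "continuous_on (cball (p $ j) \<rho>) q"
        by (rule holomorphic_on_imp_continuous_on, rule holomorphic_on_subset[OF q(1)]) (use \<rho> in auto)
      show "q holomorphic_on ball (p $ j) \<rho>" by (rule holomorphic_on_subset[OF q(1)]) (use \<rho> in auto)
      show "cmod (z $ j - p $ j) < \<rho>" using pj[OF zp[OF z]] by (simp add: dist_norm norm_minus_commute)
    qed
    moreover have "q \<zeta> / (\<zeta> - z $ j) = K (?g z \<zeta>) / (\<zeta> - z $ j)" if \<zeta>: "\<zeta> \<in> path_image (circlepath (p $ j) \<rho>)" for \<zeta>
    proof -
      have s: "\<zeta> \<in> sphere (p $ j) \<rho>" using \<zeta> \<rho> by simp
      then have "f \<zeta> \<noteq> 0" using e(3)[OF z s] by (simp add: W_def f_def)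
      moreover have "\<zeta> \<in> ?B" using s \<rho>(1) by auto
      ultimately have "q \<zeta> = K (?g z \<zeta>)" using q(2)[of \<zeta>] by (simp add: K_def f_def h_def)
      then show ?thesis by simp
    qed
    ultimately have "((\<lambda>\<zeta>. K (?g z \<zeta>) / (\<zeta> - z $ j)) has_contour_integral 2 * of_real pi * \<i> * q (z $ j)) (circlepath (p $ j) \<rho>)"
      by (rule has_contour_integral_eq)
    then have "\<tau> z = q (z $ j)" unfolding \<tau>_def by (simp add: contour_integral_unique)
    moreover have "z $ j \<in> ?B" using pj[OF zp[OF z]] \<rho>(1) by auto
    moreover have "?g z (z $ j) = z" by (simp add: vec_eq_iff axis_def)
    ultimately show ?thesis using q(2)[of "z $ j"] by (simp add: f_def h_def)
  qed
  show ?thesis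
  proof (rule that[OF _ _ _ hol\<tau> div])
    show "ball p e \<subseteq> U" using R(2) \<rho> e(2) by (auto simp: dist_commute)
  qed (use e in auto)
qed

section \<open>Uniqueness and gluing of local quotients\<close>

lemma continuous_quotient_unique:
  fixes F \<sigma> \<tau> :: "'a::topological_space \<Rightarrow> complex"
  assumes N: "open N" "continuous_on N \<sigma>" "continuous_on N \<tau>"
    and dense: "\<And>O'. open O' \<Longrightarrow> O' \<noteq> {} \<Longrightarrow> O' \<subseteq> N \<Longrightarrow> \<exists>z\<in>O'. F z \<noteq> 0"
    and eq: "\<And>z. z \<in> N \<Longrightarrow> F z * \<sigma> z = F z * \<tau> z" and z: "z \<in> N"
  shows "\<sigma> z = \<tau> z"
proof (rule ccontr)
  assume ne: "\<sigma> z \<noteq> \<tau> z"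
  \<comment> \<open>If nonempty, this open set would contain a point with
    \<open>F z \<noteq> 0\<close>, where the factor can be cancelled.\<close>
  define O' where "O' = {z \<in> N. \<sigma> z - \<tau> z \<noteq> 0}"
  have "open O'" unfolding O'_def by (intro open_nonzero continuous_intros N)
  moreover have "O' \<noteq> {}" using z ne by (auto simp: O'_def)
  ultimately obtain w where "w \<in> O'" "F w \<noteq> 0" using dense[of O'] by (auto simp: O'_def)
  then show False using eq[of w] by (auto simp: O'_def)
qed

text \<open>Local quotients agree on overlaps because \<open>F\<close> is nonzero on a dense set; so
  evaluating at each point the quotient chosen there gives a function that is locally one of
  them.\<close>

lemma hol_fun_glue_quotient:
  fixes F E :: "complex ^ 'm::finite \<Rightarrow> complex"
  assumes dense: "\<And>O'. open O' \<Longrightarrow> O' \<noteq> {} \<Longrightarrow> O' \<subseteq> U \<Longrightarrow> \<exists>z\<in>O'. F z \<noteq> 0"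
    and loc: "\<And>p. p \<in> U \<Longrightarrow> \<exists>N \<tau>. open N \<and> p \<in> N \<and> N \<subseteq> U \<and> hol_fun \<tau> N \<and> (\<forall>z\<in>N. E z = F z * \<tau> z)"
  shows "\<exists>\<sigma>. hol_fun \<sigma> U \<and> (\<forall>z\<in>U. E z = F z * \<sigma> z)"
proof -
  define P where "P p x \<longleftrightarrow> open (fst x) \<and> p \<in> fst x \<and> fst x \<subseteq> U \<and> hol_fun (snd x) (fst x) \<and> (\<forall>z\<in>fst x. E z = F z * snd x z)" for p and x :: "(complex ^ 'm) set \<times> (complex ^ 'm \<Rightarrow> complex)"
  define c where "c p = (SOME x. P p x)" for p
  have c: "P p (c p)" if "p \<in> U" for p
  proof -
    have "\<exists>x. P p x" using loc[OF that] by (auto simp: P_def)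
    then show ?thesis unfolding c_def by (rule someI_ex)
  qed
  define \<sigma> where "\<sigma> p = snd (c p) p" for p
  have eq: "snd (c p) z = \<sigma> z" if p: "p \<in> U" and z: "z \<in> fst (c p)" for p z
  proof -
    have zU: "z \<in> U" using c[OF p] z by (auto simp: P_def)
    note cp = c[OF p, unfolded P_def] and cz = c[OF zU, unfolded P_def]
    show ?thesis unfolding \<sigma>_def
    proof (rule continuous_quotient_unique[of "fst (c p) \<inter> fst (c z)" "snd (c p)" "snd (c z)" F])
      show "continuous_on (fst (c p) \<inter> fst (c z)) (snd (c p))"
        using cp hol_fun_continuous_on continuous_on_subset[OF _ Int_lower1] by blast
      show "continuous_on (fst (c p) \<inter> fst (c z)) (snd (c z))"
        using cz hol_fun_continuous_on continuous_on_subset[OF _ Int_lower2] by blast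
      show "\<exists>w\<in>O'. F w \<noteq> 0" if "open O'" "O' \<noteq> {}" "O' \<subseteq> fst (c p) \<inter> fst (c z)" for O'
        using dense[OF that(1,2)] that(3) cp by blast
      show "F w * snd (c p) w = F w * snd (c z) w" if "w \<in> fst (c p) \<inter> fst (c z)" for w
      proof -
        have "E w = F w * snd (c p) w" "E w = F w * snd (c z) w" using cp cz that by blast+
        then show ?thesis by (rule trans[OF sym])
      qed
    qed (use cp cz z in auto)
  qed
  have "hol_fun \<sigma> U"
    unfolding hol_fun_def
  proof
    fix p assume p: "p \<in> U"
    have h: "hol_fun (snd (c p)) (fst (c p))" "open (fst (c p))" and pin: "p \<in> fst (c p)"
      using c[OF p] by (auto simp: P_def)
    have "hol_fun \<sigma> (fst (c p))" by (rule hol_fun_transform[OF h eq[OF p]])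
    then show "\<exists>D. (\<sigma> has_derivative D) (at p) \<and> (\<forall>a v. D (a *s v) = a * D v)"
      using pin unfolding hol_fun_def by (rule bspec)
  qed
  moreover have "E z = F z * \<sigma> z" if "z \<in> U" for z
    using c[OF that] by (auto simp: P_def \<sigma>_def)
  ultimately show ?thesis by blast
qed

lemma cpartial_eq_0_if_locally_0:
  fixes F :: "complex ^ 'm::finite \<Rightarrow> complex"
  assumes "open S" "z \<in> S" "\<And>w. w \<in> S \<Longrightarrow> F w = 0"
  shows "cpartial i F z = 0"
proof -
  have "((\<lambda>_. 0) has_derivative (\<lambda>v :: complex ^ 'm. \<Sum>i\<in>UNIV. 0 * v $ i)) (at z)" by simp
  then have "(F has_derivative (\<lambda>v :: complex ^ 'm. \<Sum>i\<in>UNIV. 0 * v $ i)) (at z)"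
    by (rule has_derivative_transform_within_open[OF _ assms(1,2)]) (simp add: assms(3))
  then show ?thesis by (rule cpartial_unique)
qed

text \<open>If \<open>F\<close> vanished on a nonempty open set, all its points would be critical;
  an isolated one would then form an open singleton.\<close>

lemma nonzero_dense_if_critical_isolated:
  fixes F :: "complex ^ 'm::finite \<Rightarrow> complex"
  assumes iso: "\<And>p. p \<in> U \<Longrightarrow> (\<forall>i. cpartial i F p = 0) \<Longrightarrow>
      \<exists>N. open N \<and> p \<in> N \<and> (\<forall>z\<in>N \<inter> U. (\<forall>i. cpartial i F z = 0) \<longrightarrow> z = p)"
    and O': "open O'" "O' \<noteq> {}" "O' \<subseteq> U"
  shows "\<exists>z\<in>O'. F z \<noteq> 0"
proof (rule ccontr)
  assume "\<not> ?thesis"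
  then have crit: "cpartial i F z = 0" if "z \<in> O'" for z i
    using cpartial_eq_0_if_locally_0[OF O'(1) that] by blast
  obtain p where p: "p \<in> O'" using O' by blast
  obtain N where N: "open N" "p \<in> N" "\<And>z. z \<in> N \<inter> U \<Longrightarrow> (\<forall>i. cpartial i F z = 0) \<Longrightarrow> z = p"
    using iso[OF subsetD[OF O'(3) p]] crit[OF p] by blast
  have "N \<inter> O' = {p}"
  proof (intro equalityI subsetI)
    fix z assume "z \<in> N \<inter> O'"
    then show "z \<in> {p}" using N(3)[of z] crit[of z] O'(3) by auto
  qed (use N(2) p in auto)
  moreover have "open (N \<inter> O')" using N(1) O'(1) by blast
  ultimately have "open {p}" by simp
  then show False using not_open_singleton by blast
qed

text \<open>Division is possible near every point of the open set \<open>R\<close> of regular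
  points. The quotient obtained there is extended over each isolated critical point by Hartogs'
  theorem and glued again.\<close>

lemma hol_fun_divide_isolated_critical:
  fixes F E :: "complex ^ 'm::finite \<Rightarrow> complex"
  assumes F: "hol_fun F U" and E: "hol_fun E U" and U: "open U" and dim: "CARD('m) \<ge> 2"
    and iso: "\<And>p. p \<in> U \<Longrightarrow> (\<forall>i. cpartial i F p = 0) \<Longrightarrow>
      \<exists>N. open N \<and> p \<in> N \<and> (\<forall>z\<in>N \<inter> U. (\<forall>i. cpartial i F z = 0) \<longrightarrow> z = p)"
    and zero: "\<And>z. z \<in> U \<Longrightarrow> F z = 0 \<Longrightarrow> \<exists>i. cpartial i F z \<noteq> 0 \<Longrightarrow> E z = 0"
  shows "\<exists>\<sigma>. hol_fun \<sigma> U \<and> (\<forall>z\<in>U. E z = F z * \<sigma> z)"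
proof -
  define R where "R = (\<Union>i. {z \<in> U. cpartial i F z \<noteq> 0})"
  have oR: "open R" unfolding R_def by (intro open_UN ballI open_nonzero continuous_on_cpartial[OF F U] U)
  have RU: "R \<subseteq> U" by (auto simp: R_def)
  have R: "z \<in> R \<longleftrightarrow> z \<in> U \<and> (\<exists>i. cpartial i F z \<noteq> 0)" for z by (auto simp: R_def)
  have dense: "\<exists>z\<in>O'. F z \<noteq> 0" if "open O'" "O' \<noteq> {}" "O' \<subseteq> U" for O'
    by (rule nonzero_dense_if_critical_isolated[OF iso that])
  have quot: "\<exists>N \<tau>. open N \<and> p \<in> N \<and> N \<subseteq> R \<and> hol_fun \<tau> N \<and> (\<forall>z\<in>N. E z = F z * \<tau> z)"
    if p: "p \<in> R" for p
  proof (cases "F p = 0")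
    case True
    obtain j where j: "cpartial j F p \<noteq> 0" using p R by blast
    have z: "E z = 0" if "z \<in> R" "F z = 0" for z using zero that R by blast
    obtain N \<tau> where "open N" "p \<in> N" "N \<subseteq> R" "hol_fun \<tau> N" "\<And>z. z \<in> N \<Longrightarrow> E z = F z * \<tau> z"
      by (rule hol_fun_divide_at_regular[OF hol_fun_subset[OF F RU] hol_fun_subset[OF E RU] oR p True j z];
          (assumption | rule that; assumption))
    then show ?thesis by blast
  next
    case False
    define N where "N = {z \<in> R. F z \<noteq> 0}"
    have "open N" unfolding N_def by (rule open_nonzero[OF hol_fun_continuous_on[OF hol_fun_subset[OF F RU]] oR])
    moreover have "N \<subseteq> U" using RU by (auto simp: N_def)
    then have "hol_fun (\<lambda>z. E z / F z) N"
      by (intro hol_fun_divide hol_fun_subset[OF E] hol_fun_subset[OF F]) (auto simp: N_def)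
    ultimately show ?thesis using p False
      by (intro exI[of _ N] exI[of _ "\<lambda>z. E z / F z"]) (auto simp: N_def)
  qed
  have "\<exists>\<sigma>. hol_fun \<sigma> R \<and> (\<forall>z\<in>R. E z = F z * \<sigma> z)"
    by (rule hol_fun_glue_quotient[OF dense quot]) (use RU in auto)
  then obtain \<sigma> where \<sigma>: "hol_fun \<sigma> R" "\<And>z. z \<in> R \<Longrightarrow> E z = F z * \<sigma> z" by blast
  show ?thesis
  proof (rule hol_fun_glue_quotient[OF dense])
    fix p assume p: "p \<in> U"
    show "\<exists>N \<tau>. open N \<and> p \<in> N \<and> N \<subseteq> U \<and> hol_fun \<tau> N \<and> (\<forall>z\<in>N. E z = F z * \<tau> z)"
    proof (cases "p \<in> R")
      case True
      then show ?thesis using quot[OF True] RU by blast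
    next
      case False
      then have "\<forall>i. cpartial i F p = 0" using p R by blast
      from iso[OF p this] obtain N0 where N0: "open N0" "p \<in> N0" "\<And>z. z \<in> N0 \<inter> U \<Longrightarrow> (\<forall>i. cpartial i F z = 0) \<Longrightarrow> z = p"
        by blast
      have sub: "(N0 \<inter> U) - {p} \<subseteq> R" using N0(3) R by blast
      obtain N \<tau> where N: "open N" "p \<in> N" "N \<subseteq> N0 \<inter> U" "hol_fun \<tau> N" "\<And>z. z \<in> N - {p} \<Longrightarrow> \<tau> z = \<sigma> z"
        by (rule hartogs_isolated_point[OF hol_fun_subset[OF \<sigma>(1) sub] _ _ dim]) (use N0 U p in auto)
      have NU: "N \<subseteq> U" using N(3) by blast
      have off: "E z = F z * \<tau> z" if "z \<in> N - {p}" for z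
        using \<sigma>(2)[of z] N(5)[OF that] that sub N(3) by (metis Diff_iff subsetD)
      have "E z = F z * \<tau> z" if z: "z \<in> N" for z
      \<comment> \<open>The index \<open>undefined\<close> is an arbitrary coordinate: off the
        hyperplane through \<open>p\<close> a point differs from \<open>p\<close>, where the
        factorization is already known.\<close>
      proof (rule continuous_eq_off_hyperplane[where S = N and c = "p $ undefined" and i = undefined])
        show "continuous_on N E" by (rule hol_fun_continuous_on[OF hol_fun_subset[OF E NU]])
        show "continuous_on N (\<lambda>z. F z * \<tau> z)"
          by (intro continuous_intros hol_fun_continuous_on[OF hol_fun_subset[OF F NU]] hol_fun_continuous_on[OF N(4)])
        show "E w = F w * \<tau> w" if "w \<in> N" "w $ undefined \<noteq> p $ undefined" for w using off that by blast
      qed (use N z in auto)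
      then show ?thesis using N NU by blast
    qed
  qed
qed

section \<open>Nondegenerate critical points\<close>

lemma critical_gradient_bound:
  fixes F :: "complex ^ 'm::finite \<Rightarrow> complex"
  assumes F: "hol_fun F U" and U: "open U" "p \<in> U" and crit: "\<And>i. cpartial i F p = 0"
    and inv: "invertible (chessian F p)"
  shows "\<exists>c>0. \<exists>e>0. ball p e \<subseteq> U \<and> (\<forall>z\<in>ball p e. c * norm (z - p) \<le> norm (\<chi> i. cpartial i F z))"
proof -
  let ?G = "\<lambda>z. \<chi> i. cpartial i F z"
  have G: "hol_map ?G U" using hol_fun_cpartial[OF F U(1)] by (simp add: hol_map_def)
  \<comment> \<open>The gradient map has the transposed Hessian as its derivative; by symmetry this
    is the Hessian itself. It is injective, so it is bounded below by some \<open>B\<close>, and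
    half of \<open>B\<close> survives the linearization error.\<close>
  have J: "cjacobian ?G p = chessian F p"
    using cpartial_commute[OF F U] by (simp add: cjacobian_def chessian_def vec_eq_iff)
  define A where "A = (\<lambda>v. chessian F p *v v)"
  have d: "(?G has_derivative A) (at p)"
    unfolding A_def using hol_map_has_derivative[OF G U(2)] by (simp add: J)
  have "linear A" using d has_derivative_bounded_linear bounded_linear.linear by blast
  moreover have "inj A"
    unfolding A_def using inv by (simp add: invertible_def matrix_left_invertible_injective[symmetric]) blast
  ultimately obtain B where B: "B > 0" "\<And>v. B * norm v \<le> norm (A v)"
    using linear_inj_bounded_below_pos by blast
  from d have "\<exists>e>0. \<forall>z. norm (z - p) < e \<longrightarrow> norm (?G z - ?G p - A (z - p)) \<le> (B / 2) * norm (z - p)"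
    unfolding has_derivative_at_alt using B(1) by (auto elim!: allE[of _ "B/2"])
  then obtain e1 where e1: "e1 > 0" "\<And>z. norm (z - p) < e1 \<Longrightarrow> norm (?G z - ?G p - A (z - p)) \<le> (B / 2) * norm (z - p)" by blast
  obtain e2 where e2: "e2 > 0" "ball p e2 \<subseteq> U" using U open_contains_ball by blast
  have "(B / 2) * norm (z - p) \<le> norm (?G z)" if "z \<in> ball p (min e1 e2)" for z
  proof -
    have "?G p = 0" using crit by (simp add: vec_eq_iff)
    then have "norm (?G z - A (z - p)) \<le> (B / 2) * norm (z - p)"
      using e1(2)[of z] that by (simp add: dist_norm norm_minus_commute)
    moreover have "norm (A (z - p)) \<le> norm (?G z) + norm (?G z - A (z - p))"
      by (metis norm_minus_commute norm_triangle_sub)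
    ultimately show ?thesis using B(2)[of "z - p"] by linarith
  qed
  then show ?thesis using B(1) e1(1) e2
    by (intro exI[of _ "B/2"] conjI exI[of _ "min e1 e2"]) (auto simp: subset_iff)
qed

definition qform :: "complex ^ 'm ^ 'm::finite \<Rightarrow> complex ^ 'm \<Rightarrow> complex" where
  "qform H v = (\<Sum>i\<in>UNIV. \<Sum>j\<in>UNIV. H $ i $ j * v $ i * v $ j)"

lemma qform_add_smult:
  assumes sym: "\<And>i j. H $ i $ j = H $ j $ i"
  shows "qform H (u + t *s v) = qform H u + 2 * t * (\<Sum>i\<in>UNIV. \<Sum>j\<in>UNIV. H $ i $ j * u $ i * v $ j) + t\<^sup>2 * qform H v"
proof -
  have s: "(\<Sum>i\<in>UNIV. \<Sum>j\<in>UNIV. H $ i $ j * v $ i * u $ j) = (\<Sum>i\<in>UNIV. \<Sum>j\<in>UNIV. H $ i $ j * u $ i * v $ j)"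
  proof (subst sum.swap, intro sum.cong refl)
    fix i j
    show "H $ j $ i * v $ j * u $ i = H $ i $ j * u $ i * v $ j" by (subst sym[of j i]) (simp only: mult_ac)
  qed
  have "qform H (u + t *s v) = qform H u + t * (\<Sum>i\<in>UNIV. \<Sum>j\<in>UNIV. H $ i $ j * u $ i * v $ j)
     + t * (\<Sum>i\<in>UNIV. \<Sum>j\<in>UNIV. H $ i $ j * v $ i * u $ j) + t\<^sup>2 * qform H v"
    by (simp add: qform_def algebra_simps sum.distrib sum_distrib_left power2_eq_square)
  then show ?thesis unfolding s by (simp add: algebra_simps)
qed

lemma sum_mult_axis: "(\<Sum>j\<in>UNIV. a j * axis k (c::'a::comm_ring_1) $ j) = a (k::'m::finite) * c"
  by (simp add: axis_def if_distrib[of "\<lambda>t. _ * t"] cong: if_cong)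

text \<open>Nonzero \<open>qform\<close> in each direction is what keeps projections near the
  critical point two-to-one; the norm bound guarantees that some direction sees a fixed share of the
  gradient.\<close>

lemma anisotropic_directions:
  fixes H :: "complex ^ 'm ^ 'm::finite"
  assumes sym: "\<And>i j. H $ i $ j = H $ j $ i" and H: "H \<noteq> 0"
  shows "\<exists>D c. finite D \<and> c > 0 \<and> (\<forall>v\<in>D. qform H v \<noteq> 0) \<and>
    (\<forall>a :: complex ^ 'm. \<exists>v\<in>D. c * norm a \<le> cmod (\<Sum>i\<in>UNIV. a $ i * v $ i))"
proof -
  have qa: "(\<Sum>i\<in>UNIV. \<Sum>j\<in>UNIV. H $ i $ j * axis k 1 $ i * axis l 1 $ j) = H $ k $ l" for k l
  proof -
    have "(\<Sum>i\<in>UNIV. \<Sum>j\<in>UNIV. H $ i $ j * axis k 1 $ i * axis l 1 $ j) = (\<Sum>i\<in>UNIV. H $ i $ l * axis k 1 $ i)"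
      by (simp add: sum_mult_axis)
    then show ?thesis by (simp add: sum_mult_axis)
  qed
  \<comment> \<open>Polarization: if the quadratic form vanished identically, so would every entry
    of the symmetric matrix.\<close>
  have "\<exists>v. qform H v \<noteq> 0"
  proof (rule ccontr)
    assume "\<not> ?thesis"
    then have q0: "qform H v = 0" for v by blast
    have "H $ k $ l = 0" for k l
      using qform_add_smult[OF sym, of "axis k 1" 1 "axis l 1"] by (simp add: q0 qa)
    then show False using H by (simp add: vec_eq_iff)
  qed
  then obtain v0 where v0: "qform H v0 \<noteq> 0" by blast
  \<comment> \<open>As a function of \<open>t\<close> this is a polynomial of degree 2 with leading
    coefficient \<open>qform H v0\<close>, so it cannot vanish at 0, 1 and -1 together.\<close>
  have "\<exists>t. cmod t \<le> 1 \<and> qform H (axis k 1 + t *s v0) \<noteq> 0" for k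
  proof (rule ccontr)
    assume "\<not> ?thesis"
    then have n: "qform H (axis k 1 + t *s v0) = 0" if "cmod t \<le> 1" for t using that by blast
    show False
      using n[of 0] n[of 1] n[of "-1"] v0 unfolding qform_add_smult[OF sym] by (simp add: algebra_simps)
  qed
  then obtain t where t: "\<And>k. cmod (t k) \<le> 1" "\<And>k. qform H (axis k 1 + t k *s v0) \<noteq> 0" by metis
  define w where "w k = axis k 1 + t k *s v0" for k
  define D where "D = insert v0 (range w)"
  \<comment> \<open>If all directions gave less than \<open>?c * norm a\<close>, each coordinate of
    \<open>a\<close> would be below \<open>2 * ?c * norm a\<close>, since it combines two directions
    with a factor of modulus at most 1. Summing would contradict \<open>norm a\<close> being at most
    the sum of the moduli.\<close>
  let ?c = "1 / (2 * real CARD('m))"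
  have "\<exists>v\<in>D. ?c * norm a \<le> cmod (\<Sum>i\<in>UNIV. a $ i * v $ i)" for a :: "complex ^ 'm"
  proof (rule ccontr)
    assume "\<not> ?thesis"
    then have less: "cmod (\<Sum>i\<in>UNIV. a $ i * v $ i) < ?c * norm a" if "v \<in> D" for v using that by force
    have "cmod (a $ k) < 2 * (?c * norm a)" for k
    proof -
      have "(\<Sum>i\<in>UNIV. a $ i * w k $ i) = a $ k + t k * (\<Sum>i\<in>UNIV. a $ i * v0 $ i)"
        unfolding w_def by (simp add: algebra_simps sum.distrib sum_mult_axis sum_distrib_left)
      then have "a $ k = (\<Sum>i\<in>UNIV. a $ i * w k $ i) - t k * (\<Sum>i\<in>UNIV. a $ i * v0 $ i)" by simp
      then have "cmod (a $ k) \<le> cmod (\<Sum>i\<in>UNIV. a $ i * w k $ i) + cmod (t k) * cmod (\<Sum>i\<in>UNIV. a $ i * v0 $ i)"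
        by (metis norm_mult norm_triangle_ineq4)
      also have "cmod (t k) * cmod (\<Sum>i\<in>UNIV. a $ i * v0 $ i) \<le> 1 * cmod (\<Sum>i\<in>UNIV. a $ i * v0 $ i)"
        using t(1) by (intro mult_right_mono) auto
      finally show ?thesis using less[of "w k"] less[of v0] by (simp add: D_def)
    qed
    then have "(\<Sum>k\<in>UNIV. cmod (a $ k)) < (\<Sum>k\<in>(UNIV::'m set). 2 * (?c * norm a))"
      by (intro sum_strict_mono) auto
    also have "\<dots> = norm a" by simp
    also have "norm a \<le> (\<Sum>k\<in>UNIV. cmod (a $ k))" by (simp add: norm_vec_def L2_set_le_sum)
    finally show False by simp
  qed
  moreover have "finite D" "\<forall>v\<in>D. qform H v \<noteq> 0" using t(2) v0 by (auto simp: D_def w_def)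
  ultimately show ?thesis by (intro exI[of _ D] exI[of _ ?c]) (auto simp: zero_less_mult_iff)
qed

text \<open>Compare \<open>g\<close> with the parabola \<open>Q / 2 * t\<^sup>2\<close>. The
  difference \<open>h\<close> has second derivative at most a quarter of \<open>cmod Q\<close>, so
  its difference quotient \<open>\<psi>\<close> at \<open>t1\<close> has the same Lipschitz bound.
  Equal values of \<open>g\<close> would force slope \<open>Q / 2\<close> for \<open>\<psi>\<close>
  between \<open>t2\<close> and \<open>t3\<close>. The segment must avoid \<open>t1\<close>, where
  \<open>\<psi>\<close> has junk value.\<close>

lemma no_three_equal_values:
  fixes g g1 g2 :: "complex \<Rightarrow> complex"
  assumes S: "convex S" and d: "\<And>t. t \<in> S \<Longrightarrow> (g has_field_derivative g1 t) (at t)"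
    "\<And>t. t \<in> S \<Longrightarrow> (g1 has_field_derivative g2 t) (at t)"
    and Q: "Q \<noteq> 0" "\<And>t. t \<in> S \<Longrightarrow> cmod (g2 t - Q) \<le> cmod Q / 4"
    and t: "t1 \<in> S" "t2 \<in> S" "t3 \<in> S" "t1 \<notin> closed_segment t2 t3" "t2 \<noteq> t3"
    and eq: "g t1 = g t2" "g t1 = g t3"
  shows False
proof -
  \<comment> \<open>The remainder and its derivatives are indexed by their order, as
    \<open>complex_Taylor\<close> expects.\<close>
  define h where "h i t = (if i = 0 then g t - Q / 2 * t\<^sup>2 else if i = 1 then g1 t - Q * t else g2 t - Q)" for i :: nat and t
  define \<psi> where "\<psi> t = (h 0 t - h 0 t1) / (t - t1)" for t
  have dh: "(h i has_field_derivative h (Suc i) x) (at x)" if "x \<in> S" "i \<le> 1" for i x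
  proof (cases "i = 0")
    case True
    show ?thesis unfolding h_def True
      by (auto intro!: derivative_eq_intros d(1)[OF that(1)])
  next
    case False
    then have "i = 1" using that(2) by simp
    then show ?thesis unfolding h_def
      by (auto intro!: derivative_eq_intros d(2)[OF that(1)])
  qed
  have taylor: "cmod (h 0 t1 - h 0 x - h 1 x * (t1 - x)) \<le> cmod Q / 4 * (cmod (t1 - x))\<^sup>2" if x: "x \<in> S" for x
  proof -
    have "cmod (h 0 t1 - (\<Sum>i\<le>1. h i x * (t1 - x) ^ i / fact i)) \<le> cmod Q / 4 * cmod (t1 - x) ^ Suc 1 / fact 1"
    proof (rule complex_Taylor[OF S _ _ x t(1)])
      show "(h i has_field_derivative h (Suc i) y) (at y within S)" if "y \<in> S" "i \<le> 1" for i y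
        using dh[OF that] by (rule has_field_derivative_at_within)
      show "cmod (h (Suc 1) y) \<le> cmod Q / 4" if "y \<in> S" for y
        using Q(2)[OF that] by (simp add: h_def)
    qed
    then show ?thesis by (simp add: algebra_simps power2_eq_square)
  qed
  have seg: "closed_segment t2 t3 \<subseteq> S" using S t by (simp add: closed_segment_subset)
  have le: "cmod (\<psi> t3 - \<psi> t2) \<le> cmod Q / 4 * cmod (t3 - t2)"
  proof (rule field_differentiable_bound[OF convex_closed_segment[of t2 t3]])
    fix x assume x: "x \<in> closed_segment t2 t3"
    then have ne: "x \<noteq> t1" and xS: "x \<in> S" using t seg by auto
    have "((\<lambda>t. (h 0 t - h 0 t1) / (t - t1)) has_field_derivative ((h 1 x * (x - t1) - (h 0 x - h 0 t1)) / ((x - t1) * (x - t1)))) (at x)"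
      using dh[OF xS, of 0] ne by (auto intro!: derivative_eq_intros)
    then show "(\<psi> has_field_derivative ((h 1 x * (x - t1) - (h 0 x - h 0 t1)) / ((x - t1) * (x - t1)))) (at x within closed_segment t2 t3)"
      unfolding \<psi>_def by (rule has_field_derivative_at_within)
    \<comment> \<open>The numerator of the derivative of \<open>\<psi>\<close> is the first-order
      Taylor remainder of \<open>h 0\<close> expanded at \<open>x\<close>.\<close>
    have "h 1 x * (x - t1) - (h 0 x - h 0 t1) = h 0 t1 - h 0 x - h 1 x * (t1 - x)" by (simp add: algebra_simps)
    then have "cmod ((h 1 x * (x - t1) - (h 0 x - h 0 t1)) / ((x - t1) * (x - t1)))
        = cmod (h 0 t1 - h 0 x - h 1 x * (t1 - x)) / (cmod (t1 - x))\<^sup>2"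
      by (simp only: norm_divide norm_mult norm_minus_commute[of x t1] power2_eq_square)
    also have "\<dots> \<le> cmod Q / 4"
      using taylor[OF xS] ne by (subst pos_divide_le_eq) auto
    finally show "cmod ((h 1 x * (x - t1) - (h 0 x - h 0 t1)) / ((x - t1) * (x - t1))) \<le> cmod Q / 4" .
  qed auto
  have "\<psi> x = - Q / 2 * (x + t1)" if "g t1 = g x" "x \<noteq> t1" for x
    using that by (simp add: \<psi>_def h_def divide_simps power2_eq_square) (simp add: algebra_simps)
  moreover have "t2 \<noteq> t1" "t3 \<noteq> t1" using t(4) by auto
  ultimately have "\<psi> t2 = - Q / 2 * (t2 + t1)" "\<psi> t3 = - Q / 2 * (t3 + t1)" using eq by blast+
  then have "\<psi> t3 - \<psi> t2 = (- Q / 2) * (t3 + t1) - (- Q / 2) * (t2 + t1)" by simp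
  also have "\<dots> = (- Q / 2) * ((t3 + t1) - (t2 + t1))" by (rule right_diff_distrib[symmetric])
  finally have "\<psi> t3 - \<psi> t2 = - Q / 2 * (t3 - t2)" by simp
  then have "cmod (\<psi> t3 - \<psi> t2) = cmod Q / 2 * cmod (t3 - t2)" by (simp add: norm_mult norm_divide)
  moreover have "0 < cmod Q * cmod (t3 - t2)" using Q(1) t(5) by simp
  ultimately show False using le by simp
qed

subsection \<open>Projections along lines\<close>

lemma prod_UNIV_option:
  fixes f :: "'n::finite option \<Rightarrow> 'c::comm_monoid_mult"
  shows "(\<Prod>i\<in>UNIV. f i) = f None * (\<Prod>k\<in>UNIV. f (Some k))"
  unfolding UNIV_option_conv by (subst prod.insert) (auto simp: prod.reindex)

lemma sum_UNIV_option:
  fixes f :: "'n::finite option \<Rightarrow> 'c::comm_monoid_add"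
  shows "(\<Sum>i\<in>UNIV. f i) = f None + (\<Sum>k\<in>UNIV. f (Some k))"
  unfolding UNIV_option_conv by (subst sum.insert) (auto simp: sum.reindex)

text \<open>This is the matrix in the definition of \<open>fibre_form\<close>: a direction in the
  total space followed by the tangent vectors of the fibre.\<close>

definition cons_col :: "complex ^ 'n::finite option \<Rightarrow> complex ^ 'n ^ 'n option \<Rightarrow> complex ^ 'n option ^ 'n option" where
  "cons_col v G = (\<chi> i j. case j of None \<Rightarrow> v $ i | Some k \<Rightarrow> G $ i $ k)"

text \<open>Expansion along the column \<open>None\<close>: only permutations fixing
  \<open>None\<close> contribute, and these come from permutations of \<open>'n\<close>.\<close>

lemma det_cons_col_axis:
  fixes G :: "complex ^ 'n::finite ^ 'n option"
  shows "det (cons_col (axis None 1) G) = det (\<chi> i k. G $ Some i $ k)"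
proof -
  let ?A = "cons_col (axis None 1) G"
  let ?g = "map_permutation (UNIV::'n set) Some"
  have mp: "?g q None = None" "?g q (Some x) = Some (q x)" for q x
    by (auto simp: map_permutation_def restrict_id_def)
  have inj: "inj_on ?g {q. q permutes UNIV}"
  proof (rule inj_onI)
    fix p q assume e: "?g p = ?g q"
    have "p x = q x" for x using fun_cong[OF e, of "Some x"] by (simp add: mp)
    then show "p = q" by (rule ext)
  qed
  let ?t = "\<lambda>p. of_int (sign p) * (\<Prod>i\<in>UNIV. ?A $ i $ p i)"
  have sub: "?g ` {q. q permutes UNIV} \<subseteq> {p. p permutes UNIV}"
  proof (intro image_subsetI)
    fix q :: "'n \<Rightarrow> 'n" assume "q \<in> {q. q permutes UNIV}"
    then have "?g q permutes range Some"
      by (intro map_permutation_permutes) (auto simp: bij_betw_def)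
    then show "?g q \<in> {p. p permutes UNIV}" using permutes_subset by blast
  qed
  have zero: "?t p = 0" if p: "p permutes UNIV" "p \<notin> ?g ` {q. q permutes UNIV}" for p
  proof -
    have nN: "p None \<noteq> None"
    proof
      assume pN: "p None = None"
      have ip: "inj p" using p(1) by (simp add: permutes_inj)
      have "\<exists>y. p (Some x) = Some y" for x
        using injD[OF ip, of "Some x" None] pN by (cases "p (Some x)") auto
      then obtain q where q: "\<And>x. p (Some x) = Some (q x)" by metis
      have "inj q"
      proof (rule injI)
        fix x y assume "q x = q y"
        then have "p (Some x) = p (Some y)" by (simp add: q)
        then show "x = y" using injD[OF ip] by blast
      qed
      then have "q permutes UNIV" by (simp add: permutes_UNIV_iff_bij bij_def finite_UNIV_inj_surj)
      moreover have "p = ?g q"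
      proof
        fix x show "p x = ?g q x" by (cases x) (simp_all add: mp q pN)
      qed
      ultimately show False using p(2) by blast
    qed
    obtain i where i: "p i = None" using p(1) by (metis permutes_def)
    then have "i \<noteq> None" using nN by metis
    then have "?A $ i $ p i = 0" using i by (simp add: cons_col_def axis_def)
    then have "(\<Prod>i\<in>UNIV. ?A $ i $ p i) = 0" by (intro prod_zero) auto
    then show ?thesis by simp
  qed
  have "det ?A = sum ?t (?g ` {q. q permutes UNIV})"
    unfolding det_def by (rule sum.mono_neutral_right) (use sub zero in \<open>auto simp: finite_permutations\<close>)
  also have "\<dots> = (\<Sum>q | q permutes UNIV. ?t (?g q))" by (rule sum.reindex[OF inj, unfolded comp_def])
  also have "\<dots> = (\<Sum>q | q permutes UNIV. of_int (sign q) * (\<Prod>i\<in>UNIV. G $ Some i $ q i))"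
  proof (rule sum.cong[OF refl])
    fix q :: "'n \<Rightarrow> 'n" assume "q \<in> {q. q permutes UNIV}"
    then have "sign (?g q) = sign q" by (intro sign_map_permutation) auto
    then show "?t (?g q) = of_int (sign q) * (\<Prod>i\<in>UNIV. G $ Some i $ q i)"
      by (simp add: prod_UNIV_option mp cons_col_def axis_def)
  qed
  finally show ?thesis by (simp add: det_def)
qed

lemma matrix_mult_cons_col: "R ** cons_col v G = cons_col (R *v v) (R ** G)"
proof -
  have "(R ** cons_col v G) $ i $ j = cons_col (R *v v) (R ** G) $ i $ j" for i j
    by (cases j) (simp_all add: matrix_matrix_mult_def matrix_vector_mult_def cons_col_def)
  then show ?thesis by (simp add: vec_eq_iff)
qed

text \<open>Relates the Jacobian determinant of a fibre chart followed by projection along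
  \<open>v\<close> to the determinant occurring in \<open>fibre_form\<close>.\<close>

lemma det_cons_col:
  assumes "R *v v = axis None 1"
  shows "det R * det (cons_col v G) = det (\<chi> i k. (R ** G) $ Some i $ k)"
  by (metis assms det_cons_col_axis det_mul matrix_mult_cons_col)

text \<open>For a covector \<open>l\<close> with \<open>l(v) = 1\<close>, the map sending
  \<open>y\<close> to \<open>y - l(y) * (v - axis None 1)\<close> takes \<open>v\<close> to
  \<open>axis None 1\<close>. If it kills \<open>y\<close>, then
  \<open>l(y) * l(axis None 1) = 0\<close>; so it is injective once the entry
  \<open>l $ None\<close> is nonzero.\<close>

lemma exists_straightening:
  fixes v :: "complex ^ 'n::finite option"
  assumes v: "v \<noteq> 0"
  shows "\<exists>R :: complex ^ 'n option ^ 'n option. invertible R \<and> R *v v = axis None 1"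
proof -
  obtain l :: "complex ^ 'n option" where l: "(\<Sum>i\<in>UNIV. l $ i * v $ i) = 1" "l $ None \<noteq> 0"
  proof (cases "v $ None = 0")
    case False
    show ?thesis
      by (rule that[of "axis None (1 / v $ None)"])
         (use False in \<open>simp_all add: axis_def if_distrib[of "\<lambda>t. t * _"] cong: if_cong\<close>)
  next
    case True
    then obtain i where i: "v $ i \<noteq> 0" "i \<noteq> None" using v by (metis vec_eq_iff zero_index)
    show ?thesis
    proof (rule that[of "axis None 1 + axis i (1 / v $ i)"])
      have "(\<Sum>j\<in>UNIV. (axis None 1 + axis i (1 / v $ i)) $ j * v $ j)
          = (\<Sum>j\<in>UNIV. v $ j * axis None 1 $ j) + (\<Sum>j\<in>UNIV. v $ j * axis i (1 / v $ i) $ j)"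
        by (simp add: algebra_simps sum.distrib)
      then show "(\<Sum>j\<in>UNIV. (axis None 1 + axis i (1 / v $ i)) $ j * v $ j) = 1"
        unfolding sum_mult_axis using True i by simp
    qed (use i in \<open>auto simp: axis_def\<close>)
  qed
  define R :: "complex ^ 'n option ^ 'n option" where "R = (\<chi> i j. (if i = j then 1 else 0) - l $ j * (v - axis None 1) $ i)"
  have R: "R *v y = y - (\<Sum>j\<in>UNIV. l $ j * y $ j) *s (v - axis None 1)" for y
  proof -
    define w where "w = v - axis None 1"
    have "(R *v y) $ i = (y - (\<Sum>j\<in>UNIV. l $ j * y $ j) *s w) $ i" for i
    proof -
      have "(R *v y) $ i = (\<Sum>j\<in>UNIV. (if i = j then y $ j else 0) - l $ j * y $ j * w $ i)"
        unfolding matrix_vector_mult_def R_def w_def[symmetric] vec_lambda_beta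
        by (intro sum.cong refl) (auto simp: algebra_simps)
      then show ?thesis by (simp add: sum_subtractf sum_distrib_right)
    qed
    then show ?thesis unfolding w_def[symmetric] vec_eq_iff by blast
  qed
  have "R *v v = axis None 1" unfolding R l(1) by (simp add: vec_eq_iff)
  moreover have "inj ((*v) R)"
  proof -
    have "y = 0" if "R *v y = 0" for y
    proof -
      let ?m = "\<Sum>j\<in>UNIV. l $ j * y $ j"
      have y: "y = ?m *s (v - axis None 1)" using that unfolding R by simp
      have "?m = (\<Sum>j\<in>UNIV. l $ j * (?m *s (v - axis None 1)) $ j)" using y by metis
      also have "\<dots> = ?m * ((\<Sum>j\<in>UNIV. l $ j * v $ j) - (\<Sum>j\<in>UNIV. l $ j * axis None 1 $ j))"
      proof -
        have "(\<Sum>j\<in>UNIV. l $ j * (m *s w) $ j) = m * (\<Sum>j\<in>UNIV. l $ j * w $ j)" for m w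
          by (simp add: sum_distrib_left mult_ac)
        then show ?thesis by (simp add: sum_subtractf right_diff_distrib)
      qed
      also have "\<dots> = ?m * (1 - l $ None)" by (simp add: l sum_mult_axis)
      finally have "?m * l $ None = 0" by (simp add: algebra_simps)
      then have "?m = 0" using l(2) by simp
      then show ?thesis using y by (metis vector_smult_lzero)
    qed
    then show ?thesis
      by (intro injI) (metis (no_types, opaque_lifting) eq_iff_diff_eq_0 matrix_vector_mult_diff_distrib)
  qed
  then have "invertible R" by (simp add: invertible_left_inverse matrix_left_invertible_injective)
  ultimately show ?thesis by blast
qed

text \<open>When \<open>R\<close> is invertible and takes \<open>v\<close> to
  \<open>axis None 1\<close>, this is the linear projection with kernel the line through
  \<open>v\<close>.\<close>

definition proj :: "complex ^ 'n option ^ 'n::finite option \<Rightarrow> complex ^ 'n option \<Rightarrow> complex ^ 'n" where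
  "proj R z = (\<chi> k. (R *v z) $ Some k)"

lemma linear_proj: "linear (proj R)"
  by (rule linearI) (simp_all add: proj_def vec_eq_iff matrix_vector_mult_def algebra_simps sum.distrib scaleR_sum_right)

lemma proj_diff: "proj R (y - z) = proj R y - proj R z"
  by (rule linear_diff[OF linear_proj])

lemma proj_eq_imp_line:
  fixes R :: "complex ^ 'n option ^ 'n::finite option"
  assumes R: "invertible R" "R *v v = axis None 1" and eq: "proj R y = proj R z"
  obtains t where "y = z + t *s v"
proof -
  have "(R *v (y - z)) $ Some k = 0" for k
    using eq by (simp add: proj_def vec_eq_iff matrix_vector_mult_diff_distrib)
  then have "(R *v (y - z)) $ i = ((R *v (y - z)) $ None *s axis None 1) $ i" for i
    by (cases i) (simp_all add: axis_def)
  then have e: "R *v (y - z) = R *v ((R *v (y - z)) $ None *s v)"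
    unfolding vec_eq_iff vector_scalar_commute R(2) by blast
  have "inj ((*v) R)" using R(1) by (simp add: invertible_left_inverse matrix_left_invertible_injective)
  then have "y - z = (R *v (y - z)) $ None *s v" using e by (rule injD)
  then have "y = z + (R *v (y - z)) $ None *s v" by (simp only: diff_eq_eq add.commute)
  then show ?thesis by (rule that)
qed

lemma finite_card_le_2I:
  assumes "\<And>x y z. x \<in> S \<Longrightarrow> y \<in> S \<Longrightarrow> z \<in> S \<Longrightarrow> x = y \<or> y = z \<or> x = z"
  shows "finite S \<and> card S \<le> 2"
proof -
  have "\<exists>a b. S \<subseteq> {a, b}"
  proof (cases "\<exists>a\<in>S. \<exists>b\<in>S. a \<noteq> b")
    case True
    then obtain a b where "a \<in> S" "b \<in> S" "a \<noteq> b" by blast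
    then have "S \<subseteq> {a, b}" using assms[of a b] by auto
    then show ?thesis by blast
  qed blast
  then obtain a b where "S \<subseteq> {a, b}" by blast
  moreover have "card {a, b} \<le> 2" by (simp add: card_insert_if)
  ultimately show ?thesis using finite_subset card_mono[of "{a, b}" S] by (meson finite.intros le_trans)
qed

section \<open>Values of a function on complex lines\<close>

definition dirv :: "(complex ^ 'm::finite \<Rightarrow> complex) \<Rightarrow> complex ^ 'm \<Rightarrow> complex ^ 'm \<Rightarrow> complex" where
  "dirv F v z = (\<Sum>i\<in>UNIV. cpartial i F z * v $ i)"

lemma hol_fun_dirv: "hol_fun F U \<Longrightarrow> open U \<Longrightarrow> hol_fun (dirv F v) U"
  unfolding dirv_def by (intro hol_fun_sum hol_fun_mult hol_fun_const hol_fun_cpartial)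

lemma dirv_axis: "dirv F (axis i 1) z = cpartial i F z"
  by (simp add: dirv_def sum_mult_axis)

lemma has_field_derivative_dirv:
  assumes "hol_fun F U" "z + t *s v \<in> U"
  shows "((\<lambda>t. F (z + t *s v)) has_field_derivative dirv F v (z + t *s v)) (at t)"
  using hol_fun_line[OF assms] by (simp add: dirv_def)

lemma dirv_dirv:
  assumes "hol_fun F U" "open U" "z \<in> U"
  shows "dirv (dirv F v) v z = qform (chessian F z) v"
proof -
  have "cpartial i (dirv F v) z = (\<Sum>j\<in>UNIV. cpartial i (cpartial j F) z * v $ j)" for i
  proof (rule cpartial_unique)
    have "((\<lambda>z. \<Sum>j\<in>UNIV. cpartial j F z * v $ j) has_derivative (\<lambda>w. \<Sum>j\<in>UNIV. (\<Sum>i\<in>UNIV. cpartial i (cpartial j F) z * w $ i) * v $ j)) (at z)"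
      by (intro has_derivative_sum has_derivative_mult_left hol_fun_has_derivative[OF hol_fun_cpartial[OF assms(1,2)] assms(3)])
    moreover have "(\<Sum>j\<in>UNIV. (\<Sum>i\<in>UNIV. cpartial i (cpartial j F) z * w $ i) * v $ j)
        = (\<Sum>i\<in>UNIV. (\<Sum>j\<in>UNIV. cpartial i (cpartial j F) z * v $ j) * w $ i)" for w
      unfolding sum_distrib_right by (subst sum.swap) (intro sum.cong refl, simp add: mult_ac)
    ultimately show "(dirv F v has_derivative (\<lambda>w. \<Sum>i\<in>UNIV. (\<Sum>j\<in>UNIV. cpartial i (cpartial j F) z * v $ j) * w $ i)) (at z)"
      unfolding dirv_def by simp
  qed
  then show ?thesis by (simp add: dirv_def qform_def chessian_def sum_distrib_left sum_distrib_right mult_ac)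
qed

lemma convex_line_preimage:
  fixes z v :: "complex ^ 'm::finite"
  assumes "convex S" shows "convex {t. z + t *s v \<in> S}"
proof -
  have "linear (\<lambda>t. t *s v)" using bounded_linear.linear[OF bounded_linear_vector_smult] .
  then have "convex ((\<lambda>t. t *s v) -` ((+) (- z) ` S))"
    by (rule convex_linear_vimage) (use assms in \<open>simp add: convex_translation\<close>)
  moreover have "(\<lambda>t. t *s v) -` ((+) (- z) ` S) = {t. z + t *s v \<in> S}"
    by (auto simp: image_iff algebra_simps)
  ultimately show ?thesis by simp
qed

text \<open>\<open>F\<close> minus the linear function of slope \<open>a\<close> has Lipschitz
  constant at most half the modulus of \<open>a\<close> along the line, so equal values of
  \<open>F\<close> leave no room for a nonzero \<open>t\<close>.\<close>

lemma dirv_injective_on_lines: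
  fixes F :: "complex ^ 'm::finite \<Rightarrow> complex"
  assumes F: "hol_fun F U" and B: "convex B" "B \<subseteq> U" and a: "\<And>z. z \<in> B \<Longrightarrow> cmod (dirv F v z - a) \<le> cmod a / 2" "a \<noteq> 0"
    and z: "z \<in> B" "z + t *s v \<in> B" "F z = F (z + t *s v)"
  shows "t = 0"
proof -
  let ?S = "{t. z + t *s v \<in> B}" and ?h = "\<lambda>t. F (z + t *s v) - a * t"
  have "cmod (?h t - ?h 0) \<le> cmod a / 2 * cmod (t - 0)"
  proof (rule field_differentiable_bound[OF convex_line_preimage[OF B(1)]])
    fix x assume x: "x \<in> ?S"
    have "((\<lambda>t. F (z + t *s v)) has_field_derivative dirv F v (z + x *s v)) (at x)"
      by (rule has_field_derivative_dirv[OF F]) (use x B in auto)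
    from DERIV_diff[OF this DERIV_cmult[OF DERIV_ident, of a]]
    show "(?h has_field_derivative dirv F v (z + x *s v) - a) (at x within ?S)"
      by (simp add: has_field_derivative_at_within)
    show "cmod (dirv F v (z + x *s v) - a) \<le> cmod a / 2" using a x by blast
  qed (use z in auto)
  then have "cmod a * cmod t \<le> cmod a / 2 * cmod t" using z(3) by (simp add: norm_mult)
  then have "cmod a * cmod t \<le> 0" by simp
  then show ?thesis using a(2) by (simp add: mult_le_0_iff)
qed

text \<open>Betweenness of both points would make two triangle inequalities equalities and force
  distance 0. This supplies the off-segment condition of \<open>no_three_equal_values\<close> for a
  suitable one of three collinear points.\<close>

lemma some_point_not_between:
  fixes a b c :: "'a::euclidean_space"
  assumes "a \<noteq> b"
  shows "a \<notin> closed_segment b c \<or> b \<notin> closed_segment a c"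
proof (rule ccontr)
  assume "\<not> ?thesis"
  then have "dist b c = dist b a + dist a c" "dist a c = dist a b + dist b c"
    using between_mem_segment between by (metis, metis)
  then have "dist a b = 0" by (simp add: dist_commute)
  then show False using assms by simp
qed

lemma no_three_on_line:
  fixes F :: "complex ^ 'm::finite \<Rightarrow> complex"
  assumes F: "hol_fun F U" "open U" and B: "convex B" "B \<subseteq> U"
    and Q: "\<And>z. z \<in> B \<Longrightarrow> cmod (qform (chessian F z) v - Q) \<le> cmod Q / 4" "Q \<noteq> 0"
    and z: "z \<in> B" "z + t *s v \<in> B" "z + u *s v \<in> B" "F z = F (z + t *s v)" "F z = F (z + u *s v)"
  shows "t = 0 \<or> u = 0 \<or> t = u"
proof (rule ccontr)
  assume ne: "\<not> ?thesis"
  let ?S = "{t. z + t *s v \<in> B}" and ?g = "\<lambda>t. F (z + t *s v)"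
  let ?g1 = "\<lambda>t. dirv F v (z + t *s v)" and ?g2 = "\<lambda>t. qform (chessian F (z + t *s v)) v"
  have d1: "(?g has_field_derivative ?g1 t) (at t)" if "t \<in> ?S" for t
    by (rule has_field_derivative_dirv[OF F(1)]) (use that B in auto)
  have d2: "(?g1 has_field_derivative ?g2 t) (at t)" if "t \<in> ?S" for t
  proof -
    have U: "z + t *s v \<in> U" using that B by auto
    have "(?g1 has_field_derivative dirv (dirv F v) v (z + t *s v)) (at t)"
      by (rule has_field_derivative_dirv[OF hol_fun_dirv[OF F] U])
    then show ?thesis by (simp only: dirv_dirv[OF F U])
  qed
  note no = no_three_equal_values[OF convex_line_preimage[OF B(1)] d1 d2 Q(2), of z v]
  have S: "0 \<in> ?S" "t \<in> ?S" "u \<in> ?S" using z by auto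
  have b: "cmod (?g2 t - Q) \<le> cmod Q / 4" if "t \<in> ?S" for t using Q(1) that by blast
  have "0 \<notin> closed_segment t u \<or> t \<notin> closed_segment 0 u" using some_point_not_between[of 0 t u] ne by blast
  then show False
  proof
    assume "0 \<notin> closed_segment t u"
    then show False using no[of 0 t u] S b ne z(4,5) by auto
  next
    assume "t \<notin> closed_segment 0 u"
    then show False using no[of t 0 u] S b ne z(4,5) by auto
  qed
qed

subsection \<open>Integration over the fibres of a function\<close>

text \<open>
  On level sets of \<open>F\<close> in \<open>B\<close> the projection along \<open>v\<close> is at most two-to-one. On \<open>D\<close> the density
  \<open>\<bar>E\<bar>\<^sup>2 / \<bar>dF(v)\<bar>\<^sup>2\<close> of the fibre form, in the coordinates given by this projection, is dominated by the
  integrable function \<open>\<phi>\<close>. The value \<open>w0\<close> is excluded because the majorant \<open>1 / \<bar>w - w0\<bar>\<^sup>2\<close> used near a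
  critical point takes the junk value 0 there.
\<close>

definition patch :: "(complex ^ 'n::finite option \<Rightarrow> complex) \<Rightarrow> (complex ^ 'n option \<Rightarrow> complex) \<Rightarrow> (complex ^ 'n option) set
    \<Rightarrow> (complex ^ 'n option) set \<Rightarrow> (complex ^ 'n option) set \<Rightarrow> complex ^ 'n option ^ 'n option
    \<Rightarrow> complex ^ 'n option \<Rightarrow> complex ^ 'n \<Rightarrow> (complex ^ 'n \<Rightarrow> real) \<Rightarrow> bool" where
  "patch F E U B D R v w0 \<phi> \<longleftrightarrow>
     open B \<and> B \<subseteq> U \<and> D \<in> sets borel \<and> D \<subseteq> B \<and> invertible R \<and> R *v v = axis None 1 \<and>
     (\<forall>z\<in>D. dirv F v z \<noteq> 0) \<and>
     (\<forall>s w. finite {z\<in>B. F z = s \<and> proj R z = w} \<and> card {z\<in>B. F z = s \<and> proj R z = w} \<le> 2) \<and>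
     \<phi> \<in> borel_measurable borel \<and> (\<forall>w. 0 \<le> \<phi> w) \<and> (\<integral>\<^sup>+ w. \<phi> w \<partial>lborel) < \<infinity> \<and>
     (\<forall>z\<in>D. proj R z \<noteq> w0 \<longrightarrow> (cmod (E z))\<^sup>2 / ((cmod (det R))\<^sup>2 * (cmod (dirv F v z))\<^sup>2) \<le> \<phi> (proj R z))"

lemma hol_map_proj:
  assumes "hol_map G W" shows "hol_map (\<lambda>z. proj R (G z)) W"
  using assms unfolding hol_map_def proj_def matrix_vector_mult_def
  by (auto intro!: hol_fun_sum hol_fun_mult hol_fun_const)

lemma cjacobian_proj:
  assumes "hol_map G W" "z \<in> W"
  shows "cjacobian (\<lambda>z. proj R (G z)) z = (\<chi> i k. (R ** cjacobian G z) $ Some i $ k)"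
proof -
  have "cpartial k (\<lambda>w. proj R (G w) $ i) z = (R ** cjacobian G z) $ Some i $ k" for i k
  proof (rule cpartial_unique)
    have "((\<lambda>w. \<Sum>j\<in>UNIV. R $ Some i $ j * G w $ j) has_derivative (\<lambda>v. \<Sum>j\<in>UNIV. R $ Some i $ j * (\<Sum>k\<in>UNIV. cpartial k (\<lambda>w. G w $ j) z * v $ k))) (at z)"
      using assms by (intro has_derivative_sum has_derivative_mult_right hol_fun_has_derivative) (auto simp: hol_map_def)
    moreover have "(\<Sum>j\<in>UNIV. R $ Some i $ j * (\<Sum>k\<in>UNIV. cpartial k (\<lambda>w. G w $ j) z * v $ k))
       = (\<Sum>k\<in>UNIV. (\<Sum>j\<in>UNIV. R $ Some i $ j * cpartial k (\<lambda>w. G w $ j) z) * v $ k)" for v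
      unfolding sum_distrib_left sum_distrib_right mult.assoc by (rule sum.swap)
    ultimately show "((\<lambda>w. proj R (G w) $ i) has_derivative (\<lambda>v. \<Sum>k\<in>UNIV. (R ** cjacobian G z) $ Some i $ k * v $ k)) (at z)"
      by (simp add: proj_def matrix_vector_mult_def matrix_matrix_mult_def cjacobian_def)
  qed
  then show ?thesis by (simp add: cjacobian_def)
qed

lemma hol_fun_det_cjacobian:
  fixes G :: "complex ^ 'n::finite \<Rightarrow> complex ^ 'n"
  assumes "hol_map G W" "open W"
  shows "hol_fun (\<lambda>z. det (cjacobian G z)) W"
  unfolding det_def cjacobian_def
  by (auto intro!: hol_fun_sum hol_fun_mult hol_fun_const hol_fun_prod hol_fun_cpartial
      simp: assms(2) assms(1)[unfolded hol_map_def])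

text \<open>The map \<open>proj R\<close> after \<open>G p\<close> has Jacobian
  \<open>det R * det (cons_col v _)\<close>, so hypothesis \<open>h\<close> turns the fibre density
  into the squared Jacobian times the function bounded by \<open>\<phi>\<close>. Disjointness, in
  the form of \<open>inj\<close>, lets the two-to-one property bound the multiplicity of all pieces
  together.\<close>

lemma patch_integral_bound:
  fixes F E :: "complex ^ 'n::finite option \<Rightarrow> complex" and G :: "'p \<Rightarrow> complex ^ 'n \<Rightarrow> complex ^ 'n option"
  assumes patch: "patch F E U B D R v w0 \<phi>" and F: "hol_fun F U" "open U" and P: "finite P"
    and W: "\<And>p. p \<in> P \<Longrightarrow> open (W p)" and S: "\<And>p. p \<in> P \<Longrightarrow> S p \<in> sets borel" "\<And>p. p \<in> P \<Longrightarrow> S p \<subseteq> W p"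
    and G: "\<And>p. p \<in> P \<Longrightarrow> hol_map (G p) (W p)" "\<And>p z. p \<in> P \<Longrightarrow> z \<in> W p \<Longrightarrow> F (G p z) = s"
    and injW: "\<And>p. p \<in> P \<Longrightarrow> inj_on (G p) (W p)"
    and inj: "\<And>p q z w. p \<in> P \<Longrightarrow> q \<in> P \<Longrightarrow> z \<in> S p \<Longrightarrow> w \<in> S q \<Longrightarrow> G p z = G q w \<Longrightarrow> p = q"
    and h: "\<And>p z. p \<in> P \<Longrightarrow> z \<in> W p \<Longrightarrow> E (G p z) * det (cons_col v (cjacobian (G p) z)) = dirv F v (G p z) * h p z"
  shows "(\<Sum>p\<in>P. \<integral>\<^sup>+ z\<in>S p \<inter> {z \<in> W p. G p z \<in> D}. ennreal ((cmod (h p z))\<^sup>2) \<partial>lborel) \<le> 2 * (\<integral>\<^sup>+ w. \<phi> w \<partial>lborel)"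
proof -
  have B: "open B" "B \<subseteq> U" and D: "D \<in> sets borel" "D \<subseteq> B" and R: "invertible R" "R *v v = axis None 1"
    and nz: "\<And>z. z \<in> D \<Longrightarrow> dirv F v z \<noteq> 0"
    and m2: "\<And>s w. finite {z\<in>B. F z = s \<and> proj R z = w}" "\<And>s w. card {z\<in>B. F z = s \<and> proj R z = w} \<le> 2"
    and \<phi>: "\<phi> \<in> borel_measurable borel" "\<And>w. 0 \<le> \<phi> w" "(\<integral>\<^sup>+ w. \<phi> w \<partial>lborel) < \<infinity>"
    and bd: "\<And>z. z \<in> D \<Longrightarrow> proj R z \<noteq> w0 \<Longrightarrow> (cmod (E z))\<^sup>2 / ((cmod (det R))\<^sup>2 * (cmod (dirv F v z))\<^sup>2) \<le> \<phi> (proj R z)"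
    using patch unfolding patch_def by blast+
  have dR: "det R \<noteq> 0" using R(1) by (simp add: invertible_det_nz)
  define val where "val z = (cmod (E z))\<^sup>2 / ((cmod (det R))\<^sup>2 * (cmod (dirv F v z))\<^sup>2)" for z
  have val0: "0 \<le> val z" for z by (simp add: val_def)
  \<comment> \<open>The bound by \<open>\<phi>\<close> is not assumed over \<open>w0\<close>. The
    level set has at most two points there, so enlarging the majorant at this single point restores
    domination without changing the integral.\<close>
  define S0 where "S0 = {z\<in>B. F z = s \<and> proj R z = w0}"
  define \<phi>' where "\<phi>' w = (if w = w0 then sum val S0 else \<phi> w)" for w
  have \<phi>'m: "\<phi>' \<in> borel_measurable borel" unfolding \<phi>'_def using \<phi>(1) by measurable
  have \<phi>'0: "0 \<le> \<phi>' w" for w unfolding \<phi>'_def using \<phi>(2) val0 by (simp add: sum_nonneg)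
  have "AE w in lborel. w \<noteq> w0" by (rule AE_lborel_singleton)
  then have "AE w in lborel. ennreal (\<phi>' w) = ennreal (\<phi> w)"
    by eventually_elim (simp add: \<phi>'_def)
  then have int: "(\<integral>\<^sup>+ w. \<phi>' w \<partial>lborel) = (\<integral>\<^sup>+ w. \<phi> w \<partial>lborel)"
    by (rule nn_integral_cong_AE)
  have bd': "val z \<le> \<phi>' (proj R z)" if z: "z \<in> D" "F z = s" for z
  proof (cases "proj R z = w0")
    case True
    then have "z \<in> S0" using z D by (auto simp: S0_def)
    then have "val z \<le> sum val S0" using m2(1) val0 by (intro member_le_sum) (auto simp: S0_def)
    then show ?thesis using True by (simp add: \<phi>'_def)
  next
    case False then show ?thesis using bd[OF z(1)] by (simp add: \<phi>'_def val_def)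
  qed
  define T where "T p z = proj R (G p z)" for p z
  \<comment> \<open>On this open set the projection is a local injection: \<open>dirv F v\<close> is
    nonzero there and nearly constant on small balls.\<close>
  define N where "N p = {z \<in> W p. G p z \<in> {y \<in> B. dirv F v y \<noteq> 0}}" for p
  have oB: "open {y \<in> B. dirv F v y \<noteq> 0}"
    by (rule open_nonzero[OF hol_fun_continuous_on[OF hol_fun_subset[OF hol_fun_dirv[OF F] B(2)]] B(1)])
  have cG: "continuous_on (W p) (G p)" if "p \<in> P" for p using hol_map_continuous_on[OF G(1)[OF that]] .
  have oN: "open (N p)" if p: "p \<in> P" for p
    using continuous_open_preimage[OF cG[OF p] W[OF p] oB] by (simp add: N_def vimage_def Int_def)
  have NW: "N p \<subseteq> W p" for p by (auto simp: N_def)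
  have SD: "S p \<inter> {z \<in> W p. G p z \<in> D} \<subseteq> N p" for p using D nz by (auto simp: N_def)
  have T: "hol_map (T p) (N p)" if "p \<in> P" for p
    unfolding T_def by (rule hol_map_proj[OF hol_map_subset[OF G(1)[OF that] NW]])
  have detT: "det (cjacobian (T p) z) = det R * det (cons_col v (cjacobian (G p) z))" if "p \<in> P" "z \<in> W p" for p z
    unfolding T_def cjacobian_proj[OF G(1)[OF that(1)] that(2)] det_cons_col[OF R(2)] ..
  have "(\<Sum>p\<in>P. \<integral>\<^sup>+ z\<in>S p \<inter> {z \<in> W p. G p z \<in> D}. ennreal ((cmod (h p z))\<^sup>2) \<partial>lborel) \<le> of_nat 2 * (\<integral>\<^sup>+ w. \<phi>' w \<partial>lborel)"
  proof (rule sum_nn_integral_image_multiplicity[where U = N and T = T and J = "\<lambda>p. cjacobian (T p)"])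
    fix p assume p: "p \<in> P"
    show "S p \<inter> {z \<in> W p. G p z \<in> D} \<in> sets borel"
    proof -
      have "(\<lambda>z. if z \<in> W p then G p z else 0) \<in> borel_measurable borel"
        by (rule borel_measurable_continuous_on_if) (use W[OF p] cG[OF p] in auto)
      from measurable_sets[OF this D(1)]
      have "((\<lambda>z. if z \<in> W p then G p z else 0) -` D) \<in> sets borel" by simp
      moreover have "S p \<inter> {z \<in> W p. G p z \<in> D} = S p \<inter> W p \<inter> ((\<lambda>z. if z \<in> W p then G p z else 0) -` D)" by auto
      ultimately show ?thesis using S(1)[OF p] W[OF p] by simp
    qed
    show "continuous_on (N p) (\<lambda>z. det (cjacobian (T p) z))"
      by (rule hol_fun_continuous_on[OF hol_fun_det_cjacobian[OF T[OF p] oN[OF p]]])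
  next
    fix p z assume p: "p \<in> P" and z: "z \<in> N p"
    show "(T p has_derivative (*v) (cjacobian (T p) z)) (at z)"
      by (rule hol_map_has_derivative[OF T[OF p] z])
    define a where "a = dirv F v (G p z)"
    have y: "G p z \<in> B" "a \<noteq> 0" using z by (auto simp: N_def a_def)
    have cB: "continuous_on B (dirv F v)" by (rule hol_fun_continuous_on[OF hol_fun_subset[OF hol_fun_dirv[OF F] B(2)]])
    obtain e where e: "e > 0" "\<And>y. dist y (G p z) < e \<Longrightarrow> dist (dirv F v y) a < cmod a / 2 \<and> y \<in> B"
      using exists_ball_close[OF cB cB B(1) y(1), of "cmod a / 2" "cmod a / 2"] y(2) unfolding a_def by auto
    let ?V = "{z' \<in> W p. G p z' \<in> ball (G p z) e}"
    have "open ?V" using continuous_open_preimage[OF cG[OF p] W[OF p] open_ball] by (simp add: vimage_def Int_def)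
    moreover have "z \<in> ?V" using z e(1) NW by auto
    moreover have "inj_on (T p) (?V \<inter> N p)"
    proof (rule inj_onI)
      fix z1 z2 assume z12: "z1 \<in> ?V \<inter> N p" "z2 \<in> ?V \<inter> N p" "T p z1 = T p z2"
      obtain t where t: "G p z1 = G p z2 + t *s v"
        using proj_eq_imp_line[OF R] z12(3) unfolding T_def by metis
      have "t = 0"
      proof (rule dirv_injective_on_lines[OF F(1) convex_ball[of "G p z" e]])
        show "ball (G p z) e \<subseteq> U" using e(2) B(2) by (auto simp: dist_commute)
        show "cmod (dirv F v y - a) \<le> cmod a / 2" if "y \<in> ball (G p z) e" for y
          using e(2)[of y] that by (simp add: dist_norm norm_minus_commute)
        show "F (G p z2) = F (G p z2 + t *s v)" using G(2)[OF p] z12 t by (metis (no_types, lifting) Int_iff mem_Collect_eq)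
      qed (use y z12 t in auto)
      then have "G p z1 = G p z2" using t by simp
      then show "z1 = z2" using injW[OF p] z12 by (auto dest: inj_onD)
    qed
    ultimately show "\<exists>V. open V \<and> z \<in> V \<and> inj_on (T p) (V \<inter> N p)" by blast
  next
    fix p z assume p: "p \<in> P" and z: "z \<in> S p \<inter> {z \<in> W p. G p z \<in> D}"
    then have zW: "z \<in> W p" and zD: "G p z \<in> D" by auto
    have "(cmod (h p z))\<^sup>2 = (cmod (det (cjacobian (T p) z)))\<^sup>2 * val (G p z)"
    proof -
      have "h p z = E (G p z) * det (cons_col v (cjacobian (G p) z)) / dirv F v (G p z)"
        using h[OF p zW] nz[OF zD] by (simp add: field_simps)
      then show ?thesis using nz[OF zD] dR unfolding detT[OF p zW] val_def
        by (simp add: norm_mult norm_divide power_mult_distrib power_divide)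
    qed
    also have "\<dots> \<le> (cmod (det (cjacobian (T p) z)))\<^sup>2 * \<phi>' (T p z)"
      unfolding T_def by (intro mult_left_mono bd' zD G(2)[OF p zW]) simp
    finally show "ennreal ((cmod (h p z))\<^sup>2) \<le> ennreal ((cmod (det (cjacobian (T p) z)))\<^sup>2 * \<phi>' (T p z))"
      by (rule ennreal_leI)
  next
    fix w
    let ?X = "SIGMA p:P. {z \<in> S p \<inter> {z \<in> W p. G p z \<in> D}. T p z = w}"
    let ?Y = "{y\<in>B. F y = s \<and> proj R y = w}"
    let ?f = "\<lambda>(p, z). G p z"
    have i: "inj_on ?f ?X"
    proof (rule inj_onI)
      fix x y assume x: "x \<in> ?X" and y: "y \<in> ?X" and e: "?f x = ?f y"
      obtain p z where px: "x = (p, z)" by (cases x)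
      obtain q u where qy: "y = (q, u)" by (cases y)
      have pq: "p = q" using inj[of p q z u] x y e px qy by auto
      moreover have "z = u" using inj_onD[OF injW, of p z u] x y e px qy pq by auto
      ultimately show "x = y" using px qy by simp
    qed
    have sub: "?f ` ?X \<subseteq> ?Y"
    proof
      fix y assume "y \<in> ?f ` ?X"
      then obtain p z where "p \<in> P" "z \<in> W p" "G p z \<in> D" "T p z = w" "y = G p z" by auto
      then show "y \<in> ?Y" using G(2) D(2) by (auto simp: T_def)
    qed
    show "finite ?X" using inj_on_finite[OF i sub m2(1)] .
    show "card ?X \<le> 2" using card_inj_on_le[OF i sub m2(1)] m2(2) le_trans by blast
  next
    show "(\<integral>\<^sup>+ w. \<phi>' w \<partial>lborel) < \<infinity>" using int \<phi>(3) by simp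
  qed (use P oN SD \<phi>'m \<phi>'0 in auto)
  then show ?thesis using int by simp
qed

section \<open>Construction of patches at regular and at critical points\<close>

lemma norm_proj_bound: "\<exists>K>0. \<forall>z. norm (proj R z) \<le> K * norm z"
proof -
  obtain K where "K > 0" "\<And>z. norm (proj R z) \<le> K * norm z"
    using linear_bounded_pos[OF linear_proj[of R]] by blast
  then show ?thesis by blast
qed

lemma nn_integral_indicator_ball_finite:
  fixes a :: "'a::euclidean_space"
  assumes "0 \<le> C"
  shows "(\<integral>\<^sup>+ w. ennreal (C * indicator (ball a r) w) \<partial>lborel) < \<infinity>"
proof -
  have "(\<integral>\<^sup>+ w. ennreal (C * indicator (ball a r) w) \<partial>lborel) = (\<integral>\<^sup>+ w. ennreal C * indicator (ball a r) w \<partial>lborel)"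
    by (intro nn_integral_cong) (auto simp: indicator_def)
  also have "\<dots> = ennreal C * emeasure lborel (ball a r)" by (rule nn_integral_cmult_indicator) simp
  also have "\<dots> < \<infinity>" using emeasure_lborel_ball_finite[of a r] by (simp add: ennreal_mult_less_top)
  finally show ?thesis .
qed

lemma card_line_points:
  fixes F :: "complex ^ 'n::finite option \<Rightarrow> complex"
  assumes R: "invertible R" "R *v v = axis None 1"
    and no3: "\<And>z t u. z \<in> B \<Longrightarrow> z + t *s v \<in> B \<Longrightarrow> z + u *s v \<in> B \<Longrightarrow> F z = F (z + t *s v) \<Longrightarrow> F z = F (z + u *s v)
      \<Longrightarrow> t = 0 \<or> u = 0 \<or> t = u"
  shows "finite {z\<in>B. F z = s \<and> proj R z = w} \<and> card {z\<in>B. F z = s \<and> proj R z = w} \<le> 2"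
proof (rule finite_card_le_2I)
  fix x y z
  assume x: "x \<in> {z\<in>B. F z = s \<and> proj R z = w}" and y: "y \<in> {z\<in>B. F z = s \<and> proj R z = w}" and z: "z \<in> {z\<in>B. F z = s \<and> proj R z = w}"
  obtain t where t: "y = x + t *s v" by (rule proj_eq_imp_line[OF R, of y x]) (use x y in auto)
  obtain u where u: "z = x + u *s v" by (rule proj_eq_imp_line[OF R, of z x]) (use x z in auto)
  have "t = 0 \<or> u = 0 \<or> t = u" using no3[of x t u] x y z t u by auto
  then show "x = y \<or> y = z \<or> x = z" using t u by auto
qed

text \<open>A coordinate direction with nonzero derivative keeps \<open>dirv F v\<close> away from 0
  nearby, so a constant on a ball containing the projection is a majorant.\<close>

lemma exists_patches_regular:
  fixes F E :: "complex ^ 'n::finite option \<Rightarrow> complex"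
  assumes F: "hol_fun F U" and E: "hol_fun E U" and U: "open U" "p \<in> U" and reg: "cpartial i F p \<noteq> 0"
  shows "\<exists>B R v w0 \<phi>. p \<in> B \<and> patch F E U B B R v w0 \<phi>"
proof -
  define v :: "complex ^ 'n option" where "v = axis i 1"
  define a where "a = dirv F v p"
  have a0: "a \<noteq> 0" using reg by (simp add: a_def v_def dirv_axis)
  have "v \<noteq> 0" by (simp add: v_def axis_eq_0_iff)
  then obtain R :: "complex ^ 'n option ^ 'n option" where R: "invertible R" "R *v v = axis None 1"
    using exists_straightening by blast
  have dR: "det R \<noteq> 0" using R(1) by (simp add: invertible_det_nz)
  obtain e where e: "e > 0" "\<And>y. dist y p < e \<Longrightarrow> dist (dirv F v y) a < cmod a / 2 \<and> dist (E y) (E p) < 1 \<and> y \<in> U"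
    using exists_ball_close[OF hol_fun_continuous_on[OF hol_fun_dirv[OF F U(1), of v]] hol_fun_continuous_on[OF E] U,
      of "cmod a / 2" 1] a0 unfolding a_def by auto
  define B where "B = ball p e"
  have inB: "dist (dirv F v y) a < cmod a / 2" "dist (E y) (E p) < 1" "y \<in> U" if "y \<in> B" for y
    using e(2)[of y] that by (auto simp: B_def dist_commute)
  obtain L where L: "L > 0" "\<And>z. norm (proj R z) \<le> L * norm z" using norm_proj_bound by blast
  \<comment> \<open>On \<open>B\<close> the modulus of \<open>E\<close> is at most its value at
    \<open>p\<close> plus 1, and that of \<open>dirv F v\<close> at least half its value at
    \<open>p\<close>.\<close>
  define C where "C = (cmod (E p) + 1)\<^sup>2 / ((cmod (det R))\<^sup>2 * (cmod a / 2)\<^sup>2)"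
  define \<phi> where "\<phi> w = C * indicator (ball (proj R p) (L * e)) w" for w
  have inj: "t = 0" if "z \<in> B" "z + t *s v \<in> B" "F z = F (z + t *s v)" for z t
    by (rule dirv_injective_on_lines[OF F, of B]) (use inB that a0 in \<open>auto simp: B_def dist_norm less_imp_le\<close>)
  have big: "cmod a / 2 < cmod (dirv F v z)" if "z \<in> B" for z
  proof -
    have "cmod a \<le> cmod (dirv F v z) + cmod (dirv F v z - a)"
      by (metis norm_minus_commute norm_triangle_sub)
    then show ?thesis using inB(1)[OF that] by (simp add: dist_norm)
  qed
  have "patch F E U B B R v undefined \<phi>"
    unfolding patch_def
  proof (intro conjI allI ballI impI)
    show "finite {z\<in>B. F z = s \<and> proj R z = w}" "card {z\<in>B. F z = s \<and> proj R z = w} \<le> 2" for s w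
      using card_line_points[OF R, of B F s w] inj by blast+
    show "\<phi> \<in> borel_measurable borel" unfolding \<phi>_def
      by (intro borel_measurable_times borel_measurable_const borel_measurable_indicator) simp
    show "(\<integral>\<^sup>+ w. \<phi> w \<partial>lborel) < \<infinity>" unfolding \<phi>_def
      by (rule nn_integral_indicator_ball_finite) (simp add: C_def)
  next
    fix z assume z: "z \<in> B"
    show "dirv F v z \<noteq> 0" using big[OF z] a0 by auto
    have "norm (proj R z - proj R p) < L * e"
    proof -
      have "norm (proj R (z - p)) \<le> L * norm (z - p)" by (rule L(2))
      also have "\<dots> < L * e" using z L(1) by (simp add: B_def dist_norm norm_minus_commute)
      finally show ?thesis by (simp add: proj_diff)
    qed
    then have "\<phi> (proj R z) = C" by (simp add: \<phi>_def dist_norm norm_minus_commute)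
    moreover have "(cmod (E z))\<^sup>2 / ((cmod (det R))\<^sup>2 * (cmod (dirv F v z))\<^sup>2) \<le> C"
      unfolding C_def
    proof (intro frac_le mult_left_mono power_mono)
      have "cmod (E z) \<le> cmod (E p) + cmod (E z - E p)" by (metis norm_triangle_sub)
      then show "cmod (E z) \<le> cmod (E p) + 1" using inB(2)[OF z] by (simp add: dist_norm)
      show "cmod a / 2 \<le> cmod (dirv F v z)" using big[OF z] by simp
      show "0 < (cmod (det R))\<^sup>2 * (cmod a / 2)\<^sup>2" using dR a0 by simp
    qed auto
    ultimately show "(cmod (E z))\<^sup>2 / ((cmod (det R))\<^sup>2 * (cmod (dirv F v z))\<^sup>2) \<le> \<phi> (proj R z)" by simp
  qed (use R inB in \<open>auto simp: B_def \<phi>_def C_def\<close>)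
  moreover have "p \<in> B" using e(1) by (simp add: B_def)
  ultimately show ?thesis by blast
qed

lemma DIM_complex_vec: "DIM(complex ^ 'n::finite) = 2 * CARD('n)"
  by (simp add: DIM_complex)

text \<open>One patch for each anisotropic direction. The gradient grows at least linearly in
  \<open>z - p\<close> and some direction captures a fixed share of it, so the sets
  \<open>D v\<close> cover the punctured ball. Since \<open>proj\<close> is Lipschitz, the distance
  to \<open>p\<close> may be replaced by the distance of the projections.\<close>

lemma exists_patches_critical:
  fixes F E :: "complex ^ 'n::finite option \<Rightarrow> complex"
  assumes F: "hol_fun F U" and E: "hol_fun E U" and U: "open U" "p \<in> U"
    and crit: "\<And>i. cpartial i F p = 0" and inv: "invertible (chessian F p)" and dim: "CARD('n) \<ge> 2"
  shows "\<exists>B Q. open B \<and> p \<in> B \<and> B \<subseteq> U \<and> finite Q \<and>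
    (\<forall>(D, R, v, w0, \<phi>)\<in>Q. patch F E U B D R v w0 \<phi>) \<and> (\<forall>z\<in>B - {p}. \<exists>(D, R, v, w0, \<phi>)\<in>Q. z \<in> D)"
proof -
  obtain c e1 where c: "c > 0" and e1: "e1 > 0" "\<And>z. z \<in> ball p e1 \<Longrightarrow> c * norm (z - p) \<le> norm (\<chi> i. cpartial i F z)"
    using critical_gradient_bound[OF F U crit inv] by blast
  have sym: "chessian F p $ i $ j = chessian F p $ j $ i" for i j
    using cpartial_commute[OF F U] by (simp add: chessian_def)
  have "chessian F p \<noteq> 0"
  proof
    assume "chessian F p = 0"
    then have "row undefined (chessian F p) = 0" by (simp add: row_def vec_eq_iff)
    then have "det (chessian F p) = 0" by (rule det_zero_row)
    then show False using inv by (simp add: invertible_det_nz)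
  qed
  then obtain V c' where V: "finite V" "c' > 0" "\<And>v. v \<in> V \<Longrightarrow> qform (chessian F p) v \<noteq> 0"
    "\<And>a :: complex ^ 'n option. \<exists>v\<in>V. c' * norm a \<le> cmod (\<Sum>i\<in>UNIV. a $ i * v $ i)"
    using anisotropic_directions[of "chessian F p", OF sym] by blast
  have "\<forall>v. \<exists>R :: complex ^ 'n option ^ 'n option. v \<in> V \<longrightarrow> invertible R \<and> R *v v = axis None 1"
  proof
    fix v
    have "v \<noteq> 0" if "v \<in> V" using V(3)[OF that] by (auto simp: qform_def)
    then show "\<exists>R :: complex ^ 'n option ^ 'n option. v \<in> V \<longrightarrow> invertible R \<and> R *v v = axis None 1"
      using exists_straightening[of v] by blast
  qed
  from choice[OF this] obtain R :: "complex ^ 'n option \<Rightarrow> complex ^ 'n option ^ 'n option"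
    where R: "\<And>v. v \<in> V \<Longrightarrow> invertible (R v)" "\<And>v. v \<in> V \<Longrightarrow> R v *v v = axis None 1" by blast
  \<comment> \<open>The second derivative of \<open>F\<close> in direction \<open>v\<close>. The
    ball \<open>B\<close> below is small enough to keep it within a quarter of its value at
    \<open>p\<close>, the tolerance of \<open>no_three_on_line\<close>.\<close>
  let ?q = "\<lambda>v z. qform (chessian F z) v"
  have cq: "isCont (?q v) p" for v
  proof -
    have "continuous_on U (dirv (dirv F v) v)"
      by (intro hol_fun_continuous_on[OF hol_fun_dirv] hol_fun_dirv F U)
    then have "continuous_on U (?q v)" by (rule continuous_on_eq) (rule dirv_dirv[OF F U(1)])
    then show ?thesis using U by (simp add: continuous_on_eq_continuous_at)
  qed
  have "\<forall>\<^sub>F z in nhds p. \<forall>v\<in>V. dist (?q v z) (?q v p) < cmod (?q v p) / 4"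
  proof (rule eventually_ball_finite[OF V(1)], rule ballI)
    fix v assume "v \<in> V"
    have "(?q v \<longlongrightarrow> ?q v p) (nhds p)" using cq[of v] tendsto_at_iff_tendsto_nhds[of "?q v" p] by (simp add: isCont_def)
    then show "\<forall>\<^sub>F z in nhds p. dist (?q v z) (?q v p) < cmod (?q v p) / 4"
      by (rule tendstoD) (use V(3)[OF \<open>v \<in> V\<close>] in simp)
  qed
  moreover have "\<forall>\<^sub>F y in nhds p. dist (E y) (E p) < 1"
    using exists_ball_close[OF hol_fun_continuous_on[OF E] hol_fun_continuous_on[OF E] U, of 1 1]
    unfolding eventually_nhds_metric by auto
  moreover have "\<forall>\<^sub>F y in nhds p. y \<in> U \<inter> ball p e1" using U e1(1) by (intro eventually_nhds_in_open) auto
  ultimately have "\<forall>\<^sub>F z in nhds p. (\<forall>v\<in>V. dist (?q v z) (?q v p) < cmod (?q v p) / 4) \<and> dist (E z) (E p) < 1 \<and> z \<in> U \<inter> ball p e1"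
    by (intro eventually_conj)
  then obtain e where e: "e > 0" "\<And>z. dist z p < e \<Longrightarrow> (\<forall>v\<in>V. dist (?q v z) (?q v p) < cmod (?q v p) / 4) \<and> dist (E z) (E p) < 1 \<and> z \<in> U \<inter> ball p e1"
    unfolding eventually_nhds_metric by blast
  define B where "B = ball p e"
  have inB: "v \<in> V \<Longrightarrow> dist (?q v z) (?q v p) < cmod (?q v p) / 4" "dist (E z) (E p) < 1" "z \<in> U" "z \<in> ball p e1" if "z \<in> B" for z v
    using e(2)[of z] that by (auto simp: B_def dist_commute)
  define \<kappa> where "\<kappa> = c' * c"
  have \<kappa>: "\<kappa> > 0" using c V(2) by (simp add: \<kappa>_def)
  \<comment> \<open>The points where direction \<open>v\<close> realizes the guaranteed growth
    \<open>\<kappa> * norm (z - p)\<close> of the derivative; the constant combines the share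
    \<open>c'\<close> with the gradient bound \<open>c\<close>.\<close>
  define D where "D v = {z \<in> B - {p}. \<kappa> * norm (z - p) - cmod (dirv F v z) \<in> {..0}}" for v
  have D: "z \<in> D v \<longleftrightarrow> z \<in> B \<and> z \<noteq> p \<and> \<kappa> * norm (z - p) \<le> cmod (dirv F v z)" for z v by (auto simp: D_def)
  have BU: "B \<subseteq> U" using inB(3) by blast
  define L where "L v = (SOME K. K > 0 \<and> (\<forall>z. norm (proj (R v) z) \<le> K * norm z))" for v
  have L: "L v > 0 \<and> (\<forall>z. norm (proj (R v) z) \<le> L v * norm z)" for v
    unfolding L_def by (rule someI_ex) (rule norm_proj_bound)
  \<comment> \<open>With \<open>d\<close> the distance of the projections,
    \<open>norm (z - p)\<close> is at least \<open>d / L v\<close>, so the derivative is at least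
    \<open>\<kappa> * d / L v\<close>; collecting the constants leaves
    \<open>C v / d\<^sup>2\<close>.\<close>
  define C where "C v = (cmod (E p) + 1)\<^sup>2 * (L v)\<^sup>2 / ((cmod (det (R v)))\<^sup>2 * \<kappa>\<^sup>2)" for v
  define \<phi> where "\<phi> v w = C v * (1 / (norm (w - proj (R v) p))\<^sup>2 * indicator (ball (proj (R v) p) (L v * e)) w)" for v w
  have C0: "0 \<le> C v" for v by (simp add: C_def)
  have patch: "patch F E U B (D v) (R v) v (proj (R v) p) (\<phi> v)" if v: "v \<in> V" for v
    unfolding patch_def
  proof (intro conjI allI ballI impI)
    have "continuous_on (B - {p}) (\<lambda>z. \<kappa> * norm (z - p) - cmod (dirv F v z))"
      by (intro continuous_intros continuous_on_subset[OF hol_fun_continuous_on[OF hol_fun_dirv[OF F U(1)]]]) (use BU in auto)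
    moreover have "open (B - {p})" by (simp add: B_def open_delete)
    ultimately have "open {z \<in> B - {p}. \<kappa> * norm (z - p) - cmod (dirv F v z) \<in> {0<..}}"
      using continuous_open_preimage[of "B - {p}" "\<lambda>z. \<kappa> * norm (z - p) - cmod (dirv F v z)" "{0<..}"]
      by (simp add: vimage_def Int_def)
    moreover have "D v = (B - {p}) - {z \<in> B - {p}. \<kappa> * norm (z - p) - cmod (dirv F v z) \<in> {0<..}}" by (auto simp: D_def)
    ultimately show "D v \<in> sets borel" using \<open>open (B - {p})\<close> by (simp only: sets.Diff borel_open)
    show "finite {z\<in>B. F z = s \<and> proj (R v) z = w}" "card {z\<in>B. F z = s \<and> proj (R v) z = w} \<le> 2" for s w
    proof -
      have "t = 0 \<or> u = 0 \<or> t = u" if "z \<in> B" "z + t *s v \<in> B" "z + u *s v \<in> B" "F z = F (z + t *s v)" "F z = F (z + u *s v)" for z t u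
        by (rule no_three_on_line[OF F U(1) _ BU _ V(3)[OF v] that])
           (use inB(1)[OF _ v] in \<open>auto simp: B_def dist_norm less_imp_le\<close>)
      then show "finite {z\<in>B. F z = s \<and> proj (R v) z = w}" "card {z\<in>B. F z = s \<and> proj (R v) z = w} \<le> 2"
        using card_line_points[OF R[OF v], of B F s w] by blast+
    qed
    show "\<phi> v \<in> borel_measurable borel" unfolding \<phi>_def
    proof (intro borel_measurable_times borel_measurable_const borel_measurable_indicator)
      show "(\<lambda>w. 1 / (norm (w - proj (R v) p))\<^sup>2) \<in> borel_measurable borel" by measurable
    qed simp
    show "(\<integral>\<^sup>+ w. \<phi> v w \<partial>lborel) < \<infinity>"
    proof -
      have m: "(\<lambda>w. ennreal (1 / (norm (w - proj (R v) p))\<^sup>2) * indicator (ball (proj (R v) p) (L v * e)) w) \<in> borel_measurable lborel"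
        by (intro borel_measurable_times_ennreal borel_measurable_indicator) measurable
      have "(\<integral>\<^sup>+ w. \<phi> v w \<partial>lborel) = (\<integral>\<^sup>+ w. ennreal (C v) * (ennreal (1 / (norm (w - proj (R v) p))\<^sup>2) * indicator (ball (proj (R v) p) (L v * e)) w) \<partial>lborel)"
        unfolding \<phi>_def by (intro nn_integral_cong) (auto simp: indicator_def C0 simp flip: ennreal_mult)
      also have "\<dots> = ennreal (C v) * (\<integral>\<^sup>+ w\<in>ball (proj (R v) p) (L v * e). ennreal (1 / (norm (w - proj (R v) p))\<^sup>2) \<partial>lborel)"
        by (rule nn_integral_cmult[OF m])
      also have "\<dots> < \<infinity>"
      proof -
        \<comment> \<open>The projected space has real dimension \<open>2 * CARD('n)\<close>, at
          least 4, so the inverse square is integrable.\<close>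
        have "(\<integral>\<^sup>+ w\<in>ball (proj (R v) p) (L v * e). ennreal (1 / (norm (w - proj (R v) p))\<^sup>2) \<partial>lborel) < \<infinity>"
          by (rule nn_integral_inverse_square_ball) (use dim L[of v] e(1) in \<open>simp_all add: DIM_complex_vec\<close>)
        then show ?thesis by (simp add: ennreal_mult_less_top)
      qed
      finally show ?thesis .
    qed
  next
    fix z assume z: "z \<in> D v"
    have zp: "0 < norm (z - p)" using z D by auto
    then show "dirv F v z \<noteq> 0" using z D[of z v] \<kappa> by (metis mult_pos_pos norm_zero not_le)
    assume ne: "proj (R v) z \<noteq> proj (R v) p"
    define d where "d = norm (proj (R v) z - proj (R v) p)"
    have "d = norm (proj (R v) (z - p))" by (simp add: d_def proj_diff)
    then have d: "0 < d" "d \<le> L v * norm (z - p)" using ne L[of v] by (auto simp: d_def)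
    have "d < L v * e"
    proof -
      have "norm (z - p) < e" using z D[of z v] by (simp add: B_def dist_norm norm_minus_commute)
      then have "L v * norm (z - p) < L v * e" using L[of v] by simp
      then show ?thesis using d(2) by linarith
    qed
    then have \<phi>z: "\<phi> v (proj (R v) z) = C v / d\<^sup>2" by (simp add: \<phi>_def d_def dist_norm norm_minus_commute)
    have dR: "det (R v) \<noteq> 0" using R(1)[OF v] by (simp add: invertible_det_nz)
    have "\<kappa> * (d / L v) \<le> cmod (dirv F v z)"
    proof -
      have "d / L v \<le> norm (z - p)" using d L[of v] by (simp add: pos_divide_le_eq mult.commute)
      then have "\<kappa> * (d / L v) \<le> \<kappa> * norm (z - p)" by (rule mult_left_mono) (use \<kappa> in simp)
      then show ?thesis using z D[of z v] by linarith
    qed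
    then have "(cmod (E z))\<^sup>2 / ((cmod (det (R v)))\<^sup>2 * (cmod (dirv F v z))\<^sup>2)
        \<le> (cmod (E p) + 1)\<^sup>2 / ((cmod (det (R v)))\<^sup>2 * (\<kappa> * (d / L v))\<^sup>2)"
    proof (intro frac_le mult_left_mono power_mono)
      have "cmod (E z) \<le> cmod (E p) + cmod (E z - E p)" by (metis norm_triangle_sub)
      then show "cmod (E z) \<le> cmod (E p) + 1" using inB(2)[of z] z D[of z v] by (simp add: dist_norm)
      show "0 < (cmod (det (R v)))\<^sup>2 * (\<kappa> * (d / L v))\<^sup>2" using dR \<kappa> d L[of v] by simp
    qed (use \<kappa> d L[of v] in auto)
    also have "\<dots> = C v / d\<^sup>2" using L[of v] d(1) by (simp add: C_def power_mult_distrib power_divide field_simps)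
    finally show "(cmod (E z))\<^sup>2 / ((cmod (det (R v)))\<^sup>2 * (cmod (dirv F v z))\<^sup>2) \<le> \<phi> v (proj (R v) z)"
      by (simp add: \<phi>z)
  qed (use R[OF v] BU C0 in \<open>auto simp: B_def D \<phi>_def\<close>)
  have cover: "\<exists>v\<in>V. z \<in> D v" if z: "z \<in> B - {p}" for z
  proof -
    obtain v where v: "v \<in> V" "c' * norm (\<chi> i. cpartial i F z) \<le> cmod (\<Sum>i\<in>UNIV. (\<chi> i. cpartial i F z) $ i * v $ i)"
      using V(4) by blast
    have "\<kappa> * norm (z - p) \<le> c' * norm (\<chi> i. cpartial i F z)"
      using e1(2)[of z] inB(4)[of z] z V(2) by (simp add: \<kappa>_def mult.assoc)
    then have "z \<in> D v" using v(2) z by (simp add: D dirv_def)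
    then show ?thesis using v(1) by blast
  qed
  show ?thesis
    by (rule exI[of _ B], rule exI[of _ "(\<lambda>v. (D v, R v, v, proj (R v) p, \<phi> v)) ` V"])
       (use BU V(1) patch cover e(1) in \<open>auto simp: B_def\<close>)
qed

subsection \<open>Fibres of a degeneration\<close>

lemma det_cons_col_add:
  fixes G :: "complex ^ 'n::finite ^ 'n option"
  shows "det (cons_col (v + w) G) = det (cons_col v G) + det (cons_col w G)"
proof -
  have t: "transpose (cons_col v G) = (\<chi> i. if i = None then v else (\<chi> j. G $ j $ the i))" for v :: "complex ^ 'n option"
    by (auto simp: vec_eq_iff transpose_def cons_col_def split: option.split)
  show ?thesis
    unfolding det_transpose[of "cons_col _ G", symmetric] t
    by (rule det_row_add[of None "\<lambda>_. v" "\<lambda>_. w"])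
qed

lemma det_cons_col_smult:
  fixes G :: "complex ^ 'n::finite ^ 'n option"
  shows "det (cons_col (c *s v) G) = c * det (cons_col v G)"
proof -
  have t: "transpose (cons_col v G) = (\<chi> i. if i = None then v else (\<chi> j. G $ j $ the i))" for v :: "complex ^ 'n option"
    by (auto simp: vec_eq_iff transpose_def cons_col_def split: option.split)
  show ?thesis
    unfolding det_transpose[of "cons_col _ G", symmetric] t
    by (rule det_row_mul[of None c "\<lambda>_. v"])
qed

text \<open>If a covector \<open>a\<close> annihilates the columns of \<open>G\<close> and \<open>u\<close>, it is a left null vector of the
  square matrix \<open>cons_col u G\<close>; so the determinant depends on its first column only through \<open>a\<close>.\<close>

lemma det_cons_col_proportional:
  fixes G :: "complex ^ 'n::finite ^ 'n option"
  assumes aG: "\<And>k. (\<Sum>i\<in>UNIV. a $ i * G $ i $ k) = 0" and av: "(\<Sum>i\<in>UNIV. a $ i * v $ i) \<noteq> 0"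
  shows "det (cons_col w G) = (\<Sum>i\<in>UNIV. a $ i * w $ i) * (det (cons_col v G) / (\<Sum>i\<in>UNIV. a $ i * v $ i))"
proof -
  let ?a = "\<lambda>w. \<Sum>i\<in>UNIV. a $ i * w $ i"
  have null: "det (cons_col u G) = 0" if u: "?a u = 0" for u
  proof -
    have "(transpose (cons_col u G) *v a) $ j = 0" for j
      using aG u by (cases j) (simp_all add: matrix_vector_mult_def transpose_def cons_col_def mult.commute)
    then have "transpose (cons_col u G) *v a = transpose (cons_col u G) *v 0" by (simp add: vec_eq_iff)
    moreover have "a \<noteq> 0" using av by auto
    ultimately have "\<not> inj ((*v) (transpose (cons_col u G)))" by (meson injD)
    then have "\<not> invertible (transpose (cons_col u G))"
      by (simp add: invertible_left_inverse matrix_left_invertible_injective)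
    then show ?thesis by (simp add: invertible_det_nz)
  qed
  define t where "t = ?a w / ?a v"
  have "?a (w + (- t) *s v) = ?a w - t * ?a v"
    by (simp add: right_diff_distrib sum_subtractf sum_distrib_left mult.left_commute)
  also have "\<dots> = 0" using av by (simp add: t_def)
  finally have "det (cons_col (w + (- t) *s v) G) = 0" by (rule null)
  then have "det (cons_col w G) = t * det (cons_col v G)"
    by (simp only: det_cons_col_add det_cons_col_smult) simp
  then show ?thesis by (simp add: t_def)
qed

section \<open>Charts of the total space and of its fibres\<close>

lemma topological_chartD:
  assumes "topological_chart X c"
  shows "openin X (fst c)" "open (snd c ` fst c)" "inj_on (snd c) (fst c)" "fst c \<subseteq> topspace X"
    "\<And>x. x \<in> fst c \<Longrightarrow> chart_inv c (snd c x) = x"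
    "\<And>z. z \<in> snd c ` fst c \<Longrightarrow> chart_inv c z \<in> fst c" "\<And>z. z \<in> snd c ` fst c \<Longrightarrow> snd c (chart_inv c z) = z"
proof -
  show 1: "openin X (fst c)" "open (snd c ` fst c)" using assms by (auto simp: topological_chart_def)
  show 2: "fst c \<subseteq> topspace X" using 1(1) by (rule openin_subset)
  have "homeomorphic_map (subtopology X (fst c)) (top_of_set (snd c ` fst c)) (snd c)"
    using assms by (auto simp: topological_chart_def)
  from homeomorphic_imp_injective_map[OF this] show 3: "inj_on (snd c) (fst c)"
    by (simp only: topspace_subtopology_subset[OF 2])
  show "chart_inv c (snd c x) = x" if "x \<in> fst c" for x
    unfolding chart_inv_def by (rule inv_into_f_f[OF 3 that])
  show "chart_inv c z \<in> fst c" if "z \<in> snd c ` fst c" for z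
    unfolding chart_inv_def by (rule inv_into_into[OF that])
  show "snd c (chart_inv c z) = z" if "z \<in> snd c ` fst c" for z
    unfolding chart_inv_def by (rule f_inv_into_f[OF that])
qed

lemma topological_chart_open_image:
  assumes c: "topological_chart X c" and W: "openin X W"
  shows "open (snd c ` (fst c \<inter> W))"
proof -
  have h: "homeomorphic_map (subtopology X (fst c)) (top_of_set (snd c ` fst c)) (snd c)"
    using c by (auto simp: topological_chart_def)
  have "openin (subtopology X (fst c)) (fst c \<inter> W)"
    using W by (auto simp: openin_subtopology)
  with homeomorphic_imp_open_map[OF h] have "openin (top_of_set (snd c ` fst c)) (snd c ` (fst c \<inter> W))"
    by (simp add: open_map_def)
  then show ?thesis using topological_chartD(2)[OF c] by (metis openin_open_trans)
qed

lemma topological_chart_open_preimage: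
  assumes c: "topological_chart X c" and V: "open V"
  shows "openin X {x \<in> fst c. snd c x \<in> V}"
proof -
  have h: "homeomorphic_map (subtopology X (fst c)) (top_of_set (snd c ` fst c)) (snd c)"
    using c by (auto simp: topological_chart_def)
  have "openin (top_of_set (snd c ` fst c)) (snd c ` fst c \<inter> V)" using V by (metis openin_open_Int)
  from openin_continuous_map_preimage[OF homeomorphic_imp_continuous_map[OF h] this]
  have "openin (subtopology X (fst c)) {x \<in> fst c. snd c x \<in> V}"
    by (simp only: topspace_subtopology_subset[OF topological_chartD(4)[OF c]])
       (elim back_subst[of "openin _"], auto)
  then show ?thesis using topological_chartD(1)[OF c] by (metis openin_trans_full)
qed

lemma openin_hol_fun_on_preimage:
  assumes m: "complex_manifold X A" and f: "hol_fun_on A f (topspace X)" and V: "open V"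
  shows "openin X {x \<in> topspace X. f x \<in> V}"
proof -
  have tc: "topological_chart X c" if "c \<in> A" for c using m that by (simp add: complex_manifold_def)
  have "{x \<in> topspace X. f x \<in> V} = (\<Union>c\<in>A. {x \<in> fst c. snd c x \<in> {z \<in> snd c ` fst c. (f \<circ> chart_inv c) z \<in> V}})"
    (is "?L = ?R")
  proof
    show "?L \<subseteq> ?R"
    proof
      fix x assume x: "x \<in> ?L"
      then have "x \<in> (\<Union>c\<in>A. fst c)" using m by (simp add: complex_manifold_def)
      then obtain c where c: "c \<in> A" "x \<in> fst c" by blast
      then show "x \<in> ?R" using x topological_chartD(5)[OF tc[OF c(1)] c(2)] by auto
    qed
    show "?R \<subseteq> ?L" using topological_chartD(4,5)[OF tc] by fastforce
  qed
  moreover have "openin X {x \<in> fst c. snd c x \<in> {z \<in> snd c ` fst c. (f \<circ> chart_inv c) z \<in> V}}" if c: "c \<in> A" for c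
  proof (rule topological_chart_open_preimage[OF tc[OF c]])
    have "hol_fun (f \<circ> chart_inv c) (snd c ` fst c)"
      using f c topological_chartD(4)[OF tc[OF c]] unfolding hol_fun_on_def by (metis inf.absorb1)
    from continuous_open_preimage[OF hol_fun_continuous_on[OF this] topological_chartD(2)[OF tc[OF c]] V]
    show "open {z \<in> snd c ` fst c. (f \<circ> chart_inv c) z \<in> V}" by (simp add: vimage_def Int_def)
  qed
  ultimately show ?thesis by auto
qed

text \<open>The locale fixes a section over \<open>V\<close>; that it is a frame enters when its
  nonvanishing at a regular point of the special fibre is proved.\<close>

locale degeneration_family =
  fixes X :: "'a topology" and A :: "('a, 'n::finite option) chart set" and f :: "'a \<Rightarrow> complex" and r :: real
    and V :: "complex set" and \<eta> :: "('a, 'n option) chart \<Rightarrow> 'a \<Rightarrow> complex"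
  assumes deg: "degeneration X A f r" and V: "open V" "0 \<in> V"
    and sec: "canonical_section A {x \<in> topspace X. f x \<in> V} \<eta>"
begin

lemma manifold: "complex_manifold X A" and hol_f: "hol_fun_on A f (topspace X)" and r_pos: "0 < r"
  and proper: "proper_map X (top_of_set (ball 0 r)) f"
  and noncritical: "\<And>x. x \<in> topspace X \<Longrightarrow> f x \<noteq> 0 \<Longrightarrow> \<not> critical_point A f x"
  using deg by (auto simp: degeneration_def)

abbreviation XV where "XV \<equiv> {x \<in> topspace X. f x \<in> V}"

lemma chart: "c \<in> A \<Longrightarrow> topological_chart X c"
  using manifold by (simp add: complex_manifold_def)

lemmas chartD = topological_chartD[OF chart]

lemma open_XV: "openin X XV"
  by (rule openin_hol_fun_on_preimage[OF manifold hol_f V(1)])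

lemma hol_f_chart: "c \<in> A \<Longrightarrow> hol_fun (f \<circ> chart_inv c) (snd c ` fst c)"
  using hol_f chartD(4) unfolding hol_fun_on_def by (metis inf.absorb1)

lemma hol_sec_chart: "c \<in> A \<Longrightarrow> hol_fun (\<eta> c \<circ> chart_inv c) (snd c ` (fst c \<inter> XV))"
  using sec by (simp add: canonical_section_def)

lemma open_chart_XV: "c \<in> A \<Longrightarrow> open (snd c ` (fst c \<inter> XV))"
  by (rule topological_chart_open_image[OF chart open_XV])

lemma transition: "c \<in> A \<Longrightarrow> d \<in> A \<Longrightarrow> hol_map (snd d \<circ> chart_inv c) (snd c ` (fst c \<inter> fst d))"
  using manifold by (simp add: complex_manifold_def)

lemma open_overlap: "c \<in> A \<Longrightarrow> d \<in> A \<Longrightarrow> open (snd c ` (fst c \<inter> fst d))"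
  by (rule topological_chart_open_image[OF chart chartD(1)])

lemma cpartial_transition:
  assumes c: "c \<in> A" "x \<in> fst c" and d: "d \<in> A" "x \<in> fst d"
  shows "cpartial j (f \<circ> chart_inv c) (snd c x) =
    (\<Sum>i\<in>UNIV. cpartial i (f \<circ> chart_inv d) (snd d x) * cjacobian (snd d \<circ> chart_inv c) (snd c x) $ i $ j)"
proof -
  let ?W = "snd c ` (fst c \<inter> fst d)" and ?g = "snd d \<circ> chart_inv c" and ?F = "f \<circ> chart_inv d"
  have x: "snd c x \<in> ?W" using c d by blast
  have gx: "?g (snd c x) = snd d x" using chartD(5)[OF c] by simp
  have F: "(?F has_derivative (\<lambda>v. \<Sum>i\<in>UNIV. cpartial i ?F (snd d x) * v $ i)) (at (?g (snd c x)))"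
    unfolding gx by (rule hol_fun_has_derivative[OF hol_f_chart[OF d(1)]]) (use d in blast)
  have "((\<lambda>z. ?F (?g z)) has_derivative (\<lambda>v. \<Sum>j\<in>UNIV. (\<Sum>i\<in>UNIV. cpartial i ?F (snd d x) * cjacobian ?g (snd c x) $ i $ j) * v $ j)) (at (snd c x))"
    by (rule has_derivative_compose_hol[OF transition[OF c(1) d(1)] x F])
  then have "((f \<circ> chart_inv c) has_derivative (\<lambda>v. \<Sum>j\<in>UNIV. (\<Sum>i\<in>UNIV. cpartial i ?F (snd d x) * cjacobian ?g (snd c x) $ i $ j) * v $ j)) (at (snd c x))"
    by (rule has_derivative_transform_within_open[OF _ open_overlap[OF c(1) d(1)] x])
       (use chartD(5)[OF c(1)] chartD(5)[OF d(1)] in auto)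
  then show ?thesis by (rule cpartial_unique)
qed

text \<open>The definition quantifies over all charts; the chain rule for coordinate changes lets
  one chart decide.\<close>

lemma critical_point_chart:
  assumes c: "c \<in> A" "x \<in> fst c"
  shows "critical_point A f x \<longleftrightarrow> (\<forall>i. cpartial i (f \<circ> chart_inv c) (snd c x) = 0)"
proof
  assume "critical_point A f x"
  then show "\<forall>i. cpartial i (f \<circ> chart_inv c) (snd c x) = 0" using c by (simp add: critical_point_def)
next
  assume 0: "\<forall>i. cpartial i (f \<circ> chart_inv c) (snd c x) = 0"
  show "critical_point A f x"
    unfolding critical_point_def
  proof (intro ballI impI allI)
    fix d i assume d: "d \<in> A" "x \<in> fst d"
    show "cpartial i (f \<circ> chart_inv d) (snd d x) = 0"
      unfolding cpartial_transition[OF d c] using 0 by (intro sum.neutral) simp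
  qed
qed

lemma transition_jacobian_inverse:
  assumes c: "c \<in> A" "x \<in> fst c" and d: "d \<in> A" "x \<in> fst d"
  shows "cjacobian (snd c \<circ> chart_inv d) (snd d x) ** cjacobian (snd d \<circ> chart_inv c) (snd c x) = mat 1"
proof -
  let ?W = "snd c ` (fst c \<inter> fst d)" and ?g = "snd d \<circ> chart_inv c" and ?h = "snd c \<circ> chart_inv d"
  have x: "snd c x \<in> ?W" "snd d x \<in> snd d ` (fst d \<inter> fst c)" using c d by blast+
  have gx: "?g (snd c x) = snd d x" using chartD(5)[OF c] by simp
  have "cjacobian (\<lambda>z. ?h (?g z)) (snd c x) = cjacobian ?h (snd d x) ** cjacobian ?g (snd c x)"
    using cjacobian_compose[OF transition[OF c(1) d(1)] x(1) transition[OF d(1) c(1)]] x(2) gx by simp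
  moreover have "cjacobian (\<lambda>z. ?h (?g z)) (snd c x) = mat 1"
    by (rule cjacobian_eq_mat_1[OF open_overlap[OF c(1) d(1)] x(1)])
       (use chartD(5)[OF c(1)] chartD(5)[OF d(1)] in auto)
  ultimately show ?thesis by simp
qed

lemma fibre_chart: "d \<in> fibre_atlas X A f s \<Longrightarrow> topological_chart (subtopology X (fibre X f s)) d"
  by (simp add: fibre_atlas_def)

lemmas fibre_chartD = topological_chartD[OF fibre_chart]

lemma fibre_chart_fibre: "d \<in> fibre_atlas X A f s \<Longrightarrow> x \<in> fst d \<Longrightarrow> x \<in> topspace X \<and> f x = s"
  using fibre_chartD(4)[of d s] by (auto simp: fibre_def)

lemma open_fibre_overlap:
  assumes "d \<in> fibre_atlas X A f s" "c \<in> A"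
  shows "open (snd d ` (fst d \<inter> fst c))"
proof -
  have "openin (subtopology X (fibre X f s)) (fibre X f s \<inter> fst c)"
    using chartD(1)[OF assms(2)] by (metis inf_commute openin_subtopology_Int)
  from topological_chart_open_image[OF fibre_chart[OF assms(1)] this]
  have "open (snd d ` (fst d \<inter> (fibre X f s \<inter> fst c)))" .
  moreover have "fst d \<inter> (fibre X f s \<inter> fst c) = fst d \<inter> fst c"
    using fibre_chart_fibre[OF assms(1)] by (auto simp: fibre_def)
  ultimately show ?thesis by simp
qed

lemma fibre_immersion:
  assumes "d \<in> fibre_atlas X A f s" "c \<in> A"
  shows "hol_map (snd c \<circ> chart_inv d) (snd d ` (fst d \<inter> fst c))"
  using assms by (simp add: fibre_atlas_def)

text \<open>\<open>f\<close> is constant on the fibre, so its differential annihilates the columns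
  of the fibre Jacobian. This is the hypothesis on \<open>a\<close> in
  \<open>det_cons_col_proportional\<close>.\<close>

lemma f_constant_on_fibre_chart:
  assumes d: "d \<in> fibre_atlas X A f s" "x \<in> fst d" and c: "c \<in> A" "x \<in> fst c"
  shows "(\<Sum>i\<in>UNIV. cpartial i (f \<circ> chart_inv c) (snd c x) * cjacobian (snd c \<circ> chart_inv d) (snd d x) $ i $ k) = 0"
proof -
  let ?W = "snd d ` (fst d \<inter> fst c)" and ?g = "snd c \<circ> chart_inv d" and ?F = "f \<circ> chart_inv c"
  have x: "snd d x \<in> ?W" using c d by blast
  have gx: "?g (snd d x) = snd c x" using fibre_chartD(5)[OF d] by simp
  have F: "(?F has_derivative (\<lambda>v. \<Sum>i\<in>UNIV. cpartial i ?F (snd c x) * v $ i)) (at (?g (snd d x)))"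
    unfolding gx by (rule hol_fun_has_derivative[OF hol_f_chart[OF c(1)]]) (use c in blast)
  have 1: "((\<lambda>z. ?F (?g z)) has_derivative (\<lambda>v. \<Sum>j\<in>UNIV. (\<Sum>i\<in>UNIV. cpartial i ?F (snd c x) * cjacobian ?g (snd d x) $ i $ j) * v $ j)) (at (snd d x))"
    by (rule has_derivative_compose_hol[OF fibre_immersion[OF d(1) c(1)] x F])
  have "((\<lambda>z. s) has_derivative (\<lambda>v :: complex ^ 'n. \<Sum>j\<in>UNIV. 0 * v $ j)) (at (snd d x))" by simp
  then have 2: "((\<lambda>z. ?F (?g z)) has_derivative (\<lambda>v. \<Sum>j\<in>UNIV. 0 * v $ j)) (at (snd d x))"
    by (rule has_derivative_transform_within_open[OF _ open_fibre_overlap[OF d(1) c(1)] x])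
       (use chartD(5)[OF c(1)] fibre_chartD(5)[OF d(1)] fibre_chart_fibre[OF d(1)] in auto)
  show ?thesis using cpartial_unique[OF 1, of k] cpartial_unique[OF 2, of k] by simp
qed

text \<open>Justifies the definite description in \<open>fibre_form\<close>. Fibres over
  \<open>s \<noteq> 0\<close> have no critical points, so in some chart a direction with nonzero
  derivative fixes the value; \<open>det_cons_col_proportional\<close> extends the identity to all
  directions, and the transformation law of the section carries it to all charts.\<close>

lemma fibre_form_eq:
  assumes s: "s \<noteq> 0" "s \<in> V" and d: "d \<in> fibre_atlas X A f s" "x \<in> fst d" and c: "c \<in> A" "x \<in> fst c"
  shows "\<eta> c x * det (cons_col v (cjacobian (snd c \<circ> chart_inv d) (snd d x)))
       = dirv (f \<circ> chart_inv c) v (snd c x) * fibre_form A f \<eta> d x"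
proof -
  let ?J = "\<lambda>c. cjacobian (snd c \<circ> chart_inv d) (snd d x)"
  let ?a = "\<lambda>c. \<chi> i. cpartial i (f \<circ> chart_inv c) (snd c x)"
  define P where "P h \<longleftrightarrow> (\<forall>c\<in>A. x \<in> fst c \<longrightarrow> (\<forall>v. \<eta> c x * det (cons_col v (?J c)) = dirv (f \<circ> chart_inv c) v (snd c x) * h))" for h
  have xX: "x \<in> topspace X" "f x = s" using fibre_chart_fibre[OF d] by auto
  obtain c0 i0 where c0: "c0 \<in> A" "x \<in> fst c0" and i0: "cpartial i0 (f \<circ> chart_inv c0) (snd c0 x) \<noteq> 0"
    using noncritical[OF xX(1)] xX(2) s(1) by (auto simp: critical_point_def)
  define v0 :: "complex ^ 'n option" where "v0 = axis i0 1"
  have dv0: "dirv (f \<circ> chart_inv c0) v0 (snd c0 x) \<noteq> 0" using i0 by (simp add: v0_def dirv_axis)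
  define h where "h = \<eta> c0 x * (det (cons_col v0 (?J c0)) / dirv (f \<circ> chart_inv c0) v0 (snd c0 x))"
  have h0: "\<eta> c0 x * det (cons_col w (?J c0)) = dirv (f \<circ> chart_inv c0) w (snd c0 x) * h" for w
    using det_cons_col_proportional[of "?a c0" "?J c0" v0 w] f_constant_on_fibre_chart[OF d c0] dv0
    by (simp add: h_def dirv_def)
  have "P h"
    unfolding P_def
  proof (intro ballI impI allI)
    fix c v assume c: "c \<in> A" "x \<in> fst c"
    let ?M = "cjacobian (snd c \<circ> chart_inv c0) (snd c0 x)" and ?M' = "cjacobian (snd c0 \<circ> chart_inv c) (snd c x)"
    \<comment> \<open>The direction \<open>v\<close> of the chart \<open>c\<close>, expressed in the
      reference chart \<open>c0\<close>.\<close>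
    define w where "w = ?M' *v v"
    have "?M ** ?M' = mat 1" by (rule transition_jacobian_inverse[OF c c0])
    then have v: "v = ?M *v w" unfolding w_def matrix_vector_mul_assoc by simp
    have JJ: "?J c = ?M ** ?J c0"
    proof -
      let ?W = "snd d ` (fst d \<inter> fst c0) \<inter> snd d ` (fst d \<inter> fst c)"
      have oW: "open ?W" using open_fibre_overlap[OF d(1)] c(1) c0(1) by (intro open_Int) auto
      have xW: "snd d x \<in> ?W" using d c c0 by blast
      have gx: "(snd c0 \<circ> chart_inv d) (snd d x) = snd c0 x" using fibre_chartD(5)[OF d] by simp
      have in_ov: "(snd c0 \<circ> chart_inv d) (snd d x) \<in> snd c0 ` (fst c0 \<inter> fst c)" unfolding gx using c c0 by blast
      have "cjacobian (\<lambda>z. (snd c \<circ> chart_inv c0) ((snd c0 \<circ> chart_inv d) z)) (snd d x) = ?M ** ?J c0"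
        using cjacobian_compose[OF hol_map_subset[OF fibre_immersion[OF d(1) c0(1)] Int_lower1] xW transition[OF c0(1) c(1)] in_ov]
        by (simp only: gx)
      moreover have "cjacobian (\<lambda>z. (snd c \<circ> chart_inv c0) ((snd c0 \<circ> chart_inv d) z)) (snd d x) = ?J c"
      proof -
        have "cpartial j (\<lambda>z. (snd c \<circ> chart_inv c0) ((snd c0 \<circ> chart_inv d) z) $ i) (snd d x) = cpartial j (\<lambda>z. (snd c \<circ> chart_inv d) z $ i) (snd d x)" for i j
        proof (rule cpartial_unique)
          have "hol_fun (\<lambda>z. (snd c \<circ> chart_inv d) z $ i) (snd d ` (fst d \<inter> fst c))"
            using fibre_immersion[OF d(1) c(1)] by (simp add: hol_map_def)
          from hol_fun_has_derivative[OF this, of "snd d x"]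
          have "((\<lambda>z. (snd c \<circ> chart_inv d) z $ i) has_derivative (\<lambda>v. \<Sum>j\<in>UNIV. cpartial j (\<lambda>z. (snd c \<circ> chart_inv d) z $ i) (snd d x) * v $ j)) (at (snd d x))"
            using d c by blast
          then show "((\<lambda>z. (snd c \<circ> chart_inv c0) ((snd c0 \<circ> chart_inv d) z) $ i) has_derivative (\<lambda>v. \<Sum>j\<in>UNIV. cpartial j (\<lambda>z. (snd c \<circ> chart_inv d) z $ i) (snd d x) * v $ j)) (at (snd d x))"
          proof (rule has_derivative_transform_within_open[OF _ oW xW])
            fix y assume "y \<in> ?W"
            then obtain x0 where "x0 \<in> fst d" "x0 \<in> fst c0" "y = snd d x0" by blast
            then have "chart_inv d y \<in> fst c0" using fibre_chartD(5)[OF d(1)] by simp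
            then show "(snd c \<circ> chart_inv d) y $ i = (snd c \<circ> chart_inv c0) ((snd c0 \<circ> chart_inv d) y) $ i"
              using chartD(5)[OF c0(1)] by simp
          qed
        qed
        then show ?thesis by (simp add: cjacobian_def)
      qed
      ultimately show ?thesis by simp
    qed
    have "\<eta> c x * det (cons_col v (?J c)) = \<eta> c x * (det ?M * det (cons_col w (?J c0)))"
      unfolding JJ v matrix_mult_cons_col[symmetric] det_mul ..
    also have "\<dots> = \<eta> c0 x * det (cons_col w (?J c0))"
    proof -
      have "x \<in> fst c0 \<inter> fst c \<inter> XV" using c c0 xX s(2) by simp
      then have "\<eta> c0 x = det ?M * \<eta> c x"
        using sec c(1) c0(1) unfolding canonical_section_def by blast
      then show ?thesis by (simp only: mult_ac)
    qed
    also have "\<dots> = dirv (f \<circ> chart_inv c0) w (snd c0 x) * h" by (rule h0)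
    also have "dirv (f \<circ> chart_inv c0) w (snd c0 x) = dirv (f \<circ> chart_inv c) v (snd c x)"
    proof -
      have "dirv (f \<circ> chart_inv c0) w (snd c0 x) = (\<Sum>j\<in>UNIV. (\<Sum>i\<in>UNIV. cpartial i (f \<circ> chart_inv c) (snd c x) * ?M $ i $ j) * w $ j)"
        unfolding dirv_def by (simp only: cpartial_transition[OF c0 c])
      also have "\<dots> = (\<Sum>i\<in>UNIV. cpartial i (f \<circ> chart_inv c) (snd c x) * (?M *v w) $ i)"
        unfolding matrix_vector_mult_def vec_lambda_beta sum_distrib_left sum_distrib_right mult.assoc by (rule sum.swap)
      finally show ?thesis unfolding dirv_def v[symmetric] .
    qed
    finally show "\<eta> c x * det (cons_col v (?J c)) = dirv (f \<circ> chart_inv c) v (snd c x) * h" .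
  qed
  moreover have "h' = h" if "P h'" for h'
  proof -
    have "\<eta> c0 x * det (cons_col v0 (?J c0)) = dirv (f \<circ> chart_inv c0) v0 (snd c0 x) * h'"
      using that c0 unfolding P_def by blast
    then show ?thesis using dv0 unfolding h0 by simp
  qed
  ultimately have "(THE h. P h) = h" by (rule the_equality)
  moreover have "fibre_form A f \<eta> d x = (THE h. P h)"
    unfolding fibre_form_def P_def cons_col_def dirv_def ..
  ultimately have "P (fibre_form A f \<eta> d x)" using \<open>P h\<close> by simp
  then show ?thesis using c by (simp add: P_def)
qed

text \<open>Needed for measurability. Near a point the form is an explicit quotient, with the
  derivative in a suitable fixed direction as nonvanishing denominator.\<close>

lemma continuous_on_fibre_form:
  assumes s: "s \<noteq> 0" "s \<in> V" and d: "d \<in> fibre_atlas X A f s"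
  shows "continuous_on (snd d ` fst d) (\<lambda>z. fibre_form A f \<eta> d (chart_inv d z))"
proof (rule continuous_at_imp_continuous_on, rule ballI)
  fix z0 assume "z0 \<in> snd d ` fst d"
  then obtain x where x: "x \<in> fst d" "z0 = snd d x" by blast
  have xX: "x \<in> topspace X" "f x = s" using fibre_chart_fibre[OF d x(1)] by auto
  obtain c i where c: "c \<in> A" "x \<in> fst c" and i: "cpartial i (f \<circ> chart_inv c) (snd c x) \<noteq> 0"
    using noncritical[OF xX(1)] xX(2) s(1) by (auto simp: critical_point_def)
  define v :: "complex ^ 'n option" where "v = axis i 1"
  let ?W = "snd d ` (fst d \<inter> fst c)" and ?G = "snd c \<circ> chart_inv d" and ?F = "f \<circ> chart_inv c"
  note oW = open_fibre_overlap[OF d c(1)] and G = fibre_immersion[OF d c(1)]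
  have GU: "?G z \<in> snd c ` (fst c \<inter> XV)" if "z \<in> ?W" for z
    using that fibre_chartD(5)[OF d] fibre_chart_fibre[OF d] s(2) by auto
  have cG: "continuous_on ?W ?G" by (rule hol_map_continuous_on[OF G])
  have c1: "continuous_on ?W (\<lambda>z. (\<eta> c \<circ> chart_inv c) (?G z))"
    by (rule continuous_on_compose2[OF hol_fun_continuous_on[OF hol_sec_chart[OF c(1)]] cG]) (use GU in blast)
  have c2: "continuous_on ?W (\<lambda>z. dirv ?F v (?G z))"
  proof (rule continuous_on_compose2[OF hol_fun_continuous_on[OF hol_fun_dirv] cG])
    show "hol_fun ?F (snd c ` (fst c \<inter> XV))" by (rule hol_fun_subset[OF hol_f_chart[OF c(1)]]) auto
  qed (use GU open_chart_XV[OF c(1)] in auto)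
  have c3: "continuous_on ?W (\<lambda>z. det (cons_col v (cjacobian ?G z)))"
  proof -
    have e: "continuous_on ?W (\<lambda>z. cons_col v (cjacobian ?G z) $ i $ j)" for i j
    proof (cases j)
      case (Some k)
      have "continuous_on ?W (cpartial k (\<lambda>w. ?G w $ i))"
        by (rule continuous_on_cpartial[OF _ oW]) (use G in \<open>simp add: hol_map_def\<close>)
      then show ?thesis using Some by (simp add: cons_col_def cjacobian_def)
    qed (simp add: cons_col_def)
    show ?thesis unfolding det_def by (intro continuous_intros e)
  qed
  have z0W: "z0 \<in> ?W" using x c by blast
  have G0: "?G z0 = snd c x" using fibre_chartD(5)[OF d x(1)] x(2) by simp
  let ?h = "\<lambda>z. (\<eta> c \<circ> chart_inv c) (?G z) * det (cons_col v (cjacobian ?G z)) / dirv ?F v (?G z)"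
  have nz: "dirv ?F v (?G z0) \<noteq> 0" using i G0 by (simp add: v_def dirv_axis)
  have isc: "isCont g z0" if "continuous_on ?W g" for g :: "complex ^ 'n \<Rightarrow> complex"
    using that oW z0W continuous_on_eq_continuous_at by blast
  have cont: "isCont ?h z0" by (intro isCont_divide isCont_mult isc c1 c2 c3 nz)
  have "isCont (\<lambda>z. dirv ?F v (?G z)) z0" by (rule isc[OF c2])
  then have "\<forall>\<^sub>F z in nhds z0. dirv ?F v (?G z) \<in> - {0}"
    using tendsto_at_iff_tendsto_nhds[of "\<lambda>z. dirv ?F v (?G z)" z0] nz
    unfolding isCont_def by (intro topological_tendstoD[of _ "dirv ?F v (?G z0)"]) (auto simp: open_Compl)
  moreover have "\<forall>\<^sub>F z in nhds z0. z \<in> ?W" using oW z0W by (rule eventually_nhds_in_open)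
  ultimately have "\<forall>\<^sub>F z in nhds z0. ?h z = fibre_form A f \<eta> d (chart_inv d z)"
  proof eventually_elim
    case (elim z)
    then obtain y where y: "y \<in> fst d" "y \<in> fst c" "z = snd d y" by blast
    have "chart_inv d z = y" "?G z = snd c y" "chart_inv c (snd c y) = y"
      using y fibre_chartD(5)[OF d] chartD(5)[OF c(1)] by auto
    then show ?case using fibre_form_eq[OF s d y(1) c(1) y(2), of v] elim(1) y(3) by (simp add: field_simps)
  qed
  from isCont_cong[OF this] cont show "isCont (\<lambda>z. fibre_form A f \<eta> d (chart_inv d z)) z0"
    by simp
qed

end

lemma sets_borel_preimage_on_open:
  fixes G :: "'a::euclidean_space \<Rightarrow> 'b::euclidean_space"
  assumes "open W" "continuous_on W G" "D \<in> sets borel"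
  shows "{z \<in> W. G z \<in> D} \<in> sets borel"
proof -
  have "(\<lambda>z. if z \<in> W then G z else 0) \<in> borel_measurable borel"
    by (rule borel_measurable_continuous_on_if) (use assms in auto)
  from measurable_sets[OF this assms(3)]
  have "((\<lambda>z. if z \<in> W then G z else 0) -` D) \<in> sets borel" by simp
  moreover have "{z \<in> W. G z \<in> D} = W \<inter> ((\<lambda>z. if z \<in> W then G z else 0) -` D)" by auto
  ultimately show ?thesis using assms(1) by simp
qed

lemma nn_integral_le_finite_cover:
  assumes K: "finite K" and S: "S \<subseteq> (\<Union>k\<in>K. T k)" and T: "\<And>k. k \<in> K \<Longrightarrow> T k \<in> sets M"
    and g: "(\<lambda>z. g z * indicator S z) \<in> borel_measurable M"
  shows "(\<integral>\<^sup>+ z\<in>S. g z \<partial>M) \<le> (\<Sum>k\<in>K. \<integral>\<^sup>+ z\<in>S \<inter> T k. g z \<partial>M)"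
proof -
  have m: "(\<lambda>z. g z * indicator (S \<inter> T k) z) \<in> borel_measurable M" if "k \<in> K" for k
  proof -
    have "(\<lambda>z. (g z * indicator S z) * indicator (T k) z) \<in> borel_measurable M"
      using g T[OF that] by measurable
    then show ?thesis by (simp add: indicator_inter_arith mult.assoc)
  qed
  have "(\<integral>\<^sup>+ z\<in>S. g z \<partial>M) \<le> (\<integral>\<^sup>+ z. (\<Sum>k\<in>K. g z * indicator (S \<inter> T k) z) \<partial>M)"
  proof (rule nn_integral_mono)
    fix z
    show "g z * indicator S z \<le> (\<Sum>k\<in>K. g z * indicator (S \<inter> T k) z)"
    proof (cases "z \<in> S")
      case True
      then obtain k where k: "k \<in> K" "z \<in> T k" using S by blast
      have "g z * indicator S z = g z * indicator (S \<inter> T k) z" using True k by simp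
      also have "\<dots> \<le> (\<Sum>k\<in>K. g z * indicator (S \<inter> T k) z)"
        by (rule member_le_sum[OF k(1)]) (use K in auto)
      finally show ?thesis .
    qed simp
  qed
  also have "\<dots> = (\<Sum>k\<in>K. \<integral>\<^sup>+ z\<in>S \<inter> T k. g z \<partial>M)" by (rule nn_integral_sum[OF m])
  finally show ?thesis .
qed

section \<open>Upper bound for the integrals over nearby fibres\<close>

context degeneration_family
begin

abbreviation chart_f where "chart_f c \<equiv> f \<circ> chart_inv c"
abbreviation chart_sec where "chart_sec c \<equiv> \<eta> c \<circ> chart_inv c"
abbreviation chart_dom where "chart_dom c \<equiv> snd c ` (fst c \<inter> XV)"

lemma hol_chart_f: "c \<in> A \<Longrightarrow> hol_fun (chart_f c) (chart_dom c)"
  by (rule hol_fun_subset[OF hol_f_chart]) auto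

text \<open>Points with \<open>f y = 0\<close> are exempt from the covering: at a critical point the
  patches omit the point itself, which lies on the special fibre.\<close>

lemma local_patches:
  assumes dim: "CARD('n) \<ge> 2" and x: "x \<in> fibre X f 0"
    and oqs: "critical_point A f x \<Longrightarrow> ordinary_quadratic_singularity X A f x"
  shows "\<exists>c B Q. c \<in> A \<and> x \<in> fst c \<and> open B \<and> snd c x \<in> B \<and> finite Q \<and>
    (\<forall>(D, R, v, w0, \<phi>)\<in>Q. patch (chart_f c) (chart_sec c) (chart_dom c) B D R v w0 \<phi>) \<and>
    (\<forall>y\<in>fst c. snd c y \<in> B \<longrightarrow> f y \<noteq> 0 \<longrightarrow> (\<exists>(D, R, v, w0, \<phi>)\<in>Q. snd c y \<in> D))"
proof -
  have xX: "x \<in> topspace X" "f x = 0" using x by (auto simp: fibre_def)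
  have dom: "snd c x \<in> chart_dom c" if "x \<in> fst c" for c using that xX V(2) by auto
  show ?thesis
  proof (cases "critical_point A f x")
    case True
    then obtain c where c: "c \<in> A" "x \<in> fst c" and inv: "invertible (chessian (chart_f c) (snd c x))"
      using oqs[OF True] by (auto simp: ordinary_quadratic_singularity_def)
    have crit: "cpartial i (chart_f c) (snd c x) = 0" for i
      using True critical_point_chart[OF c] by blast
    obtain B Q where BQ: "open B" "snd c x \<in> B" "finite Q"
      "\<forall>(D, R, v, w0, \<phi>)\<in>Q. patch (chart_f c) (chart_sec c) (chart_dom c) B D R v w0 \<phi>"
      "\<forall>z\<in>B - {snd c x}. \<exists>(D, R, v, w0, \<phi>)\<in>Q. z \<in> D"
      using exists_patches_critical[OF hol_chart_f[OF c(1)] hol_sec_chart[OF c(1)] open_chart_XV[OF c(1)] dom[OF c(2)] crit inv dim]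
      by blast
    have "\<exists>(D, R, v, w0, \<phi>)\<in>Q. snd c y \<in> D" if y: "y \<in> fst c" "snd c y \<in> B" "f y \<noteq> 0" for y
    proof -
      have "snd c y \<noteq> snd c x"
        using y(3) xX(2) inj_onD[OF chartD(3)[OF c(1)] _ y(1) c(2)] by metis
      then show ?thesis using BQ(5) y(2) by blast
    qed
    then show ?thesis using c BQ(1-4) by (intro exI[of _ c] exI[of _ B] exI[of _ Q]) blast
  next
    case False
    obtain c i where c: "c \<in> A" "x \<in> fst c" and i: "cpartial i (chart_f c) (snd c x) \<noteq> 0"
      using False by (auto simp: critical_point_def)
    obtain B R v w0 \<phi> where B: "snd c x \<in> B" and p: "patch (chart_f c) (chart_sec c) (chart_dom c) B B R v w0 \<phi>"
      using exists_patches_regular[OF hol_chart_f[OF c(1)] hol_sec_chart[OF c(1)] open_chart_XV[OF c(1)] dom[OF c(2)] i]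
      by blast
    have "open B" using p by (simp add: patch_def)
    then show ?thesis using c B p
      by (intro exI[of _ c] exI[of _ B] exI[of _ "{(B, R, v, w0, \<phi>)}"]) auto
  qed
qed

text \<open>The families over which \<open>density_integral\<close> takes its supremum.\<close>

definition pieces where
  "pieces s P \<longleftrightarrow> finite P \<and> (\<forall>(d, E)\<in>P. d \<in> fibre_atlas X A f s \<and> E \<subseteq> fst d \<and> snd d ` E \<in> sets borel) \<and>
     (\<forall>p\<in>P. \<forall>q\<in>P. p \<noteq> q \<longrightarrow> snd p \<inter> snd q = {})"

text \<open>Instance of \<open>patch_integral_bound\<close> with the inclusions of the fibre charts
  into the chart \<open>c\<close>; the pieces are disjoint in the fibre, so equal images in
  \<open>c\<close> come from the same piece.\<close>

lemma patch_fibre_bound: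
  assumes s: "s \<noteq> 0" "s \<in> V" and P: "pieces s P" and c: "c \<in> A"
    and patch: "patch (chart_f c) (chart_sec c) (chart_dom c) B D R v w0 \<phi>"
  shows "(\<Sum>(d, E)\<in>P. \<integral>\<^sup>+ z\<in>snd d ` E \<inter> {z \<in> snd d ` (fst d \<inter> fst c). snd c (chart_inv d z) \<in> D}.
      ennreal ((cmod (fibre_form A f \<eta> d (chart_inv d z)))\<^sup>2) \<partial>lborel) \<le> 2 * (\<integral>\<^sup>+ w. \<phi> w \<partial>lborel)"
proof -
  let ?W = "\<lambda>p. snd (fst p) ` (fst (fst p) \<inter> fst c)"
  let ?S = "\<lambda>p. snd (fst p) ` snd p \<inter> ?W p"
  let ?G = "\<lambda>p. snd c \<circ> chart_inv (fst p)"
  have Pd: "fst p \<in> fibre_atlas X A f s" "snd p \<subseteq> fst (fst p)" "snd (fst p) ` snd p \<in> sets borel" if "p \<in> P" for p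
    using P that unfolding pieces_def by (auto simp: case_prod_beta)
  have W: "open (?W p)" if "p \<in> P" for p by (rule open_fibre_overlap[OF Pd(1)[OF that] c])
  have bk: "chart_inv (fst p) z \<in> fst (fst p) \<inter> fst c \<and> snd (fst p) (chart_inv (fst p) z) = z"
    if "p \<in> P" "z \<in> ?W p" for p z
    using that(2) fibre_chartD(5)[OF Pd(1)[OF that(1)]] by auto
  have "(\<Sum>p\<in>P. \<integral>\<^sup>+ z\<in>?S p \<inter> {z \<in> ?W p. ?G p z \<in> D}. ennreal ((cmod (fibre_form A f \<eta> (fst p) (chart_inv (fst p) z)))\<^sup>2) \<partial>lborel)
      \<le> 2 * (\<integral>\<^sup>+ w. \<phi> w \<partial>lborel)"
  proof (rule patch_integral_bound[OF patch hol_chart_f[OF c] open_chart_XV[OF c], where s = s])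
    show "finite P" using P by (simp add: pieces_def)
  next
    fix p assume p: "p \<in> P"
    show "open (?W p)" by (rule W[OF p])
    show "?S p \<in> sets borel" using Pd(3)[OF p] W[OF p] by simp
    show "hol_map (?G p) (?W p)" by (rule fibre_immersion[OF Pd(1)[OF p] c])
    show "inj_on (?G p) (?W p)"
    proof (rule inj_onI)
      fix z w assume zw: "z \<in> ?W p" "w \<in> ?W p" "?G p z = ?G p w"
      then have "chart_inv (fst p) z = chart_inv (fst p) w"
        using inj_onD[OF chartD(3)[OF c], of "chart_inv (fst p) z" "chart_inv (fst p) w"] bk[OF p] by auto
      then show "z = w" using bk[OF p zw(1)] bk[OF p zw(2)] by metis
    qed
  next
    fix p z assume p: "p \<in> P" and z: "z \<in> ?W p"
    let ?x = "chart_inv (fst p) z"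
    have x: "?x \<in> fst (fst p)" "?x \<in> fst c" "snd (fst p) ?x = z" using bk[OF p z] by auto
    show "chart_f c (?G p z) = s"
      using fibre_chart_fibre[OF Pd(1)[OF p] x(1)] chartD(5)[OF c x(2)] by simp
    show "chart_sec c (?G p z) * det (cons_col v (cjacobian (?G p) z)) = dirv (chart_f c) v (?G p z) * fibre_form A f \<eta> (fst p) ?x"
      using fibre_form_eq[OF s Pd(1)[OF p] x(1) c x(2), of v] x(3) chartD(5)[OF c x(2)] by simp
  next
    fix p q z w assume p: "p \<in> P" and q: "q \<in> P" and z: "z \<in> ?S p" and w: "w \<in> ?S q" and e: "?G p z = ?G q w"
    have "chart_inv (fst p) z = chart_inv (fst q) w"
      using inj_onD[OF chartD(3)[OF c], of "chart_inv (fst p) z" "chart_inv (fst q) w"] bk[OF p, of z] bk[OF q, of w] z w e by auto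
    moreover have "chart_inv (fst p) z \<in> snd p"
    proof -
      obtain x where "x \<in> snd p" "z = snd (fst p) x" using z by blast
      then show ?thesis using fibre_chartD(5)[OF Pd(1)[OF p]] Pd(2)[OF p] by auto
    qed
    moreover have "chart_inv (fst q) w \<in> snd q"
    proof -
      obtain x where "x \<in> snd q" "w = snd (fst q) x" using w by blast
      then show ?thesis using fibre_chartD(5)[OF Pd(1)[OF q]] Pd(2)[OF q] by auto
    qed
    ultimately have "snd p \<inter> snd q \<noteq> {}" by auto
    then show "p = q" using P p q unfolding pieces_def by blast
  qed auto
  moreover have eq: "?S p \<inter> {z \<in> ?W p. ?G p z \<in> D} = snd (fst p) ` snd p \<inter> {z \<in> ?W p. snd c (chart_inv (fst p) z) \<in> D}" for p
    by auto
  ultimately show ?thesis unfolding eq case_prod_beta by blast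
qed

text \<open>Finitely many patches suffice, because the special fibre is compact and nearby fibres
  lie in the union of the patch neighbourhoods. The constant \<open>C\<close>, the sum of twice the
  integrals of their majorants, depends neither on the fibre nor on the family of pieces.\<close>

lemma density_integral_bounded:
  assumes dim: "CARD('n) \<ge> 2"
    and oqs: "\<And>x. x \<in> fibre X f 0 \<Longrightarrow> critical_point A f x \<Longrightarrow> ordinary_quadratic_singularity X A f x"
  shows "\<exists>C<\<infinity>. \<exists>\<epsilon>>0. \<forall>s. s \<noteq> 0 \<longrightarrow> cmod s < \<epsilon> \<longrightarrow>
    density_integral (fibre_atlas X A f s) (fibre_form A f \<eta>) \<le> C"
proof -
  define good where "good x c B Q \<longleftrightarrow> c \<in> A \<and> x \<in> fst c \<and> open B \<and> snd c x \<in> B \<and> finite Q \<and>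
    (\<forall>(D, R, v, w0, \<phi>)\<in>Q. patch (chart_f c) (chart_sec c) (chart_dom c) B D R v w0 \<phi>) \<and>
    (\<forall>y\<in>fst c. snd c y \<in> B \<longrightarrow> f y \<noteq> 0 \<longrightarrow> (\<exists>(D, R, v, w0, \<phi>)\<in>Q. snd c y \<in> D))" for x c B Q
  have "\<forall>x\<in>fibre X f 0. \<exists>t. good x (fst t) (fst (snd t)) (snd (snd t))"
  proof
    fix x assume x: "x \<in> fibre X f 0"
    obtain c B Q where "good x c B Q" using local_patches[OF dim x oqs[OF x]] unfolding good_def by blast
    then show "\<exists>t. good x (fst t) (fst (snd t)) (snd (snd t))" by (intro exI[of _ "(c, B, Q)"]) simp
  qed
  from bchoice[OF this] obtain t where t: "\<And>x. x \<in> fibre X f 0 \<Longrightarrow> good x (fst (t x)) (fst (snd (t x))) (snd (snd (t x)))" by blast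
  define ch where "ch x = fst (t x)" for x
  define Bx where "Bx x = fst (snd (t x))" for x
  define Qx where "Qx x = snd (snd (t x))" for x
  have g: "good x (ch x) (Bx x) (Qx x)" if "x \<in> fibre X f 0" for x using t[OF that] by (simp add: ch_def Bx_def Qx_def)
  define N where "N x = {y \<in> fst (ch x). snd (ch x) y \<in> Bx x}" for x
  have oN: "openin X (N x)" if "x \<in> fibre X f 0" for x
    unfolding N_def by (rule topological_chart_open_preimage[OF chart]) (use g[OF that] in \<open>auto simp: good_def\<close>)
  have xN: "x \<in> N x" if "x \<in> fibre X f 0" for x using g[OF that] by (auto simp: N_def good_def)
  have cl: "closed_map X (top_of_set (ball 0 r)) f" and comp: "compactin X (fibre X f 0)"
    using proper r_pos unfolding proper_map_def fibre_def by auto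
  have "\<exists>K. finite K \<and> K \<subseteq> fibre X f 0 \<and> fibre X f 0 \<subseteq> (\<Union>x\<in>K. N x)"
  proof -
    have "\<exists>\<F>. finite \<F> \<and> \<F> \<subseteq> N ` fibre X f 0 \<and> fibre X f 0 \<subseteq> \<Union>\<F>"
    proof (rule comp[unfolded compactin_def, THEN conjunct2, rule_format, of "N ` fibre X f 0"])
      show "(\<forall>U\<in>N ` fibre X f 0. openin X U) \<and> fibre X f 0 \<subseteq> \<Union> (N ` fibre X f 0)"
        using oN xN by auto
    qed
    then show ?thesis by (metis finite_subset_image)
  qed
  then obtain K where K: "finite K" "K \<subseteq> fibre X f 0" "fibre X f 0 \<subseteq> (\<Union>x\<in>K. N x)" by blast
  \<comment> \<open>The image of the complement of the neighbourhoods is closed, as \<open>f\<close>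
    is proper, and misses 0; so it misses all small \<open>s\<close>.\<close>
  have "closedin (top_of_set (ball 0 r)) (f ` (topspace X - (\<Union>x\<in>K. N x)))"
  proof (rule cl[unfolded closed_map_def, rule_format])
    have "openin X (\<Union>x\<in>K. N x)" using oN K(2) by (intro openin_Union) auto
    then show "closedin X (topspace X - (\<Union>x\<in>K. N x))" by (intro closedin_diff) auto
  qed
  then have "openin (top_of_set (ball 0 r)) (ball 0 r - f ` (topspace X - (\<Union>x\<in>K. N x)))"
    by (simp add: closedin_def)
  then have o: "open (ball 0 r - f ` (topspace X - (\<Union>x\<in>K. N x)))" by (metis openin_open_trans open_ball)
  have "0 \<in> ball 0 r - f ` (topspace X - (\<Union>x\<in>K. N x))" using K(3) r_pos by (auto simp: fibre_def)
  then have "0 \<in> (ball 0 r - f ` (topspace X - (\<Union>x\<in>K. N x))) \<inter> V" using V by simp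
  moreover have "open ((ball 0 r - f ` (topspace X - (\<Union>x\<in>K. N x))) \<inter> V)" using o V(1) by (rule open_Int)
  ultimately obtain \<epsilon> where \<epsilon>: "\<epsilon> > 0" "ball 0 \<epsilon> \<subseteq> (ball 0 r - f ` (topspace X - (\<Union>x\<in>K. N x))) \<inter> V"
    using open_contains_ball by blast
  define I where "I = (SIGMA x:K. Qx x)"
  have finI: "finite I" unfolding I_def using K g by (auto simp: good_def)
  define T where "T d x D = {z \<in> snd d ` (fst d \<inter> fst (ch x)). snd (ch x) (chart_inv d z) \<in> D}" for d :: "('a, 'n) chart" and x D
  define C where "C = (\<Sum>(x, D, R, v, w0, \<phi>)\<in>I. 2 * (\<integral>\<^sup>+ w. ennreal (\<phi> w) \<partial>lborel))"
  have patchI: "patch (chart_f (ch x)) (chart_sec (ch x)) (chart_dom (ch x)) (Bx x) D R v w0 \<phi>" and chA: "ch x \<in> A"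
    if "(x, D, R, v, w0, \<phi>) \<in> I" for x D R v w0 \<phi>
    using that g K(2) unfolding I_def good_def by fast+
  have Cfin: "C < \<infinity>"
  proof -
    have "2 * (\<integral>\<^sup>+ w. ennreal (\<phi> w) \<partial>lborel) < \<infinity>" if "(x, D, R, v, w0, \<phi>) \<in> I" for x D R v w0 and \<phi> :: "complex ^ 'n \<Rightarrow> real"
      using patchI[OF that] by (simp add: patch_def ennreal_mult_less_top)
    then show ?thesis unfolding C_def using finI by (auto simp: ennreal_sum_less_top)
  qed
  have main: "(\<Sum>(d, E)\<in>P. \<integral>\<^sup>+ z \<in> snd d ` E. ennreal ((cmod (fibre_form A f \<eta> d (chart_inv d z)))\<^sup>2) \<partial>lborel) \<le> C"
    if s: "s \<noteq> 0" "cmod s < \<epsilon>" and P: "pieces s P" for s P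
  proof -
    have sN: "y \<in> (\<Union>x\<in>K. N x)" if "y \<in> fibre X f s" for y
      using \<epsilon>(2) s(2) that by (force simp: fibre_def)
    let ?g = "\<lambda>d z. ennreal ((cmod (fibre_form A f \<eta> d (chart_inv d z)))\<^sup>2)"
    have sV: "s \<in> V" using \<epsilon>(2) s(2) by auto
    have Pd: "d \<in> fibre_atlas X A f s" "E \<subseteq> fst d" "snd d ` E \<in> sets borel" if "(d, E) \<in> P" for d E
      using P that unfolding pieces_def by auto
    have "(\<Sum>(d, E)\<in>P. \<integral>\<^sup>+ z \<in> snd d ` E. ?g d z \<partial>lborel) \<le>
      (\<Sum>(d, E)\<in>P. \<Sum>(x, D, R, v, w0, \<phi>)\<in>I. \<integral>\<^sup>+ z \<in> snd d ` E \<inter> T d x D. ?g d z \<partial>lborel)"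
    proof (rule sum_mono, clarify)
      fix d E assume dE: "(d, E) \<in> P"
      note d = Pd[OF dE]
      have "(\<integral>\<^sup>+ z \<in> snd d ` E. ?g d z \<partial>lborel) \<le> (\<Sum>k\<in>I. \<integral>\<^sup>+ z \<in> snd d ` E \<inter> T d (fst k) (fst (snd k)). ?g d z \<partial>lborel)"
      proof (rule nn_integral_le_finite_cover[OF finI])
        show "snd d ` E \<subseteq> (\<Union>k\<in>I. T d (fst k) (fst (snd k)))"
        proof
          fix z assume "z \<in> snd d ` E"
          then obtain y where y: "y \<in> E" "z = snd d y" by blast
          have yd: "y \<in> fst d" using y d(2) by blast
          have yf: "y \<in> fibre X f s" using fibre_chart_fibre[OF d(1) yd] by (simp add: fibre_def)
          then obtain x where x: "x \<in> K" "y \<in> N x" using sN by blast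
          have gx: "good x (ch x) (Bx x) (Qx x)" using g x K(2) by blast
          have "f y \<noteq> 0" using yf s(1) by (simp add: fibre_def)
          moreover have yc: "y \<in> fst (ch x)" "snd (ch x) y \<in> Bx x" using x by (auto simp: N_def)
          ultimately obtain k where k: "k \<in> Qx x" "snd (ch x) y \<in> fst k" using gx unfolding good_def by fastforce
          have "chart_inv d z = y" using fibre_chartD(5)[OF d(1) yd] y by simp
          then have "z \<in> T d x (fst k)" using k yc yd y by (auto simp: T_def)
          then show "z \<in> (\<Union>k\<in>I. T d (fst k) (fst (snd k)))" using k x by (intro UN_I[of "(x, k)"]) (auto simp: I_def)
        qed
        show "T d (fst k) (fst (snd k)) \<in> sets lborel" if "k \<in> I" for k
        proof -
          obtain x D R v w0 \<phi> where k: "k = (x, D, R, v, w0, \<phi>)" by (rule prod_cases6)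
          have "D \<in> sets borel" using patchI[of x D R v w0 \<phi>] that k by (simp add: patch_def)
          moreover have "ch x \<in> A" using chA that k by blast
          moreover have "continuous_on (snd d ` (fst d \<inter> fst (ch x))) (\<lambda>z. snd (ch x) (chart_inv d z))"
            using hol_map_continuous_on[OF fibre_immersion[OF d(1) \<open>ch x \<in> A\<close>]] by (simp add: comp_def)
          ultimately show ?thesis unfolding T_def k
            using sets_borel_preimage_on_open[OF open_fibre_overlap[OF d(1) \<open>ch x \<in> A\<close>]] by simp
        qed
        have "(\<lambda>z. if z \<in> snd d ` fst d then fibre_form A f \<eta> d (chart_inv d z) else 0) \<in> borel_measurable borel"
          by (rule borel_measurable_continuous_on_if)
             (use fibre_chartD(2)[OF d(1)] continuous_on_fibre_form[OF s(1) sV d(1)] in auto)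
        then have "(\<lambda>z. ennreal ((cmod (if z \<in> snd d ` fst d then fibre_form A f \<eta> d (chart_inv d z) else 0))\<^sup>2) * indicator (snd d ` E) z) \<in> borel_measurable borel"
          using d(3) by measurable
        moreover have "(\<lambda>z. ennreal ((cmod (if z \<in> snd d ` fst d then fibre_form A f \<eta> d (chart_inv d z) else 0))\<^sup>2) * indicator (snd d ` E) z)
          = (\<lambda>z. ?g d z * indicator (snd d ` E) z)"
          using d(2) by (auto simp: fun_eq_iff indicator_def)
        ultimately show "(\<lambda>z. ?g d z * indicator (snd d ` E) z) \<in> borel_measurable lborel"
          by (simp only: measurable_lborel2)
      qed
      then show "(\<integral>\<^sup>+ z \<in> snd d ` E. ?g d z \<partial>lborel) \<le> (\<Sum>(x, D, R, v, w0, \<phi>)\<in>I. \<integral>\<^sup>+ z \<in> snd d ` E \<inter> T d x D. ?g d z \<partial>lborel)"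
        by (simp add: case_prod_beta)
    qed
    \<comment> \<open>The order of summation matters: \<open>patch_fibre_bound\<close> controls all
      pieces within one patch, not a single piece within all patches.\<close>
    also have "\<dots> = (\<Sum>(x, D, R, v, w0, \<phi>)\<in>I. \<Sum>(d, E)\<in>P. \<integral>\<^sup>+ z \<in> snd d ` E \<inter> T d x D. ?g d z \<partial>lborel)"
      unfolding case_prod_beta by (rule sum.swap)
    also have "\<dots> \<le> C"
      unfolding C_def
    proof (rule sum_mono, clarify)
      fix x D R v w0 and \<phi> :: "complex ^ 'n \<Rightarrow> real" assume k: "(x, D, R, v, w0, \<phi>) \<in> I"
      show "(\<Sum>(d, E)\<in>P. \<integral>\<^sup>+ z \<in> snd d ` E \<inter> T d x D. ?g d z \<partial>lborel) \<le> 2 * (\<integral>\<^sup>+ w. ennreal (\<phi> w) \<partial>lborel)"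
        unfolding T_def by (rule patch_fibre_bound[OF s(1) sV P chA[OF k] patchI[OF k]])
    qed
    finally show ?thesis .
  qed
  have "density_integral (fibre_atlas X A f s) (fibre_form A f \<eta>) \<le> C" if s: "s \<noteq> 0" "cmod s < \<epsilon>" for s
    unfolding density_integral_def
    by (rule SUP_least) (use main[OF s] in \<open>auto simp: pieces_def\<close>)
  then show ?thesis using Cfin \<epsilon>(1) by blast
qed

section \<open>Nonvanishing of the frame and lower bound\<close>

lemma critical_isolated_in_chart:
  assumes oqs: "\<And>x. x \<in> fibre X f 0 \<Longrightarrow> critical_point A f x \<Longrightarrow> ordinary_quadratic_singularity X A f x"
    and c: "c \<in> A" and p: "p \<in> chart_dom c" and crit: "\<forall>i. cpartial i (chart_f c) p = 0"
  shows "\<exists>N. open N \<and> p \<in> N \<and> (\<forall>z\<in>N \<inter> chart_dom c. (\<forall>i. cpartial i (chart_f c) z = 0) \<longrightarrow> z = p)"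
proof -
  obtain x where x: "x \<in> fst c" "x \<in> XV" "p = snd c x" using p by blast
  have cx: "critical_point A f x" using critical_point_chart[OF c x(1)] crit x(3) by simp
  then have "f x = 0" using noncritical x(2) by blast
  then have "ordinary_quadratic_singularity X A f x" using oqs[OF _ cx] x(2) by (simp add: fibre_def)
  then obtain W where W: "openin X W" "x \<in> W" "\<And>y. y \<in> W \<Longrightarrow> critical_point A f y \<Longrightarrow> y = x"
    unfolding ordinary_quadratic_singularity_def by blast
  have "z = p" if z: "z \<in> snd c ` (fst c \<inter> W)" "\<forall>i. cpartial i (chart_f c) z = 0" for z
  proof -
    obtain y where y: "y \<in> fst c" "y \<in> W" "z = snd c y" using z(1) by blast
    then have "critical_point A f y" using critical_point_chart[OF c y(1)] z(2) by simp
    then show ?thesis using W(3) y x(3) by blast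
  qed
  then show ?thesis
    using topological_chart_open_image[OF chart[OF c] W(1)] x W(2)
    by (intro exI[of _ "snd c ` (fst c \<inter> W)"]) blast
qed

text \<open>The negation is precisely the vanishing condition of
  \<open>hol_fun_divide_isolated_critical\<close> in every chart; the local quotients are shown to
  form a section, against which the frame property is tested.\<close>

lemma exists_nonvanishing_regular_point:
  assumes oqs: "\<And>x. x \<in> fibre X f 0 \<Longrightarrow> critical_point A f x \<Longrightarrow> ordinary_quadratic_singularity X A f x"
    and frame: "direct_image_frame X A f r V \<eta>"
  shows "\<exists>x\<in>fibre X f 0. \<exists>c\<in>A. x \<in> fst c \<and> (\<exists>i. cpartial i (chart_f c) (snd c x) \<noteq> 0) \<and> \<eta> c x \<noteq> 0"
proof (rule ccontr)
  assume neg: "\<not> ?thesis"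
  have dim: "CARD('n option) \<ge> 2" by (simp add: card_UNIV_option Suc_le_eq)
  note iso = critical_isolated_in_chart[OF oqs]
  have "\<forall>c\<in>A. \<exists>\<sigma>. hol_fun \<sigma> (chart_dom c) \<and> (\<forall>z\<in>chart_dom c. chart_sec c z = chart_f c z * \<sigma> z)"
  proof
    fix c assume c: "c \<in> A"
    show "\<exists>\<sigma>. hol_fun \<sigma> (chart_dom c) \<and> (\<forall>z\<in>chart_dom c. chart_sec c z = chart_f c z * \<sigma> z)"
    proof (rule hol_fun_divide_isolated_critical[OF hol_chart_f[OF c] hol_sec_chart[OF c] open_chart_XV[OF c] dim])
      show "\<exists>N. open N \<and> p \<in> N \<and> (\<forall>z\<in>N \<inter> chart_dom c. (\<forall>i. cpartial i (chart_f c) z = 0) \<longrightarrow> z = p)"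
        if "p \<in> chart_dom c" "\<forall>i. cpartial i (chart_f c) p = 0" for p
        by (rule iso[OF _ _ c that])
    next
      fix z assume z: "z \<in> chart_dom c" "chart_f c z = 0" "\<exists>i. cpartial i (chart_f c) z \<noteq> 0"
      then obtain x where x: "x \<in> fst c" "x \<in> XV" "z = snd c x" by blast
      have "chart_inv c z = x" using chartD(5)[OF c x(1)] x(3) by simp
      then show "chart_sec c z = 0" using neg c x z by (auto simp: fibre_def)
    qed
  qed
  from bchoice[OF this] obtain sg where sg: "\<And>c. c \<in> A \<Longrightarrow> hol_fun (sg c) (chart_dom c)"
    "\<And>c z. c \<in> A \<Longrightarrow> z \<in> chart_dom c \<Longrightarrow> chart_sec c z = chart_f c z * sg c z" by blast
  define \<sigma> where "\<sigma> c x = sg c (snd c x)" for c x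
  have \<eta>\<sigma>: "\<eta> c x = f x * \<sigma> c x" if "c \<in> A" "x \<in> fst c" "x \<in> XV" for c x
    using sg(2)[OF that(1), of "snd c x"] that chartD(5)[OF that(1,2)] by (auto simp: \<sigma>_def)
  \<comment> \<open>Where \<open>f\<close> is nonzero, the transformation law follows from that of
    \<open>\<eta>\<close> by cancelling \<open>f\<close>; uniqueness of continuous quotients extends
    it to the zeros of \<open>f\<close>.\<close>
  have "canonical_section A XV \<sigma>"
    unfolding canonical_section_def
  proof (intro conjI ballI)
    fix c assume c: "c \<in> A"
    show "hol_fun (\<sigma> c \<circ> chart_inv c) (chart_dom c)"
      by (rule hol_fun_transform[OF sg(1)[OF c] open_chart_XV[OF c]])
         (use chartD(5)[OF c] in \<open>auto simp: \<sigma>_def\<close>)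
  next
    fix c d x assume c: "c \<in> A" and d: "d \<in> A" and x: "x \<in> fst c \<inter> fst d \<inter> XV"
    let ?N = "snd c ` (fst c \<inter> (fst d \<inter> XV))" and ?\<tau> = "snd d \<circ> chart_inv c"
    have oN: "open ?N" by (rule topological_chart_open_image[OF chart[OF c] openin_Int[OF chartD(1)[OF d] open_XV]])
    have \<tau>: "hol_map ?\<tau> ?N" by (rule hol_map_subset[OF transition[OF c d]]) auto
    have pt: "\<exists>y. y \<in> fst c \<and> y \<in> fst d \<and> y \<in> XV \<and> z = snd c y \<and> chart_inv c z = y \<and> ?\<tau> z = snd d y" if z: "z \<in> ?N" for z
      using z chartD(5)[OF c] by auto
    have "sg c (snd c x) = det (cjacobian ?\<tau> (snd c x)) * sg d (?\<tau> (snd c x))"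
    proof (rule continuous_quotient_unique[of ?N "sg c" "\<lambda>z. det (cjacobian ?\<tau> z) * sg d (?\<tau> z)" "chart_f c", OF oN])
      show "continuous_on ?N (sg c)"
        by (rule continuous_on_subset[OF hol_fun_continuous_on[OF sg(1)[OF c]]]) auto
      have "continuous_on ?N (\<lambda>z. sg d (?\<tau> z))"
        by (rule continuous_on_compose2[OF hol_fun_continuous_on[OF sg(1)[OF d]] hol_map_continuous_on[OF \<tau>]])
           (use chartD(5)[OF c] in auto)
      then show "continuous_on ?N (\<lambda>z. det (cjacobian ?\<tau> z) * sg d (?\<tau> z))"
        by (intro continuous_on_mult hol_fun_continuous_on[OF hol_fun_det_cjacobian[OF \<tau> oN]])
      show "\<exists>z\<in>O'. chart_f c z \<noteq> 0" if "open O'" "O' \<noteq> {}" "O' \<subseteq> ?N" for O'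
      proof (rule nonzero_dense_if_critical_isolated[OF _ that(1,2)])
        show "O' \<subseteq> chart_dom c" using that(3) by blast
        show "\<exists>N. open N \<and> p \<in> N \<and> (\<forall>z\<in>N \<inter> chart_dom c. (\<forall>i. cpartial i (chart_f c) z = 0) \<longrightarrow> z = p)"
          if "p \<in> chart_dom c" "\<forall>i. cpartial i (chart_f c) p = 0" for p
          by (rule iso[OF _ _ c that])
      qed
      fix z assume "z \<in> ?N"
      then obtain y where y: "y \<in> fst c" "y \<in> fst d" "y \<in> XV" "z = snd c y" "chart_inv c z = y" "?\<tau> z = snd d y"
        using pt by blast
      have "y \<in> fst c \<inter> fst d \<inter> XV" using y(1-3) by blast
      then have "\<eta> c y = det (cjacobian ?\<tau> z) * \<eta> d y"
        using sec c d unfolding canonical_section_def y(4) by blast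
      then show "chart_f c z * sg c z = chart_f c z * (det (cjacobian ?\<tau> z) * sg d (?\<tau> z))"
        using \<eta>\<sigma>[OF c y(1,3)] \<eta>\<sigma>[OF d y(2,3)] y(4-6) by (simp add: \<sigma>_def mult_ac)
    qed (use x in auto)
    then show "\<sigma> c x = det (cjacobian ?\<tau> (snd c x)) * \<sigma> d x"
      using chartD(5)[OF c, of x] x by (simp add: \<sigma>_def)
  qed
  note sec_\<sigma> = this
  have VV: "open V \<and> V \<subseteq> V" using V(1) by simp
  note gen = mp[OF spec[where x = V, OF frame[unfolded direct_image_frame_def, THEN conjunct2, THEN conjunct2,
    THEN conjunct2, THEN conjunct2]] VV, THEN conjunct1]
  note unique = mp[OF spec[where x = V, OF frame[unfolded direct_image_frame_def, THEN conjunct2, THEN conjunct2,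
    THEN conjunct2, THEN conjunct2]] VV, THEN conjunct2]
  from mp[OF spec[OF gen] sec_\<sigma>]
  obtain g where g: "g holomorphic_on V" "\<And>c x. c \<in> A \<Longrightarrow> x \<in> fst c \<Longrightarrow> f x \<in> V \<Longrightarrow> \<sigma> c x = g (f x) * \<eta> c x"
    by blast
  \<comment> \<open>This function multiplies the frame to 0, so it vanishes on \<open>V\<close>,
    while its value at 0 is -1.\<close>
  have "(\<lambda>t. g t * t - 1) holomorphic_on V" using g(1) by (intro holomorphic_intros)
  moreover have "(g (f x) * f x - 1) * \<eta> c x = 0" if "c \<in> A" "x \<in> fst c" "f x \<in> V" for c x
  proof -
    have "x \<in> XV" using that chartD(4) by blast
    then have "\<eta> c x = f x * (g (f x) * \<eta> c x)" using \<eta>\<sigma>[OF that(1,2)] g(2)[OF that] by simp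
    then show ?thesis by (simp add: algebra_simps)
  qed
  moreover have "\<forall>t\<in>V. k t = 0"
    if "k holomorphic_on V" "\<forall>c\<in>A. \<forall>x\<in>fst c. f x \<in> V \<longrightarrow> k (f x) * \<eta> c x = 0" for k
    by (rule mp[OF spec[OF unique]]) (use that in simp)
  ultimately have "\<forall>t\<in>V. g t * t - 1 = 0" by blast
  then show False using V(2) by force
qed

text \<open>Near the regular point, \<open>f\<close> together with the projection along
  \<open>v\<close> gives holomorphic coordinates. They parametrize a piece of every nearby fibre by
  one ball of fixed radius, on which the density is at least \<open>m0\<close>.\<close>

lemma density_integral_bounded_below:
  assumes x0: "x0 \<in> fibre X f 0" and c: "c \<in> A" "x0 \<in> fst c" and i: "cpartial i (chart_f c) (snd c x0) \<noteq> 0"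
    and nz: "\<eta> c x0 \<noteq> 0"
  shows "\<exists>m>0. \<exists>\<epsilon>>0. \<forall>s. s \<noteq> 0 \<longrightarrow> cmod s < \<epsilon> \<longrightarrow>
    ennreal m \<le> density_integral (fibre_atlas X A f s) (fibre_form A f \<eta>)"
proof -
  let ?F = "chart_f c" and ?E = "chart_sec c" and ?U = "chart_dom c"
  define y0 where "y0 = snd c x0"
  have x0X: "x0 \<in> topspace X" "f x0 = 0" using x0 by (auto simp: fibre_def)
  have y0: "y0 \<in> ?U" "?F y0 = 0" "?E y0 = \<eta> c x0"
    using x0X V(2) c chartD(5)[OF c] by (auto simp: y0_def)
  note F = hol_chart_f[OF c(1)] and E = hol_sec_chart[OF c(1)] and U = open_chart_XV[OF c(1)]
  define v :: "complex ^ 'n option" where "v = axis i 1"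
  define a where "a = dirv ?F v y0"
  have a0: "a \<noteq> 0" using i by (simp add: a_def v_def dirv_axis y0_def)
  have "v \<noteq> 0" by (simp add: v_def axis_eq_0_iff)
  then obtain R :: "complex ^ 'n option ^ 'n option" where R: "invertible R" "R *v v = axis None 1"
    using exists_straightening by blast
  have dR: "det R \<noteq> 0" using R(1) by (simp add: invertible_det_nz)
  define b where "b = cmod (\<eta> c x0)"
  have b0: "b > 0" using nz by (simp add: b_def)
  obtain e where e: "e > 0" "\<And>y. dist y y0 < e \<Longrightarrow> dist (dirv ?F v y) a < cmod a / 2 \<and> dist (?E y) (?E y0) < b / 2 \<and> y \<in> ?U"
    using exists_ball_close[OF hol_fun_continuous_on[OF hol_fun_dirv[OF F U, of v]] hol_fun_continuous_on[OF E] U y0(1),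
      of "cmod a / 2" "b / 2"] a0 b0 unfolding a_def by auto
  define B where "B = ball y0 e"
  have inB: "dist (dirv ?F v y) a < cmod a / 2" "dist (?E y) (?E y0) < b / 2" "y \<in> ?U" if "y \<in> B" for y
    using e(2)[of y] that by (auto simp: B_def dist_commute)
  have BU: "B \<subseteq> ?U" using inB(3) by blast
  have oB: "open B" by (simp add: B_def)
  have dnz: "dirv ?F v y \<noteq> 0" "cmod (dirv ?F v y) \<le> 2 * cmod a" if "y \<in> B" for y
  proof -
    have 1: "cmod (dirv ?F v y - a) < cmod a / 2" using inB(1)[OF that] by (simp add: dist_norm)
    then show "dirv ?F v y \<noteq> 0" by auto
    show "cmod (dirv ?F v y) \<le> 2 * cmod a" using 1 norm_triangle_sub[of "dirv ?F v y" a] norm_ge_zero[of a] by linarith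
  qed
  have inj: "t = 0" if "z \<in> B" "z + t *s v \<in> B" "?F z = ?F (z + t *s v)" for z t
    by (rule dirv_injective_on_lines[OF F, of B]) (use inB that a0 in \<open>auto simp: B_def dist_norm less_imp_le\<close>)
  define cons :: "complex \<Rightarrow> complex ^ 'n \<Rightarrow> complex ^ 'n option" where
    "cons s w = (\<chi> i. case i of None \<Rightarrow> s | Some k \<Rightarrow> w $ k)" for s w
  define \<Phi> where "\<Phi> y = cons (?F y) (proj R y)" for y
  have \<Phi>h: "hol_map \<Phi> B"
    unfolding hol_map_def
  proof
    fix j
    show "hol_fun (\<lambda>z. \<Phi> z $ j) B"
    proof (cases j)
      case None then show ?thesis using hol_fun_subset[OF F BU] by (simp add: \<Phi>_def cons_def comp_def)
    next
      case (Some k)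
      have "hol_map (\<lambda>z. proj R z) B" by (rule hol_map_proj) (simp add: hol_map_def hol_fun_nth)
      then show ?thesis using Some by (simp add: \<Phi>_def cons_def hol_map_def)
    qed
  qed
  have cons_eq: "cons s w = cons s' w' \<longleftrightarrow> s = s' \<and> w = w'" for s s' w w'
  proof
    assume e: "cons s w = cons s' w'"
    have "s = s'" using arg_cong[OF e, of "\<lambda>u. u $ None"] by (simp add: cons_def)
    moreover have "w $ k = w' $ k" for k using arg_cong[OF e, of "\<lambda>u. u $ Some k"] by (simp add: cons_def)
    ultimately show "s = s' \<and> w = w'" by (simp add: vec_eq_iff)
  qed simp
  have \<Phi>inj: "inj_on \<Phi> B"
  proof (rule inj_onI)
    fix y z assume y: "y \<in> B" and z: "z \<in> B" and e: "\<Phi> y = \<Phi> z"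
    then have e: "?F y = ?F z" "proj R y = proj R z" by (auto simp: \<Phi>_def cons_eq)
    obtain t where t: "y = z + t *s v" using proj_eq_imp_line[OF R e(2)] by blast
    have "t = 0" using inj[OF z, of t] y t e(1) by simp
    then show "y = z" using t by simp
  qed
  note c\<Phi> = hol_map_continuous_on[OF \<Phi>h]
  have o\<Phi>: "open (\<Phi> ` B)" using invariance_of_domain[OF c\<Phi> oB \<Phi>inj] .
  obtain \<Psi> where hom: "homeomorphism B (\<Phi> ` B) \<Phi> \<Psi>"
    using invariance_of_domain_homeomorphism[OF oB c\<Phi> _ \<Phi>inj] by auto
  have \<Psi>: "\<Psi> (\<Phi> y) = y" if "y \<in> B" for y using hom that by (simp add: homeomorphism_def)
  have \<Psi>': "\<Phi> (\<Psi> u) = u" "\<Psi> u \<in> B" if "u \<in> \<Phi> ` B" for u using hom that by (auto simp: homeomorphism_def)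
  have c\<Psi>: "continuous_on (\<Phi> ` B) \<Psi>" using hom by (simp add: homeomorphism_def)
  have J\<Phi>: "cjacobian \<Phi> y *v u = cons (dirv ?F u y) (proj R u)" if y: "y \<in> B" for y u
  proof -
    have "((\<lambda>z. \<Phi> z) has_derivative (\<lambda>u. cons (dirv ?F u y) (proj R u))) (at y)"
    proof (rule has_derivative_vecI)
      fix j
      show "((\<lambda>z. \<Phi> z $ j) has_derivative (\<lambda>u. cons (dirv ?F u y) (proj R u) $ j)) (at y)"
      proof (cases j)
        case None
        then show ?thesis using hol_fun_has_derivative[OF F inB(3)[OF y]] by (simp add: \<Phi>_def cons_def dirv_def comp_def)
      next
        case (Some k)
        have "bounded_linear (\<lambda>z. proj R z $ k)"
          using bounded_linear_compose[OF bounded_linear_vec_nth linear_proj[of R, unfolded linear_conv_bounded_linear]] by simp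
        then show ?thesis using Some bounded_linear_imp_has_derivative by (simp add: \<Phi>_def cons_def)
      qed
    qed
    from has_derivative_unique[OF hol_map_has_derivative[OF \<Phi>h y] this] show ?thesis by (simp add: fun_eq_iff)
  qed
  \<comment> \<open>The inverse is differentiable by the inverse function theorem, and its
    derivative is given by a complex matrix, hence is complex linear.\<close>
  have \<Psi>h: "hol_map \<Psi> (\<Phi> ` B)"
    unfolding hol_map_def hol_fun_def
  proof (intro allI ballI)
    fix j u assume "u \<in> \<Phi> ` B"
    then obtain y where y: "y \<in> B" "u = \<Phi> y" by blast
    have "inj ((*v) (cjacobian \<Phi> y))"
    proof -
      have "u = 0" if "cjacobian \<Phi> y *v u = 0" for u
      proof -
        have c0: "cons (dirv ?F u y) (proj R u) = cons 0 0" using that unfolding J\<Phi>[OF y(1)]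
          by (simp add: cons_def vec_eq_iff split: option.split)
        then have "proj R u = proj R 0" by (simp add: cons_eq linear_0[OF linear_proj])
        from proj_eq_imp_line[OF R this] obtain t where t: "u = 0 + t *s v" by blast
        have "dirv ?F u y = t * dirv ?F v y" unfolding t dirv_def by (simp add: sum_distrib_left mult_ac)
        then have "t = 0" using c0 dnz(1)[OF y(1)] by (simp add: cons_eq)
        then show ?thesis using t by simp
      qed
      then show ?thesis
        by (intro injI) (metis (no_types, opaque_lifting) eq_iff_diff_eq_0 matrix_vector_mult_diff_distrib)
    qed
    then have "invertible (cjacobian \<Phi> y)" by (simp add: invertible_left_inverse matrix_left_invertible_injective)
    then obtain M where M: "cjacobian \<Phi> y ** M = mat 1" by (auto simp: invertible_def)
    have "(\<Psi> has_derivative (*v) M) (at (\<Phi> y))"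
    proof (rule has_derivative_inverse_strong[OF oB y(1) c\<Phi> \<Psi> hol_map_has_derivative[OF \<Phi>h y(1)]])
      show "(*v) (cjacobian \<Phi> y) \<circ> (*v) M = id" by (simp add: fun_eq_iff matrix_vector_mul_assoc M)
    qed
    from has_derivative_compose[OF this bounded_linear_imp_has_derivative[OF bounded_linear_vec_nth[of j]]]
    show "\<exists>D. ((\<lambda>z. \<Psi> z $ j) has_derivative D) (at u) \<and> (\<forall>a v. D (a *s v) = a * D v)"
      unfolding y(2) by (intro exI[of _ "\<lambda>u. (M *v u) $ j"] conjI) (auto simp: vector_scalar_commute)
  qed
  define w0 where "w0 = proj R y0"
  have "\<Phi> y0 = cons 0 w0" using y0 by (simp add: \<Phi>_def w0_def)
  moreover have "y0 \<in> B" using e(1) by (simp add: B_def)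
  ultimately have "cons 0 w0 \<in> \<Phi> ` B" by (metis imageI)
  then obtain \<delta> where \<delta>: "\<delta> > 0" "ball (cons 0 w0) \<delta> \<subseteq> \<Phi> ` B" using o\<Phi> open_contains_ball by blast
  have cons_norm: "norm (cons s w) \<le> cmod s + norm w" for s w
  proof -
    have "cons s w = axis None s + cons 0 w"
      by (simp add: cons_def vec_eq_iff axis_def split: option.split)
    moreover have "norm (cons 0 w) = norm w"
      by (simp add: norm_vec_def L2_set_def sum_UNIV_option cons_def)
    ultimately show ?thesis using norm_triangle_ineq[of "axis None s" "cons 0 w"] by (simp add: norm_axis_complex)
  qed
  have cons_in: "cons s w \<in> \<Phi> ` B" if "cmod s < \<delta> / 2" "w \<in> ball w0 (\<delta> / 2)" for s w
  proof -
    have "cons s w - cons 0 w0 = cons s (w - w0)"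
      by (simp add: cons_def vec_eq_iff split: option.split)
    then have "norm (cons s w - cons 0 w0) < \<delta>"
      using cons_norm[of s "w - w0"] that by (simp add: dist_norm norm_minus_commute)
    then show ?thesis using \<delta>(2) by (auto simp: dist_norm norm_minus_commute)
  qed
  \<comment> \<open>On \<open>B\<close> the section has modulus at least \<open>b / 2\<close> and
    the derivative at most \<open>2 * cmod a\<close>; in the chosen fibre coordinates the
    determinant in \<open>fibre_form\<close> is the inverse of \<open>det R\<close>.\<close>
  define m0 where "m0 = (b / 2 / (cmod (det R) * (2 * cmod a)))\<^sup>2"
  have m0: "m0 > 0" using b0 dR a0 by (simp add: m0_def)
  have "ennreal (m0 * measure lborel (ball w0 (\<delta> / 2))) \<le> density_integral (fibre_atlas X A f s) (fibre_form A f \<eta>)"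
    if s: "s \<noteq> 0" "cmod s < \<delta> / 2" for s
  proof -
    let ?D = "ball w0 (\<delta> / 2)"
    define y where "y w = \<Psi> (cons s w)" for w
    \<comment> \<open>The piece of the fibre over \<open>s\<close>, charted by the projection; its
      inverse \<open>g\<close> goes through \<open>\<Psi>\<close> and the chart
      \<open>c\<close>.\<close>
    define O' where "O' = {x \<in> fst c. snd c x \<in> B \<and> f x = s \<and> proj R (snd c x) \<in> ?D}"
    define d where "d = (O', \<lambda>x. proj R (snd c x))"
    have yB: "y w \<in> B" and \<Phi>y: "?F (y w) = s" "proj R (y w) = w" if "w \<in> ?D" for w
    proof -
      have i: "cons s w \<in> \<Phi> ` B" by (rule cons_in[OF s(2) that])
      show "y w \<in> B" unfolding y_def by (rule \<Psi>'(2)[OF i])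
      have "cons (?F (y w)) (proj R (y w)) = cons s w" using \<Psi>'(1)[OF i] by (simp add: y_def \<Phi>_def)
      then show "?F (y w) = s" "proj R (y w) = w" by (auto simp: cons_eq)
    qed
    define g where "g w = chart_inv c (y w)" for w
    have yU: "y w \<in> snd c ` fst c" if "w \<in> ?D" for w using BU yB[OF that] by blast
    have g: "g w \<in> O'" "snd c (g w) = y w" if "w \<in> ?D" for w
      using chartD(6,7)[OF c(1) yU[OF that]] yB[OF that] \<Phi>y[OF that] that by (auto simp: O'_def g_def)
    have sd: "snd d x \<in> ?D \<and> g (snd d x) = x" if x: "x \<in> O'" for x
    proof -
      have "\<Phi> (snd c x) = cons s (snd d x)"
        using x chartD(5)[OF c(1)] by (simp add: \<Phi>_def d_def O'_def)
      then have "y (snd d x) = snd c x" using \<Psi>[of "snd c x"] x by (simp add: y_def O'_def)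
      then show ?thesis using x chartD(5)[OF c(1)] by (simp add: g_def O'_def d_def)
    qed
    have img: "snd d ` O' = ?D"
    proof
      show "snd d ` O' \<subseteq> ?D" using sd by blast
      show "?D \<subseteq> snd d ` O'"
      proof
        fix w assume w: "w \<in> ?D"
        have "snd d (g w) = w" using g[OF w] \<Phi>y(2)[OF w] by (simp add: d_def)
        then show "w \<in> snd d ` O'" using g(1)[OF w] by (metis imageI)
      qed
    qed
    have injd: "inj_on (snd d) O'" using sd by (metis inj_on_inverseI)
    have ci: "chart_inv d w = g w" if "w \<in> ?D" for w
    proof -
      have "snd d (g w) = w" using g[OF that] \<Phi>y(2)[OF that] by (simp add: d_def)
      then show ?thesis unfolding chart_inv_def
        using inv_into_f_f[OF injd g(1)[OF that]] by (simp add: d_def)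
    qed
    have yh: "hol_map y ?D"
      unfolding y_def
    proof (rule hol_map_compose[OF _ \<Psi>h])
      show "hol_map (cons s) ?D"
        unfolding hol_map_def
      proof
        fix j show "hol_fun (\<lambda>w. cons s w $ j) ?D"
          by (cases j) (simp_all add: cons_def hol_fun_const hol_fun_nth)
      qed
    qed (use cons_in[OF s(2)] in auto)
    have O'X: "O' \<subseteq> topspace X" using chartD(4)[OF c(1)] by (auto simp: O'_def)
    have O'f: "O' \<subseteq> fibre X f s" using O'X by (auto simp: O'_def fibre_def)
    have tc: "topological_chart (subtopology X (fibre X f s)) d"
      unfolding topological_chart_def
    proof (intro conjI)
      have "open (B \<inter> proj R -` ?D)"
        using oB linear_continuous_on[OF linear_proj[of R, unfolded linear_conv_bounded_linear]]
        by (intro open_Int open_vimage) auto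
      from topological_chart_open_preimage[OF chart[OF c(1)] this]
      have "openin X {x \<in> fst c. snd c x \<in> B \<inter> proj R -` ?D}" .
      moreover have "O' = fibre X f s \<inter> {x \<in> fst c. snd c x \<in> B \<inter> proj R -` ?D}"
        using O'X by (auto simp: O'_def fibre_def)
      ultimately show "openin (subtopology X (fibre X f s)) (fst d)"
        unfolding d_def fst_conv by (simp only: openin_subtopology_Int2)
      show "open (snd d ` fst d)" using img by (simp add: d_def)
      have "homeomorphic_maps (subtopology X O') (top_of_set ?D) (snd d) g"
        unfolding homeomorphic_maps_def
      proof (intro conjI)
        have h: "homeomorphic_map (subtopology X (fst c)) (top_of_set (snd c ` fst c)) (snd c)"
          using chart[OF c(1)] by (auto simp: topological_chart_def)
        have "continuous_map (subtopology X (fst c)) euclidean (snd c)"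
          using homeomorphic_imp_continuous_map[OF h] continuous_map_into_fulltopology by blast
        then have "continuous_map (subtopology X O') euclidean (snd c)"
          by (rule continuous_map_from_subtopology_mono) (auto simp: O'_def)
        moreover have "continuous_map euclidean euclidean (proj R)"
          using linear_continuous_on[OF linear_proj[of R, unfolded linear_conv_bounded_linear]] by simp
        ultimately have "continuous_map (subtopology X O') euclidean (proj R \<circ> snd c)"
          by (rule continuous_map_compose)
        then show "continuous_map (subtopology X O') (top_of_set ?D) (snd d)"
          using sd by (auto simp: continuous_map_in_subtopology d_def comp_def)
        \<comment> \<open>\<open>chart_inv c\<close> has arbitrary values off the chart image, so
          continuity is read off from the topological inverse \<open>k\<close>, with which it agrees
          on that image.\<close>
        obtain k where k: "homeomorphic_maps (subtopology X (fst c)) (top_of_set (snd c ` fst c)) (snd c) k"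
          using h by (auto simp: homeomorphic_map_maps)
        have kc: "k z = chart_inv c z" if z: "z \<in> snd c ` fst c" for z
        proof -
          obtain x where x: "x \<in> fst c" "z = snd c x" using z by blast
          have "k (snd c x) = x" using k x(1) chartD(4)[OF c(1)]
            by (auto simp: homeomorphic_maps_def)
          then show ?thesis using x chartD(5)[OF c(1)] by simp
        qed
        have "continuous_map (top_of_set (snd c ` fst c)) (subtopology X (fst c)) k"
          using k by (simp add: homeomorphic_maps_def)
        moreover have "continuous_map (top_of_set ?D) (top_of_set (snd c ` fst c)) y"
          using hol_map_continuous_on[OF yh] yU by (auto simp: continuous_map_in_subtopology)
        ultimately have "continuous_map (top_of_set ?D) (subtopology X (fst c)) (k \<circ> y)"
          by (rule continuous_map_compose[rotated])
        then have "continuous_map (top_of_set ?D) X (k \<circ> y)" by (simp add: continuous_map_in_subtopology)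
        moreover have "(k \<circ> y) w = g w" if "w \<in> topspace (top_of_set ?D)" for w
          using kc[OF yU] that by (simp add: g_def)
        ultimately have "continuous_map (top_of_set ?D) X g" by (rule continuous_map_eq)
        then show "continuous_map (top_of_set ?D) (subtopology X O') g"
          using g(1) by (auto simp: continuous_map_in_subtopology)
        show "\<forall>x\<in>topspace (subtopology X O'). g (snd d x) = x" using sd by auto
        show "\<forall>w\<in>topspace (top_of_set ?D). snd d (g w) = w"
          using g \<Phi>y(2) by (auto simp: d_def)
      qed
      then have "homeomorphic_map (subtopology X O') (top_of_set ?D) (snd d)"
        using homeomorphic_map_maps by blast
      moreover have "subtopology (subtopology X (fibre X f s)) (fst d) = subtopology X O'"
        using O'f by (simp add: d_def subtopology_subtopology inf.absorb2)
      ultimately show "homeomorphic_map (subtopology (subtopology X (fibre X f s)) (fst d)) (top_of_set (snd d ` fst d)) (snd d)"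
        using img by (simp add: d_def)
    qed
    have fd: "fst d = O'" by (simp add: d_def)
    have dA: "d \<in> fibre_atlas X A f s"
      unfolding fibre_atlas_def
    proof (intro CollectI conjI tc ballI)
      fix c' assume c': "c' \<in> A"
      let ?W = "snd d ` (fst d \<inter> fst c')"
      have oW: "open ?W"
      proof -
        have "openin (subtopology X (fibre X f s)) (fibre X f s \<inter> fst c')"
          using chartD(1)[OF c'] by (rule openin_subtopology_Int2)
        from topological_chart_open_image[OF tc this]
        have "open (snd d ` (fst d \<inter> (fibre X f s \<inter> fst c')))" .
        moreover have "fst d \<inter> (fibre X f s \<inter> fst c') = fst d \<inter> fst c'" using O'f by (auto simp: fd)
        ultimately show ?thesis by simp
      qed
      have WD: "?W \<subseteq> ?D" using img by (auto simp: fd)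
      have Wg: "g w \<in> fst c' \<and> g w \<in> fst c \<and> g w \<in> O'" if "w \<in> ?W" for w
        using that sd by (auto simp: fd O'_def)
      have 1: "hol_map (\<lambda>w. (snd c' \<circ> chart_inv c) (y w)) ?W"
      proof (rule hol_map_compose[OF hol_map_subset[OF yh WD] transition[OF c(1) c']])
        show "y ` ?W \<subseteq> snd c ` (fst c \<inter> fst c')"
        proof
          fix u assume "u \<in> y ` ?W"
          then obtain w where w: "w \<in> ?W" "u = y w" by blast
          then show "u \<in> snd c ` (fst c \<inter> fst c')" using Wg[OF w(1)] g(2)[of w] WD by (metis IntI imageI subsetD)
        qed
      qed
      have eq: "(snd c' \<circ> chart_inv c) (y w) = (snd c' \<circ> chart_inv d) w" if "w \<in> ?W" for w
        using ci[of w] WD that by (auto simp: g_def)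
      show H: "hol_map (snd c' \<circ> chart_inv d) ?W"
        unfolding hol_map_def
      proof
        fix j
        have "hol_fun (\<lambda>w. (snd c' \<circ> chart_inv c) (y w) $ j) ?W" using 1 by (simp add: hol_map_def)
        then show "hol_fun (\<lambda>w. (snd c' \<circ> chart_inv d) w $ j) ?W"
          by (rule hol_fun_transform[OF _ oW]) (simp only: eq)
      qed
      fix w assume w: "w \<in> ?W"
      \<comment> \<open>\<open>?K\<close> recovers the coordinates on the piece, so its Jacobian is
        a left inverse of that of \<open>?H\<close>, which is therefore an immersion.\<close>
      let ?H = "snd c' \<circ> chart_inv d" and ?K = "\<lambda>u. proj R ((snd c \<circ> chart_inv c') u)"
      have Kh: "hol_map ?K (snd c' ` (fst c' \<inter> fst c))" by (rule hol_map_proj[OF transition[OF c' c(1)]])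
      have Hin: "?H w' \<in> snd c' ` (fst c' \<inter> fst c)" "?K (?H w') = w'" if "w' \<in> ?W" for w'
      proof -
        have w'D: "w' \<in> ?D" using that WD by blast
        have "chart_inv d w' = g w'" by (rule ci[OF w'D])
        moreover note Wg[OF that] g[OF w'D] \<Phi>y(2)[OF w'D]
        ultimately show "?H w' \<in> snd c' ` (fst c' \<inter> fst c)" "?K (?H w') = w'"
          using chartD(5)[OF c'] by auto
      qed
      have "cjacobian (\<lambda>w. ?K (?H w)) w = cjacobian ?K (?H w) ** cjacobian ?H w"
        by (rule cjacobian_compose[OF H w Kh Hin(1)[OF w]])
      moreover have "cjacobian (\<lambda>w. ?K (?H w)) w = mat 1"
        by (rule cjacobian_eq_mat_1[OF oW w Hin(2)])
      ultimately have "cjacobian ?K (?H w) ** cjacobian ?H w = mat 1" by simp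
      then show "inj ((*v) (cjacobian ?H w))" using matrix_left_invertible_injective by blast
    qed
    have sV: "s \<in> V"
    proof -
      have "y w0 \<in> ?U" using BU yB[of w0] \<delta>(1) by auto
      then obtain x where "x \<in> XV" "x \<in> fst c" "y w0 = snd c x" by blast
      then show ?thesis using \<Phi>y(1)[of w0] \<delta>(1) chartD(5)[OF c(1)] by auto
    qed
    have lower: "m0 \<le> (cmod (fibre_form A f \<eta> d (chart_inv d w)))\<^sup>2" if w: "w \<in> ?D" for w
    proof -
      let ?x = "g w" and ?G = "snd c \<circ> chart_inv d"
      have x: "?x \<in> fst d" "?x \<in> fst c" "snd d ?x = w" "snd c ?x = y w"
        using g[OF w] \<Phi>y(2)[OF w] by (auto simp: d_def O'_def)
      have "\<eta> c ?x * det (cons_col v (cjacobian ?G (snd d ?x))) = dirv ?F v (snd c ?x) * fibre_form A f \<eta> d ?x"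
        by (rule fibre_form_eq[OF s(1) sV dA x(1) c(1) x(2)])
      then have eq: "\<eta> c ?x * det (cons_col v (cjacobian ?G w)) = dirv ?F v (y w) * fibre_form A f \<eta> d ?x"
        by (simp only: x(3,4))
      have Gh: "hol_map ?G (snd d ` (fst d \<inter> fst c))" by (rule fibre_immersion[OF dA c(1)])
      have wW: "w \<in> snd d ` (fst d \<inter> fst c)" using x by (metis IntI imageI)
      \<comment> \<open>In these coordinates projecting is the identity map, so its Jacobian
        determinant is 1.\<close>
      have "det R * det (cons_col v (cjacobian ?G w)) = det (cjacobian (\<lambda>w. proj R (?G w)) w)"
        unfolding det_cons_col[OF R(2)] cjacobian_proj[OF Gh wW] ..
      also have "cjacobian (\<lambda>w. proj R (?G w)) w = mat 1"
        by (rule cjacobian_eq_mat_1[OF open_ball w]) (use ci g \<Phi>y(2) in auto)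
      finally have dets: "det R * det (cons_col v (cjacobian ?G w)) = 1" by (simp only: det_I)
      have "cmod (\<eta> c ?x) = cmod (det R) * cmod (dirv ?F v (y w)) * cmod (fibre_form A f \<eta> d ?x)"
      proof -
        have "\<eta> c ?x = \<eta> c ?x * (det R * det (cons_col v (cjacobian ?G w)))" by (simp add: dets)
        also have "\<dots> = det R * (\<eta> c ?x * det (cons_col v (cjacobian ?G w)))" by (simp only: mult_ac)
        also have "\<dots> = det R * (dirv ?F v (y w) * fibre_form A f \<eta> d ?x)" by (simp only: eq)
        finally show ?thesis by (metis norm_mult mult.assoc)
      qed
      moreover have "b / 2 \<le> cmod (\<eta> c ?x)"
      proof -
        have "?E (y w) = \<eta> c ?x" by (simp add: g_def)
        then have "cmod (\<eta> c ?x - \<eta> c x0) < b / 2" using inB(2)[OF yB[OF w]] y0(3) by (simp add: dist_norm)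
        then show ?thesis using norm_triangle_sub[of "\<eta> c x0" "\<eta> c ?x"] by (simp add: b_def norm_minus_commute)
      qed
      moreover have "cmod (det R) * cmod (dirv ?F v (y w)) * cmod (fibre_form A f \<eta> d ?x)
          \<le> cmod (det R) * (2 * cmod a) * cmod (fibre_form A f \<eta> d ?x)"
        by (intro mult_right_mono mult_left_mono dnz(2)[OF yB[OF w]]) auto
      ultimately have "b / 2 \<le> cmod (det R) * (2 * cmod a) * cmod (fibre_form A f \<eta> d ?x)" by linarith
      then have "b / 2 / (cmod (det R) * (2 * cmod a)) \<le> cmod (fibre_form A f \<eta> d ?x)"
        using dR a0 by (subst pos_divide_le_eq) (auto simp: mult_ac)
      then have "m0 \<le> (cmod (fibre_form A f \<eta> d ?x))\<^sup>2"
        unfolding m0_def using b0 by (intro power_mono) auto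
      then show ?thesis by (simp add: ci[OF w])
    qed
    have "ennreal (m0 * measure lborel ?D) = (\<integral>\<^sup>+ w\<in>?D. ennreal m0 \<partial>lborel)"
    proof -
      have "(\<integral>\<^sup>+ w\<in>?D. ennreal m0 \<partial>lborel) = ennreal m0 * emeasure lborel ?D"
        by (rule nn_integral_cmult_indicator) simp
      also have "emeasure lborel ?D = ennreal (measure lborel ?D)"
        using emeasure_lborel_ball_finite[of w0 "\<delta> / 2"] by (intro emeasure_eq_ennreal_measure) (simp add: less_top)
      finally show ?thesis using m0 by (simp add: ennreal_mult)
    qed
    also have "\<dots> \<le> (\<integral>\<^sup>+ w\<in>snd d ` O'. ennreal ((cmod (fibre_form A f \<eta> d (chart_inv d w)))\<^sup>2) \<partial>lborel)"
      unfolding img by (rule nn_integral_mono) (use lower in \<open>auto simp: indicator_def intro!: ennreal_leI\<close>)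
    \<comment> \<open>A family consisting of a single piece, admissible in the supremum.\<close>
    also have "\<dots> = (\<Sum>(d, E)\<in>{(d, O')}. \<integral>\<^sup>+ w\<in>snd d ` E. ennreal ((cmod (fibre_form A f \<eta> d (chart_inv d w)))\<^sup>2) \<partial>lborel)"
      by simp
    also have "\<dots> \<le> density_integral (fibre_atlas X A f s) (fibre_form A f \<eta>)"
      unfolding density_integral_def
      by (rule SUP_upper) (use dA img in \<open>auto simp: fd\<close>)
    finally show ?thesis .
  qed
  moreover have "0 < m0 * measure lborel (ball w0 (\<delta> / 2))"
    using m0 \<delta>(1) content_ball_pos[of "\<delta> / 2" w0] by simp
  ultimately show ?thesis using \<delta>(1) by (meson half_gt_zero)
qed

end

subsection \<open>The asymptotics\<close>

text \<open>Setting \<open>cmod s = exp (- x / 2)\<close> turns the expression into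
  \<open>- (\<alpha> * x + \<beta> * ln x)\<close> for large \<open>x\<close>. Division by
  \<open>x\<close> gives \<open>\<alpha> = 0\<close>, and then division by \<open>ln x\<close> gives
  \<open>\<beta> = 0\<close>.\<close>

lemma log_combination_bounded_imp_zero:
  fixes \<alpha> \<beta> :: real
  assumes "(\<lambda>s. \<alpha> * ln ((cmod s)\<^sup>2) - \<beta> * ln \<bar>ln ((cmod s)\<^sup>2)\<bar>) \<in> O[at 0](\<lambda>_. 1)"
  shows "\<alpha> = 0 \<and> \<beta> = 0"
proof -
  obtain c where ev: "\<forall>\<^sub>F s in at 0. norm (\<alpha> * ln ((cmod s)\<^sup>2) - \<beta> * ln \<bar>ln ((cmod s)\<^sup>2)\<bar>) \<le> c * norm (1::real)"
    using assms by (rule landau_o.bigE)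
  have "((\<lambda>x. complex_of_real (exp (- x / 2))) \<longlongrightarrow> complex_of_real 0) at_top"
  proof (intro tendsto_of_real)
    have "filterlim (\<lambda>x::real. - x / 2) at_bot at_top"
      unfolding filterlim_at_bot eventually_at_top_linorder
    proof
      fix Z :: real
      show "\<exists>N. \<forall>n\<ge>N. - n / 2 \<le> Z" by (rule exI[of _ "- 2 * Z"]) auto
    qed
    then show "((\<lambda>x::real. exp (- x / 2)) \<longlongrightarrow> 0) at_top" by (rule filterlim_compose[OF exp_at_bot])
  qed
  then have fl: "filterlim (\<lambda>x. complex_of_real (exp (- x / 2))) (at 0) at_top"
    by (intro filterlim_atI) (auto intro!: always_eventually)
  have bd: "\<forall>\<^sub>F x in at_top. \<bar>\<alpha> * x + \<beta> * ln x\<bar> \<le> c"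
    using filterlim_iff[THEN iffD1, OF fl, rule_format, OF ev] eventually_gt_at_top[of 0]
  proof eventually_elim
    case (elim x)
    have "(cmod (complex_of_real (exp (- x / 2))))\<^sup>2 = exp (- x)"
      by (simp add: power2_eq_square flip: exp_add)
    then show ?case using elim by (simp add: abs_minus_commute algebra_simps abs_if split: if_splits)
  qed
  have lnx: "((\<lambda>x::real. ln x / x) \<longlongrightarrow> 0) at_top" by (rule ln_x_over_x_tendsto_0)
  have "((\<lambda>x. \<alpha> + \<beta> * (ln x / x)) \<longlongrightarrow> \<alpha> + \<beta> * 0) at_top" by (intro tendsto_intros lnx)
  moreover have "((\<lambda>x. \<alpha> + \<beta> * (ln x / x)) \<longlongrightarrow> 0) at_top"
  proof (rule Lim_null_comparison)
    show "((\<lambda>x. c * inverse x) \<longlongrightarrow> 0) at_top"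
      using tendsto_mult_right_zero[OF tendsto_inverse_0_at_top[OF filterlim_ident]] by simp
    show "\<forall>\<^sub>F x in at_top. norm (\<alpha> + \<beta> * (ln x / x)) \<le> c * inverse x"
      using bd eventually_gt_at_top[of 0]
    proof eventually_elim
      case (elim x)
      have "\<alpha> + \<beta> * (ln x / x) = (\<alpha> * x + \<beta> * ln x) / x" using elim(2) by (simp add: field_simps)
      then show ?case using elim by (simp add: divide_inverse abs_mult mult_right_mono)
    qed
  qed
  ultimately have \<alpha>: "\<alpha> = 0" using tendsto_unique[OF trivial_limit_at_top_linorder] by fastforce
  have "((\<lambda>x::real. \<beta>) \<longlongrightarrow> 0) at_top"
  proof (rule Lim_null_comparison)
    show "((\<lambda>x. c * inverse (ln x)) \<longlongrightarrow> 0) at_top"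
      using tendsto_mult_right_zero[OF tendsto_inverse_0_at_top[OF ln_at_top]] by simp
    show "\<forall>\<^sub>F x::real in at_top. norm \<beta> \<le> c * inverse (ln x)"
      using bd eventually_gt_at_top[of 1]
    proof eventually_elim
      case (elim x)
      then have "\<bar>\<beta>\<bar> * ln x \<le> c" by (simp add: \<alpha> abs_mult)
      then show ?case using elim(2) by (simp add: divide_inverse[symmetric] pos_le_divide_eq)
    qed
  qed
  then have "\<beta> = 0" by (simp add: tendsto_const_iff)
  then show ?thesis using \<alpha> by simp
qed

text \<open>The modulus of the constant in \<open>wedge_cnj_integral\<close> is
  \<open>2 ^ CARD('n)\<close>, which cancels against the normalization by powers of
  \<open>2 * pi\<close>.\<close>

lemma L2_norm_sq_eq:
  "L2_norm_sq X (A :: ('a, 'n::finite option) chart set) f \<eta> s =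
    enn2real (density_integral (fibre_atlas X A f s) (fibre_form A f \<eta>)) / pi ^ CARD('n)"
  by (simp add: L2_norm_sq_def wedge_cnj_integral_def norm_mult norm_power power_mult_distrib)

text \<open>The equivalence contains both assertions about the coefficients: the asymptotics hold
  with both equal to 0, and no other pair satisfies them.\<close>

theorem proposition2p8:
  fixes X :: "'a topology" and A :: "('a, 'n::finite option) chart set"
    and f :: "'a \<Rightarrow> complex" and r :: real
    and V :: "complex set" and \<eta> :: "('a, 'n option) chart \<Rightarrow> 'a \<Rightarrow> complex"
    and \<alpha> \<beta> :: real
  assumes "degeneration X A f r"
    and "\<And>s. s \<in> ball 0 r - {0} \<Longrightarrow>
           trivial_canonical_bundle (fibre_atlas X A f s) (fibre X f s)"
    and "CARD('n) \<ge> 2"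
    and "\<And>x. x \<in> fibre X f 0 \<Longrightarrow> critical_point A f x \<Longrightarrow>
           ordinary_quadratic_singularity X A f x"
    and "direct_image_frame X A f r V \<eta>"
  shows "L2_asymptotics X A f \<eta> \<alpha> \<beta> \<longleftrightarrow> \<alpha> = 0 \<and> \<beta> = 0"
proof -
  interpret degeneration_family X A f r V \<eta>
    by standard (use assms(1,5) in \<open>auto simp: direct_image_frame_def\<close>)
  let ?D = "\<lambda>s. density_integral (fibre_atlas X A f s) (fibre_form A f \<eta>)"
  obtain C \<epsilon>1 where C: "C < \<infinity>" "\<epsilon>1 > 0" "\<And>s. s \<noteq> 0 \<Longrightarrow> cmod s < \<epsilon>1 \<Longrightarrow> ?D s \<le> C"
    using density_integral_bounded[OF assms(3,4)] by blast
  obtain m \<epsilon>2 where m: "m > 0" "\<epsilon>2 > 0" "\<And>s. s \<noteq> 0 \<Longrightarrow> cmod s < \<epsilon>2 \<Longrightarrow> ennreal m \<le> ?D s"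
    using exists_nonvanishing_regular_point[OF assms(4,5)] density_integral_bounded_below by blast
  let ?L = "L2_norm_sq X A f \<eta>"
  define lo where "lo = m / pi ^ CARD('n)"
  define hi where "hi = enn2real C / pi ^ CARD('n)"
  have "lo > 0" using m(1) by (simp add: lo_def)
  have L: "lo \<le> ?L s" "?L s \<le> hi" if s: "s \<noteq> 0" "cmod s < min \<epsilon>1 \<epsilon>2" for s
  proof -
    have D: "ennreal m \<le> ?D s" "?D s \<le> C" using C(3) m(3) s by auto
    \<comment> \<open>\<open>enn2real\<close> sends infinity to 0, so even the lower bound for the
      norm requires finiteness.\<close>
    have "?D s < \<infinity>" by (rule le_less_trans[OF D(2) C(1)])
    then have "m \<le> enn2real (?D s)" using D(1) m(1)
      by (metis enn2real_ennreal enn2real_mono infinity_ennreal_def less_imp_le)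
    moreover have "enn2real (?D s) \<le> enn2real C" using D(2) C(1) by (intro enn2real_mono) auto
    ultimately show "lo \<le> ?L s" "?L s \<le> hi"
      unfolding L2_norm_sq_eq lo_def hi_def by (intro divide_right_mono; simp)+
  qed
  have bounded: "(\<lambda>s. - ln (?L s)) \<in> O[at 0](\<lambda>_. 1)"
  \<comment> \<open>Adding 1 keeps the constant positive even when both logarithms vanish.\<close>
  proof (rule landau_o.bigI[of "max \<bar>ln lo\<bar> \<bar>ln hi\<bar> + 1"])
    have "\<forall>\<^sub>F s in at 0. s \<noteq> 0 \<and> cmod s < min \<epsilon>1 \<epsilon>2"
      unfolding eventually_at using C(2) m(2) by (intro exI[of _ "min \<epsilon>1 \<epsilon>2"]) auto
    then show "\<forall>\<^sub>F s in at 0. norm (- ln (?L s)) \<le> (max \<bar>ln lo\<bar> \<bar>ln hi\<bar> + 1) * norm (1::real)"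
    proof eventually_elim
      case (elim s)
      have "ln lo \<le> ln (?L s)" "ln (?L s) \<le> ln hi"
        using L[of s] elim \<open>lo > 0\<close> by (auto intro!: ln_mono)
      then show ?case by (simp add: abs_le_iff) linarith
    qed
  qed (simp add: add_nonneg_pos)
  show ?thesis
  proof
    assume "L2_asymptotics X A f \<eta> \<alpha> \<beta>"
    then have "(\<lambda>s. - ln (?L s) - (\<alpha> * ln ((cmod s)\<^sup>2) - \<beta> * ln \<bar>ln ((cmod s)\<^sup>2)\<bar>)) \<in> O[at 0](\<lambda>_. 1)"
      by (simp add: L2_asymptotics_def)
    from sum_in_bigo(2)[OF bounded this]
    have "(\<lambda>s. \<alpha> * ln ((cmod s)\<^sup>2) - \<beta> * ln \<bar>ln ((cmod s)\<^sup>2)\<bar>) \<in> O[at 0](\<lambda>_. 1)"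
      by (simp add: algebra_simps)
    then show "\<alpha> = 0 \<and> \<beta> = 0" by (rule log_combination_bounded_imp_zero)
  next
    assume "\<alpha> = 0 \<and> \<beta> = 0"
    then show "L2_asymptotics X A f \<eta> \<alpha> \<beta>" using bounded by (simp add: L2_asymptotics_def)
  qed
qed

end
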